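(* Let $d\ge 1$ and let $V\in L^\infty_{\mathrm{loc}}(\mathbb{R}^d)$ be real-valued such that $H=-\Delta+V$ is a self-adjoint operator on $L^2(\mathbb{R}^d)$ with $H\ge 0$. Suppose there is $R_0>1$ such that for all $|x|\ge R_0$ $$V(x)\ \le\ \frac{d(4-d)}{4|x|^2}+\frac{1}{|x|^2\ln|x|}+\frac{3}{4|x|^2(\ln|x|)^2}.$$ Then $H$ has no ground state with energy $0$, i.e. there is no nonzero $\psi\in L^2(\mathbb{R}^d)$ in the domain of $H$ with $H\psi=0$.
   Context: $H\ge0$ means $\langle\psi,H\psi\rangle\ge0$ for all $\psi$ in the domain of $H$. *)

theory Defs
  imports "HOL-Analysis.Analysis"
begin

text \<open>Functions on R^d are modelled on the type real^'n (d = CARD('n) \<ge> 1).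
 Elements of L^2(R^d) are represented by their (complex-valued) representatives.\<close>

definition L2 :: "(real^'n \<Rightarrow> complex) \<Rightarrow> bool" where
  "L2 f \<longleftrightarrow> f \<in> borel_measurable lborel \<and> integrable lborel (\<lambda>x. (cmod (f x))\<^sup>2)"

definition ip :: "(real^'n \<Rightarrow> complex) \<Rightarrow> (real^'n \<Rightarrow> complex) \<Rightarrow> complex" where
  "ip f g = (LINT x|lborel. cnj (f x) * g x)"

text \<open>An (unbounded) operator on L^2 is given by its graph (a set of pairs of representatives).\<close>

definition adjoint_graph ::
  "((real^'n \<Rightarrow> complex) \<times> (real^'n \<Rightarrow> complex)) set \<Rightarrow> ((real^'n \<Rightarrow> complex) \<times> (real^'n \<Rightarrow> complex)) set" where
  "adjoint_graph H = {(u, w). L2 u \<and> L2 w \<and> (\<forall>(f, g) \<in> H. ip g u = ip f w)}"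

definition self_adjoint_op ::
  "((real^'n \<Rightarrow> complex) \<times> (real^'n \<Rightarrow> complex)) set \<Rightarrow> bool" where
  "self_adjoint_op H \<longleftrightarrow>
     (\<forall>(f, g) \<in> H. L2 f \<and> L2 g) \<and>
     (\<forall>(f, g) \<in> H. \<forall>(f', g') \<in> H. (AE x in lborel. f x = f' x) \<longrightarrow> (AE x in lborel. g x = g' x)) \<and>
     H = adjoint_graph H"

definition nonneg_op ::
  "((real^'n \<Rightarrow> complex) \<times> (real^'n \<Rightarrow> complex)) set \<Rightarrow> bool" where
  "nonneg_op H \<longleftrightarrow> (\<forall>(f, g) \<in> H. 0 \<le> Re (ip f g))"

definition partial :: "'n \<Rightarrow> (real^'n \<Rightarrow> complex) \<Rightarrow> real^'n \<Rightarrow> complex" where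
  "partial i f x = frechet_derivative f (at x) (axis i 1)"

primrec Ck :: "nat \<Rightarrow> (real^'n \<Rightarrow> complex) \<Rightarrow> bool" where
  "Ck 0 f \<longleftrightarrow> continuous_on UNIV f"
| "Ck (Suc k) f \<longleftrightarrow> (\<forall>x. f differentiable (at x)) \<and> continuous_on UNIV f \<and> (\<forall>i. Ck k (partial i f))"

definition smooth :: "(real^'n \<Rightarrow> complex) \<Rightarrow> bool" where
  "smooth f \<longleftrightarrow> (\<forall>k. Ck k f)"

definition test_fun :: "(real^'n \<Rightarrow> complex) \<Rightarrow> bool" where
  "test_fun f \<longleftrightarrow> smooth f \<and> compact (closure {x. f x \<noteq> 0})"

definition laplacian :: "(real^'n \<Rightarrow> complex) \<Rightarrow> real^'n \<Rightarrow> complex" where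
  "laplacian f x = (\<Sum>i\<in>UNIV. partial i (partial i f) x)"

definition Linfty_loc :: "(real^'n \<Rightarrow> real) \<Rightarrow> bool" where
  "Linfty_loc V \<longleftrightarrow> V \<in> borel_measurable lborel \<and>
     (\<forall>K. compact K \<longrightarrow> (\<exists>C. AE x in lborel. x \<in> K \<longrightarrow> \<bar>V x\<bar> \<le> C))"

definition schroedinger_realisation ::
  "(real^'n \<Rightarrow> real) \<Rightarrow> ((real^'n \<Rightarrow> complex) \<times> (real^'n \<Rightarrow> complex)) set \<Rightarrow> bool" where
  "schroedinger_realisation V H \<longleftrightarrow> self_adjoint_op H \<and>
     (\<forall>\<phi>. test_fun \<phi> \<longrightarrow> (\<phi>, (\<lambda>x. - laplacian \<phi> x + complex_of_real (V x) * \<phi> x)) \<in> H)"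

end

theory Submission
  imports Defs
begin

text \<open>The function \<open>u = |x| powr (-d/2) * (ln |x|) powr (-1/2)\<close> satisfies \<open>\<Delta>u = W u\<close>, where \<open>W\<close> is
  the assumed upper bound on \<open>V\<close>, and it just fails to be square integrable at infinity.
  If \<open>h\<close> is locally square integrable with \<open>h\<^sup>+ (V h - \<Delta>h) \<le> 0\<close> in the weak sense, then the energy of \<open>\<zeta> h\<^sup>+\<close>
  is at most the integral of \<open>|\<nabla>\<zeta>|\<^sup>2 (h\<^sup>+)\<^sup>2\<close>, which vanishes as the cutoff \<open>\<zeta>\<close> is removed; as \<open>H\<close> is
  nonnegative, the Cauchy-Schwarz argument shows that \<open>h\<^sup>+\<close> is itself a zero-energy solution. This
  needs only that the integral of \<open>(h\<^sup>+)\<^sup>2\<close> over the ball of radius \<open>R\<close> is \<open>o(R\<^sup>2)\<close>.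
  Applied to the real and imaginary parts of a zero mode and their negatives, this yields a solution
  \<open>p \<ge> 0\<close>; if \<open>p\<close> is not zero, a mean value inequality bounds it below by a positive constant on
  every ball. Applied to \<open>h = e u - p\<close>, with \<open>e\<close> so small that \<open>h \<le> 0\<close> on a large ball, it yields
  a nonnegative solution \<open>h\<^sup>+\<close> vanishing on a ball, hence everywhere. So \<open>p \<ge> e u\<close>, and \<open>p\<close> is
  not square integrable.

  No Sobolev spaces are needed: weak solutions are mollified, and the positive part is replaced by
  the smooth convex function \<open>(t + sqrt (t\<^sup>2 + d\<^sup>2)) / 2\<close> before the limit is taken.\<close>

section \<open>Smooth real-valued functions\<close>

text \<open>\<open>H\<close> is tangible only on test functions: nonnegativity is used as a
  quadratic form inequality on real test functions, self-adjointness as the weak equation of a zero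
  mode. The functions to be inserted into the form, positive parts of weak solutions, are neither
  smooth nor of bounded support. A mollified \<open>h\<close> may violate a pointwise inequality
  involving \<open>V\<close>, so the subsolution inequality is used only after the limit. Convexity
  gives the term with the squared gradient of \<open>h\<close> a favourable sign; once it is
  dropped, all remaining integrals are continuous under local L2 convergence, which is what
  mollification provides. For large |x|, the factor \<open>|x| powr (-d/2)\<close> alone would give
  all dyadic shells comparable mass; the logarithm lowers the mass of the shell of radius 2^j to
  order 1/j. So the harmonic series decides integrability, while the mass of a ball is far below the
  square of its radius. The mean value inequality also plays the part of unique continuation: by it,
  a nonnegative solution vanishing on a ball vanishes everywhere.\<close>

definition pd :: "'n \<Rightarrow> (real^'n \<Rightarrow> real) \<Rightarrow> real^'n \<Rightarrow> real" where
  "pd i f x = frechet_derivative f (at x) (axis i 1)"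

text \<open>Real-valued counterpart of \<open>Ck\<close>. Since \<open>V\<close> is real, real test
  functions suffice for the whole argument; \<open>Ck_of_real\<close> leads back to the complex
  ones.\<close>

primrec RC :: "nat \<Rightarrow> (real^'n \<Rightarrow> real) \<Rightarrow> bool" where
  "RC 0 f \<longleftrightarrow> continuous_on UNIV f"
| "RC (Suc k) f \<longleftrightarrow> (\<forall>x. f differentiable (at x)) \<and> (\<forall>i. RC k (pd i f))"

definition sm :: "(real^'n \<Rightarrow> real) \<Rightarrow> bool" where
  "sm f \<longleftrightarrow> (\<forall>k. RC k f)"

definition lap :: "(real^'n \<Rightarrow> real) \<Rightarrow> real^'n \<Rightarrow> real" where
  "lap f x = (\<Sum>i\<in>UNIV. pd i (pd i f) x)"

text \<open>A radius is tracked instead of compactness of the closure because it is quantitative: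
  derivatives keep it, and the radius of the mollifying kernel decides on which ball a function is
  sampled.\<close>

definition supp_in :: "real \<Rightarrow> (real^'n \<Rightarrow> real) \<Rightarrow> bool" where
  "supp_in R f \<longleftrightarrow> (\<forall>x. R < norm x \<longrightarrow> f x = 0)"

definition tf :: "(real^'n \<Rightarrow> real) \<Rightarrow> bool" where
  "tf f \<longleftrightarrow> sm f \<and> (\<exists>R. supp_in R f)"

lemma pd_eq: "(f has_derivative f') (at x) \<Longrightarrow> pd i f x = f' (axis i 1)"
  unfolding pd_def by (metis frechet_derivative_at)

lemma differentiable_everywhere_imp_continuous:
  fixes f :: "real^'n \<Rightarrow> real"
  assumes "\<forall>x. f differentiable (at x)" shows "continuous_on UNIV f"
  using assms by (simp add: continuous_on_eq_continuous_at differentiable_imp_continuous_within)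

lemma RC_Suc_imp: "RC (Suc k) f \<Longrightarrow> RC k f"
proof (induction k arbitrary: f)
  case 0
  then show ?case by (simp add: differentiable_everywhere_imp_continuous)
qed (use RC.simps(2) in blast)

lemma RC_imp_continuous: "RC k f \<Longrightarrow> continuous_on UNIV f"
  by (cases k) (auto simp: differentiable_everywhere_imp_continuous)

lemma sm_continuous: "sm f \<Longrightarrow> continuous_on UNIV f"
  unfolding sm_def using RC_imp_continuous by blast

lemma sm_measurable [measurable_dest]: "sm f \<Longrightarrow> f \<in> borel_measurable borel"
  by (simp add: borel_measurable_continuous_onI sm_continuous)

lemma sm_differentiable: "sm f \<Longrightarrow> f differentiable (at x)"
  unfolding sm_def by (metis RC.simps(2))

lemma sm_pd: "sm f \<Longrightarrow> sm (pd i f)"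
  unfolding sm_def by (metis RC.simps(2))

lemma has_derivative_pd:
  fixes f :: "real^'n \<Rightarrow> real"
  assumes "f differentiable (at x)"
  shows "(f has_derivative (\<lambda>v. \<Sum>i\<in>UNIV. v $ i * pd i f x)) (at x)"
proof -
  let ?D = "frechet_derivative f (at x)"
  have D: "(f has_derivative ?D) (at x)" using assms frechet_derivative_works by blast
  then have L: "linear ?D" by (simp add: has_derivative_linear)
  have "?D v = (\<Sum>i\<in>UNIV. v $ i * pd i f x)" for v
  proof -
    have "?D v = ?D (\<Sum>i\<in>UNIV. v $ i *\<^sub>R axis i 1)"
      using basis_expansion[of v] by (simp add: scalar_mult_eq_scaleR)
    also have "\<dots> = (\<Sum>i\<in>UNIV. v $ i * pd i f x)"
      by (simp add: linear_sum[OF L] linear_cmul[OF L] pd_def)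
    finally show ?thesis .
  qed
  with D show ?thesis by (metis (no_types, lifting) has_derivative_eq_rhs ext)
qed

lemma sm_has_derivative: "sm f \<Longrightarrow> (f has_derivative (\<lambda>v. \<Sum>i\<in>UNIV. v $ i * pd i f x)) (at x)"
  by (rule has_derivative_pd) (rule sm_differentiable)

lemma sum_axis_mult: "(\<Sum>j\<in>UNIV. (axis i (1::real) :: real^'n) $ j * g j) = g i"
  by (simp add: axis_def if_distrib[where f="\<lambda>c. c * _"] cong: if_cong)

lemma pd_const: "pd i (\<lambda>x. c) = (\<lambda>x. 0)"
  using pd_eq[OF has_derivative_const] by fastforce

lemma RC_const: "RC k (\<lambda>x. c)"
  by (induction k arbitrary: c) (auto simp: pd_const)

lemma sm_const [simp, intro]: "sm (\<lambda>x. c)"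
  unfolding sm_def by (simp add: RC_const)

lemma pd_add:
  assumes "f differentiable (at x)" "g differentiable (at x)"
  shows "pd i (\<lambda>x. f x + g x) x = pd i f x + pd i g x"
  using pd_eq[OF has_derivative_add[OF has_derivative_pd[OF assms(1)] has_derivative_pd[OF assms(2)]]]
  by (simp only: sum_axis_mult)

lemma pd_mult:
  assumes "f differentiable (at x)" "g differentiable (at x)"
  shows "pd i (\<lambda>x. f x * g x) x = f x * pd i g x + pd i f x * g x"
  using pd_eq[OF has_derivative_mult[OF has_derivative_pd[OF assms(1)] has_derivative_pd[OF assms(2)]]]
  by (simp only: sum_axis_mult)

lemma pd_affine:
  fixes a :: "real^'n"
  assumes "f differentiable (at (a + c *\<^sub>R x))"
  shows "pd i (\<lambda>x. f (a + c *\<^sub>R x)) x = c * pd i f (a + c *\<^sub>R x)"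
    and "(\<lambda>x. f (a + c *\<^sub>R x)) differentiable (at x)"
proof -
  have *: "((\<lambda>x. a + c *\<^sub>R x) has_derivative (\<lambda>v. c *\<^sub>R v)) (at x)"
    by (auto intro!: derivative_eq_intros)
  have D: "((\<lambda>x. f (a + c *\<^sub>R x)) has_derivative (\<lambda>v. \<Sum>i\<in>UNIV. (c *\<^sub>R v) $ i * pd i f (a + c *\<^sub>R x))) (at x)"
    by (rule has_derivative_compose[OF * has_derivative_pd[OF assms]])
  from pd_eq[OF this] show "pd i (\<lambda>x. f (a + c *\<^sub>R x)) x = c * pd i f (a + c *\<^sub>R x)"
    by (simp add: mult.assoc sum_distrib_left[symmetric] sum_axis_mult)
  from D show "(\<lambda>x. f (a + c *\<^sub>R x)) differentiable (at x)"
    unfolding differentiable_def by blast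
qed

lemma pd_compose:
  assumes "f differentiable (at x)" "(\<phi> has_real_derivative d) (at (f x))"
  shows "pd i (\<lambda>x. \<phi> (f x)) x = d * pd i f x" "(\<lambda>x. \<phi> (f x)) differentiable (at x)"
proof -
  have D: "((\<lambda>x. \<phi> (f x)) has_derivative (\<lambda>v. d * (\<Sum>i\<in>UNIV. v $ i * pd i f x))) (at x)"
    using has_derivative_compose[OF has_derivative_pd[OF assms(1)] assms(2)[unfolded has_field_derivative_def]]
    by simp
  from pd_eq[OF this] show "pd i (\<lambda>x. \<phi> (f x)) x = d * pd i f x"
    by (simp add: sum_axis_mult)
  from D show "(\<lambda>x. \<phi> (f x)) differentiable (at x)"
    unfolding differentiable_def by blast
qed

lemma RC_add: "RC k f \<Longrightarrow> RC k g \<Longrightarrow> RC k (\<lambda>x. f x + g x)"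
proof (induction k arbitrary: f g)
  case (Suc k)
  then have "pd i (\<lambda>x. f x + g x) = (\<lambda>x. pd i f x + pd i g x)" for i
    by (intro ext pd_add) auto
  with Suc show ?case by auto
qed (auto intro: continuous_intros)

lemma RC_mult: "RC k f \<Longrightarrow> RC k g \<Longrightarrow> RC k (\<lambda>x. f x * g x)"
proof (induction k arbitrary: f g)
  case (Suc k)
  then have "pd i (\<lambda>x. f x * g x) = (\<lambda>x. f x * pd i g x + pd i f x * g x)" for i
    by (intro ext pd_mult) auto
  moreover have "RC k f" "RC k g" using Suc.prems by (blast intro: RC_Suc_imp)+
  ultimately show ?case using Suc by (auto intro!: RC_add)
qed (auto intro: continuous_intros)

lemma RC_affine: "RC k f \<Longrightarrow> RC k (\<lambda>x. f (a + c *\<^sub>R x))"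
proof (induction k arbitrary: f)
  case 0
  then show ?case by (auto intro!: continuous_intros continuous_on_compose2[of UNIV f])
next
  case (Suc k)
  then have "pd i (\<lambda>x. f (a + c *\<^sub>R x)) = (\<lambda>x. c * pd i f (a + c *\<^sub>R x))" for i
    by (intro ext pd_affine) auto
  with Suc show ?case by (auto intro!: RC_mult RC_const pd_affine(2))
qed

text \<open>The chain rule replaces \<open>D j\<close> by \<open>D (Suc j)\<close>, so the induction
  must carry the whole sequence of derivatives of the outer function, with \<open>j\<close>
  arbitrary. The set \<open>I\<close> is where these derivatives exist, e.g. the positive reals for
  powers and logarithms.\<close>

lemma RC_compose:
  assumes D: "\<And>k t. t \<in> I \<Longrightarrow> (D k has_real_derivative D (Suc k) t) (at t)"
    and I: "\<And>x. f x \<in> I"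
  shows "RC k f \<Longrightarrow> RC k (\<lambda>x. D j (f x))"
proof (induction k arbitrary: j)
  case 0
  have "isCont (D j) (f x)" for x using D[OF I] DERIV_isCont by blast
  with 0 show ?case
    by (auto simp: continuous_on_eq_continuous_at intro: continuous_at_compose[unfolded o_def])
next
  case (Suc k)
  then have f: "f differentiable (at x)" "RC k (pd i f)" for x i by auto
  have "pd i (\<lambda>x. D j (f x)) = (\<lambda>x. D (Suc j) (f x) * pd i f x)" for i
    by (rule ext, rule pd_compose(1)[OF f(1) D[OF I]])
  moreover have "RC k (\<lambda>x. D (Suc j) (f x))"
    by (rule Suc.IH) (rule RC_Suc_imp[OF Suc.prems])
  ultimately show ?case
    using pd_compose(2)[OF f(1) D[OF I]] RC_mult[OF _ f(2)] by simp
qed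

lemma sm_add [intro]: "sm f \<Longrightarrow> sm g \<Longrightarrow> sm (\<lambda>x. f x + g x)"
  unfolding sm_def by (blast intro: RC_add)

lemma sm_mult [intro]: "sm f \<Longrightarrow> sm g \<Longrightarrow> sm (\<lambda>x. f x * g x)"
  unfolding sm_def by (blast intro: RC_mult)

lemma sm_affine: "sm f \<Longrightarrow> sm (\<lambda>x. f (a + c *\<^sub>R x))"
  unfolding sm_def by (blast intro: RC_affine)

lemma sm_compose:
  assumes "\<And>k t. t \<in> I \<Longrightarrow> (D k has_real_derivative D (Suc k) t) (at t)"
    and "\<And>x. f x \<in> I" and "sm f"
  shows "sm (\<lambda>x. D j (f x))"
  using assms unfolding sm_def by (blast intro: RC_compose)

lemma sm_cmult [intro]: "sm f \<Longrightarrow> sm (\<lambda>x. c * f x)"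
  by (rule sm_mult) auto

lemma sm_diff [intro]: "sm f \<Longrightarrow> sm g \<Longrightarrow> sm (\<lambda>x. f x - g x)"
  using sm_add[OF _ sm_cmult[of g "-1"], of f] by simp

lemma sm_sum [intro]: "(\<And>i. i \<in> A \<Longrightarrow> sm (f i)) \<Longrightarrow> sm (\<lambda>x. \<Sum>i\<in>A. f i x)"
  by (induction A rule: infinite_finite_induct) auto

lemma sm_power [intro]: "sm f \<Longrightarrow> sm (\<lambda>x. f x ^ n)"
  by (induction n) auto

lemma sm_lap [intro]: "sm f \<Longrightarrow> sm (lap f)"
  unfolding lap_def[abs_def] by (intro sm_sum sm_pd)

lemma pd_coord: "pd j (\<lambda>x::real^'n. x $ i) = (\<lambda>x. if i = j then 1 else 0)"
proof
  fix x :: "real^'n"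
  have "((\<lambda>x::real^'n. x $ i) has_derivative (\<lambda>v. v $ i)) (at x)"
    by (simp add: bounded_linear_imp_has_derivative bounded_linear_vec_nth)
  from pd_eq[OF this] show "pd j (\<lambda>x. x $ i) x = (if i = j then 1 else 0)"
    by (simp add: axis_def)
qed

lemma sm_coord [intro]: "sm (\<lambda>x::real^'n. x $ i)"
proof -
  have "RC k (\<lambda>x::real^'n. x $ i)" for k
  proof (cases k)
    case 0
    then show ?thesis by (auto intro: continuous_intros)
  next
    case (Suc l)
    have "(\<lambda>x::real^'n. x $ i) differentiable (at x)" for x
      by (simp add: bounded_linear_imp_differentiable bounded_linear_vec_nth)
    with Suc show ?thesis by (auto simp: pd_coord RC_const)
  qed
  then show ?thesis by (simp add: sm_def)
qed

lemma norm_sq_eq: "(norm (x::real^'n))\<^sup>2 = (\<Sum>i\<in>UNIV. (x $ i)\<^sup>2)"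
  by (simp add: norm_vec_def L2_set_def sum_nonneg)

lemma sm_norm_sq [intro]: "sm (\<lambda>x::real^'n. (norm x)\<^sup>2)"
  unfolding norm_sq_eq by (intro sm_sum sm_power sm_coord)

lemma pd_norm_sq: "pd i (\<lambda>x::real^'n. (norm x)\<^sup>2) = (\<lambda>x. 2 * x $ i)"
proof
  fix x :: "real^'n"
  have "((\<lambda>x::real^'n. x \<bullet> x) has_derivative (\<lambda>v. 2 * (x \<bullet> v))) (at x)"
    by (auto intro!: derivative_eq_intros simp: inner_commute)
  then have "((\<lambda>x::real^'n. (norm x)\<^sup>2) has_derivative (\<lambda>v. 2 * (x \<bullet> v))) (at x)"
    by (simp add: power2_norm_eq_inner)
  from pd_eq[OF this] show "pd i (\<lambda>x. (norm x)\<^sup>2) x = 2 * x $ i"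
    by (simp add: inner_axis)
qed

section \<open>Powers, logarithms and the flat function\<close>

lemma sm_powr:
  assumes "sm f" "\<And>x. 0 < f x" shows "sm (\<lambda>x. f x powr a)"
proof -
  \<comment> \<open>The k-th derivative of \<open>t powr a\<close>, with the falling factorial as
    its coefficient.\<close>
  define D :: "nat \<Rightarrow> real \<Rightarrow> real" where "D k t = (\<Prod>j<k. a - real j) * t powr (a - real k)" for k t
  have D: "(D k has_real_derivative D (Suc k) t) (at t)" if "t \<in> {0<..}" for k t
    using DERIV_cmult[OF has_real_derivative_powr[of t "a - real k"], of "\<Prod>j<k. a - real j"] that
    by (simp add: D_def[abs_def] mult.assoc diff_diff_eq add.commute)
  have "sm (\<lambda>x. D 0 (f x))"
    by (rule sm_compose[where D=D and I="{0<..}" and f=f and j=0, OF D _ assms(1)])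
       (simp_all add: assms(2))
  then show ?thesis by (simp add: D_def)
qed

lemma sm_inverse:
  assumes "sm f" "\<And>x. 0 < f x" shows "sm (\<lambda>x. inverse (f x))"
  using sm_powr[OF assms, of "-1"] assms(2) by (simp add: powr_minus less_imp_le)

lemma sm_sqrt:
  assumes "sm f" "\<And>x. 0 < f x" shows "sm (\<lambda>x. sqrt (f x))"
  using sm_powr[OF assms, of "1/2"] assms(2) by (simp add: powr_half_sqrt less_imp_le)

lemma sm_divide:
  assumes "sm f" "sm g" "\<And>x. 0 < g x" shows "sm (\<lambda>x. f x / g x)"
  unfolding divide_inverse using assms by (intro sm_mult sm_inverse)

lemma sm_ln:
  assumes "sm f" "\<And>x. 0 < f x" shows "sm (\<lambda>x. ln (f x))"
proof -
  \<comment> \<open>\<open>E k\<close> is the k-th derivative of 1/t; \<open>D\<close> prepends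
    \<open>ln\<close> itself, so that \<open>D (Suc k)\<close> is \<open>E k\<close>.\<close>
  define E :: "nat \<Rightarrow> real \<Rightarrow> real" where "E k t = (\<Prod>j<k. - 1 - real j) * t powr (- 1 - real k)" for k t
  define D where "D = rec_nat ln (\<lambda>k _. E k)"
  have E: "(E k has_real_derivative E (Suc k) t) (at t)" if "t \<in> {0<..}" for k t
    using DERIV_cmult[OF has_real_derivative_powr[of t "- 1 - real k"], of "\<Prod>j<k. - 1 - real j"] that
    by (simp add: E_def[abs_def] mult.assoc diff_diff_eq add.commute)
  have D: "(D k has_real_derivative D (Suc k) t) (at t)" if "t \<in> {0<..}" for k t
  proof (cases k)
    case 0
    have "E 0 t = inverse t" using that by (simp add: E_def powr_minus)
    with 0 that show ?thesis by (simp add: D_def DERIV_ln)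
  next
    case (Suc l)
    with E[OF that, of l] show ?thesis by (simp add: D_def)
  qed
  have "sm (\<lambda>x. D 0 (f x))"
    by (rule sm_compose[where D=D and I="{0<..}" and f=f and j=0, OF D _ assms(1)])
       (simp_all add: assms(2))
  then show ?thesis by (simp add: D_def)
qed

text \<open>The derivatives of \<open>exp (-1/t)\<close> have the form \<open>P (1/t) * exp (-1/t)\<close>.\<close>

definition flat :: "real poly \<Rightarrow> real \<Rightarrow> real" where
  "flat p t = (if t > 0 then poly p (1/t) * exp (- (1/t)) else 0)"

lemma poly_mult_exp_tendsto_0: "((\<lambda>s. poly p s * exp (- s)) \<longlongrightarrow> (0::real)) at_top"
proof -
  have "((\<lambda>s. \<Sum>i\<le>degree p. coeff p i * (s ^ i / exp s)) \<longlongrightarrow> (\<Sum>i\<le>degree p. coeff p i * 0)) at_top"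
    by (intro tendsto_sum tendsto_mult tendsto_const tendsto_power_div_exp_0)
  moreover have "(\<Sum>i\<le>degree p. coeff p i * (s ^ i / exp s)) = poly p s * exp (- s)" for s
    by (simp add: poly_altdef exp_minus divide_inverse sum_distrib_right mult.assoc)
  ultimately show ?thesis by simp
qed

lemma flat_tendsto_0: "(flat p \<longlongrightarrow> 0) (at 0)"
proof -
  have "((\<lambda>t. poly p (inverse t) * exp (- inverse t)) \<longlongrightarrow> 0) (at_right 0)"
    using filterlim_compose[OF poly_mult_exp_tendsto_0 filterlim_inverse_at_top_right] by simp
  then have "(flat p \<longlongrightarrow> 0) (at_right 0)"
    by (rule Lim_transform_eventually) (auto simp: flat_def eventually_at_filter divide_inverse)
  moreover have "(flat p \<longlongrightarrow> 0) (at_left 0)"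
    by (rule Lim_transform_eventually[OF tendsto_const]) (auto simp: flat_def eventually_at_filter)
  ultimately show ?thesis by (simp add: filterlim_split_at)
qed

text \<open>With s = 1/t, differentiation multiplies by s^2 and replaces p by p - p', because ds/dt
  = - s^2 and exp(-s) has derivative - exp(-s). The class of these functions is therefore closed
  under differentiation, which gives smoothness.\<close>

lemma flat_deriv: "(flat p has_real_derivative flat ([:0,0,1:] * (p - pderiv p)) t) (at t)"
proof -
  consider "t > 0" | "t < 0" | "t = 0" by linarith
  then show ?thesis
  proof cases
    case 1
    have "((\<lambda>t. poly p (1/t) * exp (- (1/t))) has_real_derivative
        flat ([:0,0,1:] * (p - pderiv p)) t) (at t)"
      using 1 by (auto intro!: derivative_eq_intros DERIV_chain2[OF poly_DERIV]
          simp: flat_def field_simps power2_eq_square)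
    then show ?thesis
      by (rule has_field_derivative_transform_within_open[where S="{0<..}"]) (use 1 in \<open>auto simp: flat_def\<close>)
  next
    case 2
    have "((\<lambda>t. 0) has_real_derivative flat ([:0,0,1:] * (p - pderiv p)) t) (at t)"
      using 2 by (simp add: flat_def)
    then show ?thesis
      by (rule has_field_derivative_transform_within_open[where S="{..<0}"]) (use 2 in \<open>auto simp: flat_def\<close>)
  next
    case 3
    \<comment> \<open>At the origin the difference quotient is again a function of this type:
      dividing by h adds one power of 1/h to the polynomial.\<close>
    have "((\<lambda>h. (flat p (0 + h) - flat p 0) / h) \<longlongrightarrow> 0) (at 0)"
      by (rule Lim_transform_eventually[OF flat_tendsto_0[of "[:0,1:] * p"]])
        (auto simp: flat_def eventually_at_filter)
    with 3 show ?thesis by (simp add: DERIV_def flat_def)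
  qed
qed

lemma sm_flat: assumes "sm f" shows "sm (\<lambda>x. flat p (f x))"
proof -
  define P where "P = rec_nat p (\<lambda>_ p. [:0,0,1:] * (p - pderiv p))"
  have D: "(flat (P k) has_real_derivative flat (P (Suc k)) t) (at t)" for k t
    using flat_deriv[of "P k" t] by (simp add: P_def)
  have "sm (\<lambda>x. flat (P 0) (f x))"
    by (rule sm_compose[where D="\<lambda>k. flat (P k)" and I=UNIV and f=f and j=0, OF D _ assms]) simp
  then show ?thesis by (simp add: P_def)
qed

lemma flat_1_pos: "flat 1 t > 0 \<longleftrightarrow> t > 0" and flat_1_nonneg: "flat 1 t \<ge> 0"
  by (auto simp: flat_def)

section \<open>Functions of bounded support\<close>

lemma supp_in_pd:
  assumes "supp_in R f" shows "supp_in R (pd i f)"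
proof -
  have "pd i f x = 0" if "R < norm x" for x
  proof -
    have "open {y::real^'a. R < norm y}" by (intro open_Collect_less continuous_intros)
    then have "(f has_derivative (\<lambda>_. 0)) (at x)"
      using has_derivative_transform_within_open[of "\<lambda>_. 0" "\<lambda>_. 0" x UNIV "{y. R < norm y}" f] assms that
      by (auto simp: supp_in_def)
    from pd_eq[OF this] show ?thesis .
  qed
  then show ?thesis by (simp add: supp_in_def)
qed

lemma supp_in_lap: "supp_in R f \<Longrightarrow> supp_in R (lap f)"
  using supp_in_pd[OF supp_in_pd[of R f]] by (simp add: supp_in_def lap_def)

lemma tf_sm: "tf f \<Longrightarrow> sm f" by (simp add: tf_def)

lemma tf_pd: "tf f \<Longrightarrow> tf (pd i f)"
  unfolding tf_def using sm_pd supp_in_pd by blast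

lemma tf_lap: "tf f \<Longrightarrow> tf (lap f)"
  unfolding tf_def using sm_lap supp_in_lap by blast

lemma tf_mult: "tf f \<Longrightarrow> sm g \<Longrightarrow> tf (\<lambda>x. f x * g x)" "tf f \<Longrightarrow> sm g \<Longrightarrow> tf (\<lambda>x. g x * f x)"
  unfolding tf_def supp_in_def by auto

lemma tf_cmult: "tf f \<Longrightarrow> tf (\<lambda>x. c * f x)"
  by (rule tf_mult(2)) auto

lemma tf_add: assumes "tf f" "tf g" shows "tf (\<lambda>x. f x + g x)"
proof -
  from assms obtain R S where "supp_in R f" "supp_in S g" by (auto simp: tf_def)
  then have "supp_in (max R S) (\<lambda>x. f x + g x)" by (simp add: supp_in_def)
  with assms show ?thesis by (auto simp: tf_def)
qed

lemma tf_zero: "tf (\<lambda>x. 0)"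
  by (auto simp: tf_def supp_in_def)

lemma tf_sum: "(\<And>i. i \<in> A \<Longrightarrow> tf (f i)) \<Longrightarrow> tf (\<lambda>x. \<Sum>i\<in>A. f i x)"
  by (induction A rule: infinite_finite_induct) (simp_all add: tf_zero tf_add)

lemma tf_affine:
  fixes a :: "real^'n"
  assumes "tf f" "c \<noteq> 0" shows "tf (\<lambda>x. f (a + c *\<^sub>R x))"
proof -
  from assms obtain R where R: "supp_in R f" by (auto simp: tf_def)
  have "f (a + c *\<^sub>R x) = 0" if "(\<bar>R\<bar> + norm a) / \<bar>c\<bar> < norm x" for x
  proof -
    have "\<bar>R\<bar> + norm a < norm (c *\<^sub>R x)" using that assms by (simp add: field_simps)
    also have "norm (c *\<^sub>R x) \<le> norm (a + c *\<^sub>R x) + norm a"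
      using norm_triangle_ineq4[of "a + c *\<^sub>R x" a] by simp
    finally show ?thesis using R by (simp add: supp_in_def)
  qed
  then have "supp_in ((\<bar>R\<bar> + norm a) / \<bar>c\<bar>) (\<lambda>x. f (a + c *\<^sub>R x))" by (simp add: supp_in_def)
  with assms show ?thesis unfolding tf_def using sm_affine by blast
qed

lemma pd_affine_sm:
  "sm f \<Longrightarrow> pd i (\<lambda>x. f (a + c *\<^sub>R x)) = (\<lambda>x. c * pd i f (a + c *\<^sub>R x))"
  by (rule ext) (rule pd_affine(1)[OF sm_differentiable])

lemma pd_add_sm: "sm f \<Longrightarrow> sm g \<Longrightarrow> pd i (\<lambda>x. f x + g x) = (\<lambda>x. pd i f x + pd i g x)"
  by (rule ext) (rule pd_add[OF sm_differentiable sm_differentiable])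

lemma pd_mult_sm: "sm f \<Longrightarrow> sm g \<Longrightarrow> pd i (\<lambda>x. f x * g x) = (\<lambda>x. f x * pd i g x + pd i f x * g x)"
  by (rule ext) (rule pd_mult[OF sm_differentiable sm_differentiable])

lemma pd_cmult_sm: "sm f \<Longrightarrow> pd i (\<lambda>x. c * f x) = (\<lambda>x. c * pd i f x)"
  by (subst pd_mult_sm) (auto simp: pd_const)

lemma lap_affine_sm:
  assumes "sm f" shows "lap (\<lambda>x. f (a + c *\<^sub>R x)) = (\<lambda>x. c\<^sup>2 * lap f (a + c *\<^sub>R x))"
proof -
  have "pd i (pd i (\<lambda>x. f (a + c *\<^sub>R x))) = (\<lambda>x. c\<^sup>2 * pd i (pd i f) (a + c *\<^sub>R x))" for i
    by (simp add: assms pd_affine_sm pd_cmult_sm sm_affine sm_pd power2_eq_square mult.assoc)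
  then show ?thesis by (simp add: lap_def[abs_def] sum_distrib_left)
qed

lemma lap_add_sm: "sm f \<Longrightarrow> sm g \<Longrightarrow> lap (\<lambda>x. f x + g x) = (\<lambda>x. lap f x + lap g x)"
  by (simp add: lap_def[abs_def] pd_add_sm sm_pd sum.distrib)

lemma lap_cmult_sm: "sm f \<Longrightarrow> lap (\<lambda>x. c * f x) = (\<lambda>x. c * lap f x)"
  by (simp add: lap_def[abs_def] pd_cmult_sm sm_pd sum_distrib_left)

lemma lap_mult_sm:
  assumes "sm f" "sm g"
  shows "lap (\<lambda>x. f x * g x) = (\<lambda>x. f x * lap g x + 2 * (\<Sum>i\<in>UNIV. pd i f x * pd i g x) + lap f x * g x)"
proof -
  have "pd i (pd i (\<lambda>x. f x * g x)) =
      (\<lambda>x. f x * pd i (pd i g) x + 2 * (pd i f x * pd i g x) + pd i (pd i f) x * g x)" for i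
    by (simp add: assms pd_mult_sm pd_add_sm sm_pd sm_mult add_ac)
  then show ?thesis by (simp add: lap_def[abs_def] sum.distrib sum_distrib_left sum_distrib_right)
qed

section \<open>Transfer to complex test functions\<close>

lemma partial_of_real:
  assumes "f differentiable (at x)"
  shows "partial i (\<lambda>x. complex_of_real (f x)) x = complex_of_real (pd i f x)"
    and "(\<lambda>x. complex_of_real (f x)) differentiable (at x)"
proof -
  have D: "((\<lambda>x. complex_of_real (f x)) has_derivative
      (\<lambda>v. complex_of_real (\<Sum>i\<in>UNIV. v $ i * pd i f x))) (at x)"
    by (rule has_derivative_of_real[OF has_derivative_pd[OF assms]])
  from frechet_derivative_at[OF D] show "partial i (\<lambda>x. complex_of_real (f x)) x = complex_of_real (pd i f x)"
    by (simp only: partial_def sum_axis_mult flip: frechet_derivative_at[OF D])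
  from D show "(\<lambda>x. complex_of_real (f x)) differentiable (at x)"
    unfolding differentiable_def by blast
qed

lemma Ck_of_real: "RC k f \<Longrightarrow> Ck k (\<lambda>x. complex_of_real (f x))"
proof (induction k arbitrary: f)
  case (Suc k)
  then have f: "f differentiable (at x)" "RC k (pd i f)" for x i by auto
  have "partial i (\<lambda>x. complex_of_real (f x)) = (\<lambda>x. complex_of_real (pd i f x))" for i
    by (rule ext) (rule partial_of_real(1)[OF f(1)])
  with Suc f show ?case
    by (auto simp: partial_of_real(2) intro!: continuous_intros RC_imp_continuous[of "Suc k"])
qed (auto intro: continuous_intros)

lemma tf_imp_test_fun:
  assumes "tf f" shows "test_fun (\<lambda>x. complex_of_real (f x))"
    and "laplacian (\<lambda>x. complex_of_real (f x)) = (\<lambda>x. complex_of_real (lap f x))"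
proof -
  from assms obtain R where R: "supp_in R f" by (auto simp: tf_def)
  then have "{x. complex_of_real (f x) \<noteq> 0} \<subseteq> cball 0 R"
    by (auto simp: supp_in_def linorder_not_le[symmetric])
  then have "compact (closure {x. complex_of_real (f x) \<noteq> 0})"
    by (meson bounded_cball bounded_subset compact_closure)
  with assms show "test_fun (\<lambda>x. complex_of_real (f x))"
    by (auto simp: test_fun_def smooth_def tf_def sm_def intro: Ck_of_real)
  have "partial i (\<lambda>x. complex_of_real (g x)) = (\<lambda>x. complex_of_real (pd i g x))" if "sm g" for g :: "real^'a \<Rightarrow> real" and i
    by (rule ext) (rule partial_of_real(1)[OF sm_differentiable[OF that]])
  then show "laplacian (\<lambda>x. complex_of_real (f x)) = (\<lambda>x. complex_of_real (lap f x))"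
    using assms by (simp add: laplacian_def[abs_def] lap_def[abs_def] sm_pd tf_sm)
qed

section \<open>Local square integrability\<close>

definition L2loc :: "(real^'n \<Rightarrow> real) \<Rightarrow> bool" where
  "L2loc h \<longleftrightarrow> h \<in> borel_measurable borel \<and>
     (\<forall>R. integrable lborel (\<lambda>x. indicator (cball 0 R) x * (h x)\<^sup>2))"

text \<open>The squared L2 norm on a ball. With squares the triangle inequality costs a factor 2
  (\<open>sqn_add\<close>), but no roots appear.\<close>

definition sqn :: "real \<Rightarrow> (real^'n \<Rightarrow> real) \<Rightarrow> real" where
  "sqn R h = (LINT x|lborel. indicator (cball 0 R) x * (h x)\<^sup>2)"

text \<open>The weights against which products of two locally square integrable functions are
  integrated; the class contains the test functions and also the indicators of balls.\<close>

definition bsupp :: "(real^'n \<Rightarrow> real) \<Rightarrow> bool" where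
  "bsupp f \<longleftrightarrow> f \<in> borel_measurable borel \<and>
     (\<exists>C\<ge>0. \<exists>R. \<forall>x. \<bar>f x\<bar> \<le> C * indicator (cball 0 R) x)"

definition Lloc :: "(real^'n \<Rightarrow> real) \<Rightarrow> bool" where
  "Lloc W \<longleftrightarrow> W \<in> borel_measurable borel \<and>
     (\<forall>R. \<exists>C\<ge>0. AE x in lborel. norm x \<le> R \<longrightarrow> \<bar>W x\<bar> \<le> C)"

definition L2conv :: "(nat \<Rightarrow> real^'n \<Rightarrow> real) \<Rightarrow> (real^'n \<Rightarrow> real) \<Rightarrow> bool" where
  "L2conv X f \<longleftrightarrow> (\<forall>n. L2loc (X n)) \<and> L2loc f \<and> (\<forall>R. (\<lambda>n. sqn R (\<lambda>x. X n x - f x)) \<longlonglongrightarrow> 0)"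

lemma L2loc_int: "L2loc f \<Longrightarrow> integrable lborel (\<lambda>x. indicator (cball 0 R) x * (f x)\<^sup>2)" by (simp add: L2loc_def)

lemma ball_sq_measurable [measurable]:
  assumes [measurable]: "f \<in> borel_measurable borel"
  shows "(\<lambda>x::real^'n. indicator (cball 0 R) x * (f x)\<^sup>2 :: real) \<in> borel_measurable lborel"
proof -
  have [measurable]: "cball (0::real^'n) R \<in> sets borel" by simp
  show ?thesis by measurable
qed

lemma sqn_nonneg: "0 \<le> sqn R f"
  unfolding sqn_def by (intro integral_nonneg_AE AE_I2) (auto simp: indicator_def)

lemma integrable_ball: "integrable lborel (\<lambda>x::real^'n. indicator (cball 0 R) x * (c::real))"
proof -
  have "emeasure lborel (cball (0::real^'n) R) < \<infinity>"
    using emeasure_bounded_finite[OF bounded_cball] by simp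
  then show ?thesis by auto
qed

lemma integrable_indicator_ball [simp]: "integrable lborel (indicat_real (cball (0::real^'n) R))"
  using integrable_ball[of R 1] by simp

lemma integral_ball: "(LINT x|lborel. indicator (cball (0::real^'n) R) x * (c::real)) = c * measure lborel (cball (0::real^'n) R)"
  by (simp add: mult.commute)

lemma L2loc_bound:
  fixes f g :: "real^'n \<Rightarrow> real"
  assumes "L2loc f" and g[measurable]: "g \<in> borel_measurable borel"
    and b: "\<And>R. \<exists>C. AE x in lborel. norm x \<le> R \<longrightarrow> \<bar>g x\<bar> \<le> C * \<bar>f x\<bar> + C"
  shows "L2loc g"
  unfolding L2loc_def
proof (intro conjI allI g)
  fix R
  have [measurable]: "f \<in> borel_measurable borel" using assms by (simp add: L2loc_def)
  obtain C where C: "AE x in lborel. norm x \<le> R \<longrightarrow> \<bar>g x\<bar> \<le> C * \<bar>f x\<bar> + C" using b by blast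
  have "integrable lborel (\<lambda>x. 2 * C\<^sup>2 * (indicator (cball 0 R) x * (f x)\<^sup>2) + indicator (cball 0 R) x * (2 * C\<^sup>2))"
    by (intro Bochner_Integration.integrable_add integrable_ball integrable_mult_right L2loc_int assms)
  then show "integrable lborel (\<lambda>x. indicator (cball 0 R) x * (g x)\<^sup>2)"
  proof (rule Bochner_Integration.integrable_bound)
    show "AE x in lborel. norm (indicator (cball 0 R) x * (g x)\<^sup>2)
      \<le> norm (2 * C\<^sup>2 * (indicator (cball 0 R) x * (f x)\<^sup>2) + indicator (cball 0 R) x * (2 * C\<^sup>2))"
      using C
    proof eventually_elim
      case (elim x)
      show ?case
      proof (cases "norm x \<le> R")
        case True
        with elim have "\<bar>g x\<bar>\<^sup>2 \<le> (C * \<bar>f x\<bar> + C)\<^sup>2" by (intro power_mono) auto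
        also have "\<dots> \<le> 2 * C\<^sup>2 * (f x)\<^sup>2 + 2 * C\<^sup>2"
          using zero_le_power2[of "C * \<bar>f x\<bar> - C"] by (simp add: power2_eq_square algebra_simps)
        finally show ?thesis using True by (simp add: indicator_def)
      qed (simp add: indicator_def)
    qed
  qed (use g in measurable)
qed

lemma L2loc_add: assumes "L2loc f" "L2loc g" shows "L2loc (\<lambda>x. f x + g x)"
proof -
  have [measurable]: "f \<in> borel_measurable borel" "g \<in> borel_measurable borel" using assms by (auto simp: L2loc_def)
  have "integrable lborel (\<lambda>x. indicator (cball 0 R) x * (f x + g x)\<^sup>2)" for R
  proof (rule Bochner_Integration.integrable_bound)
    show "integrable lborel (\<lambda>x. 2 * (indicator (cball 0 R) x * (f x)\<^sup>2) + 2 * (indicator (cball 0 R) x * (g x)\<^sup>2))"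
      by (intro Bochner_Integration.integrable_add integrable_mult_right L2loc_int assms)
    have "(a + b)\<^sup>2 \<le> 2 * a\<^sup>2 + 2 * b\<^sup>2" for a b :: real
      using zero_le_power2[of "a - b"] by (simp add: power2_eq_square algebra_simps)
    then show "AE x in lborel. norm (indicator (cball 0 R) x * (f x + g x)\<^sup>2)
      \<le> norm (2 * (indicator (cball 0 R) x * (f x)\<^sup>2) + 2 * (indicator (cball 0 R) x * (g x)\<^sup>2))"
      by (auto simp: indicator_def)
  qed measurable
  then show ?thesis by (simp add: L2loc_def)
qed

lemma L2loc_mult: assumes "Lloc W" "L2loc f" shows "L2loc (\<lambda>x. W x * f x)"
proof (rule L2loc_bound[OF assms(2)])
  show "(\<lambda>x. W x * f x) \<in> borel_measurable borel"
    using assms by (auto simp: L2loc_def Lloc_def)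
  fix R
  obtain C where C: "C \<ge> 0" "AE x in lborel. norm x \<le> R \<longrightarrow> \<bar>W x\<bar> \<le> C"
    using assms(1) unfolding Lloc_def by blast
  from C(2) have "AE x in lborel. norm x \<le> R \<longrightarrow> \<bar>W x * f x\<bar> \<le> C * \<bar>f x\<bar> + C"
  proof eventually_elim
    case (elim x)
    then show ?case using C(1) mult_right_mono[of "\<bar>W x\<bar>" C "\<bar>f x\<bar>"] by (auto simp: abs_mult)
  qed
  then show "\<exists>C. AE x in lborel. norm x \<le> R \<longrightarrow> \<bar>W x * f x\<bar> \<le> C * \<bar>f x\<bar> + C" by blast
qed

lemma continuous_bounded_cball:
  fixes f :: "real^'n \<Rightarrow> real"
  assumes "continuous_on UNIV f" shows "\<exists>C\<ge>0. \<forall>x. norm x \<le> R \<longrightarrow> \<bar>f x\<bar> \<le> C"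
proof -
  have "bounded (f ` cball 0 R)"
    by (intro compact_imp_bounded compact_continuous_image continuous_on_subset[OF assms]) auto
  then obtain C where "\<forall>y\<in>f ` cball 0 R. norm y \<le> C" unfolding bounded_iff by blast
  then show ?thesis by (intro exI[of _ "max C 0"]) (auto simp: max.coboundedI1)
qed

lemma Lloc_continuous: "continuous_on UNIV f \<Longrightarrow> Lloc f"
  unfolding Lloc_def using continuous_bounded_cball[of f]
  by (metis (no_types, lifting) AE_I2 borel_measurable_continuous_onI)

lemma L2loc_const: "L2loc (\<lambda>x. c)"
  unfolding L2loc_def by (intro conjI allI integrable_ball) simp

lemma Lloc_imp_L2loc: "Lloc f \<Longrightarrow> L2loc f"
  using L2loc_mult[OF _ L2loc_const[of 1]] by simp

lemma L2loc_cmult: "L2loc f \<Longrightarrow> L2loc (\<lambda>x. c * f x)"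
  by (intro L2loc_mult Lloc_continuous continuous_intros)

lemma L2loc_diff: "L2loc f \<Longrightarrow> L2loc g \<Longrightarrow> L2loc (\<lambda>x. f x - g x)"
  using L2loc_add[OF _ L2loc_cmult[of g "-1"]] by simp

lemma L2loc_sm: "sm f \<Longrightarrow> L2loc f"
  by (intro Lloc_imp_L2loc Lloc_continuous sm_continuous)

lemma tf_bsupp: assumes "tf f" shows "bsupp f"
proof -
  from assms obtain R where R: "supp_in R f" by (auto simp: tf_def)
  obtain C where "C \<ge> 0" "\<forall>x. norm x \<le> R \<longrightarrow> \<bar>f x\<bar> \<le> C"
    using continuous_bounded_cball sm_continuous tf_sm assms by blast
  with R have "\<forall>x. \<bar>f x\<bar> \<le> C * indicator (cball 0 R) x"
    by (auto simp: supp_in_def indicator_def)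
  with \<open>C \<ge> 0\<close> show ?thesis unfolding bsupp_def
    using sm_measurable[OF tf_sm[OF assms]] by blast
qed

lemma bsupp_indicator: "bsupp (indicator (cball (0::real^'n) R))"
proof -
  have "cball (0::real^'n) R \<in> sets borel" by simp
  then have "indicator (cball (0::real^'n) R) \<in> borel_measurable borel" by (rule borel_measurable_indicator)
  moreover have "\<forall>x::real^'n. \<bar>indicator (cball 0 R) x :: real\<bar> \<le> 1 * indicator (cball 0 R) x" by simp
  ultimately show ?thesis unfolding bsupp_def by (meson zero_le_one)
qed

lemma bsupp_L2_product:
  assumes "bsupp \<zeta>" "L2loc f" "L2loc g"
  shows "integrable lborel (\<lambda>x. \<zeta> x * f x * g x)"
proof -
  have [measurable]: "\<zeta> \<in> borel_measurable borel" "f \<in> borel_measurable borel" "g \<in> borel_measurable borel"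
    using assms by (auto simp: L2loc_def bsupp_def)
  obtain C R where C: "C \<ge> 0" "\<And>x. \<bar>\<zeta> x\<bar> \<le> C * indicator (cball 0 R) x"
    using assms(1) unfolding bsupp_def by blast
  show ?thesis
  proof (rule Bochner_Integration.integrable_bound)
    show "integrable lborel (\<lambda>x. C * (indicator (cball 0 R) x * (f x)\<^sup>2 + indicator (cball 0 R) x * (g x)\<^sup>2))"
      by (intro Bochner_Integration.integrable_add integrable_mult_right L2loc_int assms)
    show "AE x in lborel. norm (\<zeta> x * f x * g x)
      \<le> norm (C * (indicator (cball 0 R) x * (f x)\<^sup>2 + indicator (cball 0 R) x * (g x)\<^sup>2))"
    proof (rule AE_I2)
      fix x
      have "2 * (\<bar>f x\<bar> * \<bar>g x\<bar>) \<le> (f x)\<^sup>2 + (g x)\<^sup>2"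
        using zero_le_power2[of "\<bar>f x\<bar> - \<bar>g x\<bar>"] by (simp add: power2_eq_square algebra_simps)
      then have *: "\<bar>f x\<bar> * \<bar>g x\<bar> \<le> (f x)\<^sup>2 + (g x)\<^sup>2" 
        using mult_nonneg_nonneg[of "\<bar>f x\<bar>" "\<bar>g x\<bar>"] by linarith
      have "norm (\<zeta> x * f x * g x) = \<bar>\<zeta> x\<bar> * (\<bar>f x\<bar> * \<bar>g x\<bar>)" by (simp add: abs_mult)
      also have "\<dots> \<le> (C * indicator (cball 0 R) x) * ((f x)\<^sup>2 + (g x)\<^sup>2)"
        by (intro mult_mono C * ) (auto simp: C)
      also have "\<dots> \<le> norm (C * (indicator (cball 0 R) x * (f x)\<^sup>2 + indicator (cball 0 R) x * (g x)\<^sup>2))"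
        by (auto simp: algebra_simps)
      finally show "norm (\<zeta> x * f x * g x)
        \<le> norm (C * (indicator (cball 0 R) x * (f x)\<^sup>2 + indicator (cball 0 R) x * (g x)\<^sup>2))" .
    qed
  qed measurable
qed

lemma bsupp_L2_int: "bsupp \<zeta> \<Longrightarrow> L2loc f \<Longrightarrow> integrable lborel (\<lambda>x. \<zeta> x * f x)"
  using bsupp_L2_product[OF _ _ L2loc_const[of 1]] by simp

lemma bsupp_L2_int': "bsupp \<zeta> \<Longrightarrow> L2loc f \<Longrightarrow> integrable lborel (\<lambda>x. f x * \<zeta> x)"
  using bsupp_L2_int by (simp add: mult.commute)

lemma tf_integrable: "tf f \<Longrightarrow> integrable lborel f"
  using bsupp_L2_int[OF tf_bsupp L2loc_const[of 1]] by simp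

lemma L2conv_const: "L2loc f \<Longrightarrow> L2conv (\<lambda>_. f) f"
  by (simp add: L2conv_def sqn_def)

lemma sqn_mono_AE:
  fixes f g :: "real^'n \<Rightarrow> real"
  assumes "L2loc f" "L2loc g" "AE x in lborel. norm x \<le> R \<longrightarrow> \<bar>f x\<bar> \<le> C * \<bar>g x\<bar> + D"
  shows "sqn R f \<le> 2 * C\<^sup>2 * sqn R g + 2 * D\<^sup>2 * measure lborel (cball (0::real^'n) R)"
proof -
  have "sqn R f \<le> (LINT x|lborel. 2 * C\<^sup>2 * (indicator (cball 0 R) x * (g x)\<^sup>2) + indicator (cball (0::real^'n) R) x * (2 * D\<^sup>2))"
    unfolding sqn_def
  proof (rule integral_mono_AE)
    show "AE x in lborel. indicator (cball 0 R) x * (f x)\<^sup>2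
      \<le> 2 * C\<^sup>2 * (indicator (cball 0 R) x * (g x)\<^sup>2) + indicator (cball 0 R) x * (2 * D\<^sup>2)"
      using assms(3)
    proof eventually_elim
      case (elim x)
      show ?case
      proof (cases "norm x \<le> R")
        case True
        with elim have "\<bar>f x\<bar>\<^sup>2 \<le> (C * \<bar>g x\<bar> + D)\<^sup>2" by (intro power_mono) auto
        also have "\<dots> \<le> 2 * C\<^sup>2 * (g x)\<^sup>2 + 2 * D\<^sup>2"
          using zero_le_power2[of "C * \<bar>g x\<bar> - D"] by (simp add: power2_eq_square algebra_simps)
        finally show ?thesis using True by (simp add: indicator_def)
      qed (simp add: indicator_def)
    qed
  qed (intro Bochner_Integration.integrable_add integrable_ball integrable_mult_right L2loc_int assms)+
  also have "\<dots> = 2 * C\<^sup>2 * sqn R g + 2 * D\<^sup>2 * measure lborel (cball (0::real^'n) R)"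
    by (subst Bochner_Integration.integral_add)
      (auto simp: sqn_def intro!: integrable_ball integrable_mult_right L2loc_int assms simp del: integrable_mult_left_iff)
  finally show ?thesis .
qed

text \<open>Serves Lipschitz images of a convergent sequence, where \<open>c\<close> absorbs the
  error of replacing the outer function by its limit, and multiplication by a locally bounded
  function, where \<open>c\<close> is zero and \<open>C\<close> is the bound on the ball.\<close>

lemma L2conv_dominated:
  fixes f :: "real^'n \<Rightarrow> real"
  assumes X: "\<And>n. L2loc (X n)" and f: "L2loc f" and Y: "L2conv Y h" and c: "c \<longlonglongrightarrow> 0"
    and b: "\<And>R. \<exists>C. \<forall>n. AE x in lborel. norm x \<le> R \<longrightarrow> \<bar>X n x - f x\<bar> \<le> C * \<bar>Y n x - h x\<bar> + c n"
  shows "L2conv X f"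
  unfolding L2conv_def
proof (intro conjI allI X f)
  fix R :: real
  let ?v = "measure lborel (cball (0::real^'n) R)"
  obtain C where C: "\<And>n. AE x in lborel. norm x \<le> R \<longrightarrow> \<bar>X n x - f x\<bar> \<le> C * \<bar>Y n x - h x\<bar> + c n"
    using b by blast
  have Yh: "L2loc (Y n)" "L2loc h" "(\<lambda>n. sqn R (\<lambda>x. Y n x - h x)) \<longlonglongrightarrow> 0" for n
    using Y by (auto simp: L2conv_def)
  have "(\<lambda>n. 2 * C\<^sup>2 * sqn R (\<lambda>x. Y n x - h x) + 2 * (c n)\<^sup>2 * ?v) \<longlonglongrightarrow> 2 * C\<^sup>2 * 0 + 2 * 0\<^sup>2 * ?v"
    by (intro tendsto_intros Yh c)
  then have lim: "(\<lambda>n. 2 * C\<^sup>2 * sqn R (\<lambda>x. Y n x - h x) + 2 * (c n)\<^sup>2 * ?v) \<longlonglongrightarrow> 0" by simp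
  show "(\<lambda>n. sqn R (\<lambda>x. X n x - f x)) \<longlonglongrightarrow> 0"
  proof (rule tendsto_sandwich[OF _ _ tendsto_const lim])
    show "\<forall>\<^sub>F n in sequentially. sqn R (\<lambda>x. X n x - f x) \<le> 2 * C\<^sup>2 * sqn R (\<lambda>x. Y n x - h x) + 2 * (c n)\<^sup>2 * ?v"
      by (intro always_eventually allI sqn_mono_AE L2loc_diff X f Yh C)
  qed (simp add: sqn_nonneg)
qed

lemma L2conv_mult:
  assumes "Lloc W" "L2conv X f" shows "L2conv (\<lambda>n x. W x * X n x) (\<lambda>x. W x * f x)"
proof (rule L2conv_dominated[OF _ _ assms(2)])
  show "L2loc (\<lambda>x. W x * X n x)" "L2loc (\<lambda>x. W x * f x)" for n
    using assms by (auto intro: L2loc_mult simp: L2conv_def)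
  show "(\<lambda>_. 0::real) \<longlonglongrightarrow> 0" by simp
  fix R
  obtain C where C: "C \<ge> 0" "AE x in lborel. norm x \<le> R \<longrightarrow> \<bar>W x\<bar> \<le> C"
    using assms(1) unfolding Lloc_def by blast
  have "AE x in lborel. norm x \<le> R \<longrightarrow> \<bar>W x * X n x - W x * f x\<bar> \<le> C * \<bar>X n x - f x\<bar> + 0" for n
    using C(2)
  proof eventually_elim
    case (elim x)
    then show ?case by (auto simp: right_diff_distrib[symmetric] abs_mult intro: mult_right_mono)
  qed
  then show "\<exists>C. \<forall>n. AE x in lborel. norm x \<le> R \<longrightarrow> \<bar>W x * X n x - W x * f x\<bar> \<le> C * \<bar>X n x - f x\<bar> + 0"
    by blast
qed

text \<open>The estimate is pointwise: with a = X n - f and b = Y n - g, the difference of the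
  products is a b + f b + a g, and the mixed terms are bounded by Young's inequality with a weight
  \<open>e n\<close> that varies with n.\<close>

lemma L2conv_integral:
  fixes f g :: "real^'n \<Rightarrow> real"
  assumes \<zeta>: "bsupp \<zeta>" and X: "L2conv X f" and Y: "L2conv Y g"
  shows "(\<lambda>n. LINT x|lborel. \<zeta> x * X n x * Y n x) \<longlonglongrightarrow> (LINT x|lborel. \<zeta> x * f x * g x)"
proof -
  have L: "L2loc (X n)" "L2loc f" "L2loc (Y n)" "L2loc g" for n using X Y by (auto simp: L2conv_def)
  obtain C R where C: "C \<ge> 0" "\<And>x. \<bar>\<zeta> x\<bar> \<le> C * indicator (cball 0 R) x"
    using \<zeta> unfolding bsupp_def by blast
  define S where "S n = sqn R (\<lambda>x. X n x - f x) + sqn R (\<lambda>x. Y n x - g x)" for n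
  define K where "K = sqn R f + sqn R g"
  have S0: "0 \<le> S n" for n by (simp add: S_def sqn_nonneg)
  have S: "S \<longlonglongrightarrow> 0"
    using tendsto_add[of "\<lambda>n. sqn R (\<lambda>x. X n x - f x)" 0 _ "\<lambda>n. sqn R (\<lambda>x. Y n x - g x)" 0] X Y
    unfolding L2conv_def S_def[abs_def] by simp
  \<comment> \<open>The weight has to tend to 0, so that \<open>e n * K\<close> disappears, and yet
    satisfy \<open>S n / e n \<le> sqrt (S n)\<close>. The root of \<open>S n\<close> does both; the
    extra 1/(n+1) keeps it positive when \<open>S n\<close> is zero.\<close>
  define e where "e n = sqrt (S n) + 1 / real (Suc n)" for n
  have e0: "e n > 0" for n unfolding e_def using S0 by (simp add: add_nonneg_pos)
  have e: "e \<longlonglongrightarrow> 0"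
    using tendsto_add[OF tendsto_real_sqrt[OF S] LIMSEQ_inverse_real_of_nat]
    by (simp add: e_def[abs_def] inverse_eq_divide)
  have bound: "\<bar>(LINT x|lborel. \<zeta> x * X n x * Y n x) - (LINT x|lborel. \<zeta> x * f x * g x)\<bar>
      \<le> C * (S n + e n * K + sqrt (S n))" for n
  proof -
    let ?I = "\<lambda>x::real^'n. indicator (cball 0 R) x :: real"
    let ?a = "\<lambda>x. X n x - f x" and ?b = "\<lambda>x. Y n x - g x"
    let ?B = "\<lambda>x. C * ((1 + 1 / e n) * (?I x * (?a x)\<^sup>2 + ?I x * (?b x)\<^sup>2) + e n * (?I x * (f x)\<^sup>2 + ?I x * (g x)\<^sup>2))"
    have int: "integrable lborel (\<lambda>x. \<zeta> x * X n x * Y n x)" "integrable lborel (\<lambda>x. \<zeta> x * f x * g x)"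
      by (intro bsupp_L2_product \<zeta> L)+
    have ints: "integrable lborel (\<lambda>x. ?I x * (?a x)\<^sup>2)" "integrable lborel (\<lambda>x. ?I x * (?b x)\<^sup>2)"
       "integrable lborel (\<lambda>x. ?I x * (f x)\<^sup>2)" "integrable lborel (\<lambda>x. ?I x * (g x)\<^sup>2)"
      by (intro L2loc_int L2loc_diff L)+
    have pt: "\<bar>\<zeta> x * X n x * Y n x - \<zeta> x * f x * g x\<bar> \<le> ?B x" for x
    proof -
      have am: "p * q \<le> p\<^sup>2 + q\<^sup>2" if "0 \<le> p" "0 \<le> q" for p q :: real
        using zero_le_power2[of "p - q"] mult_nonneg_nonneg[OF that] by (simp add: power2_eq_square algebra_simps)
      have ame: "p * q \<le> e n * p\<^sup>2 + q\<^sup>2 / e n" if "0 \<le> p" "0 \<le> q" for p q :: real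
        using am[of "sqrt (e n) * p" "q / sqrt (e n)"] that e0[of n]
        by (simp add: power_mult_distrib power_divide)
      have "\<bar>X n x * Y n x - f x * g x\<bar> = \<bar>?a x * ?b x + f x * ?b x + ?a x * g x\<bar>"
        by (simp add: algebra_simps)
      also have "\<dots> \<le> \<bar>?a x\<bar> * \<bar>?b x\<bar> + \<bar>f x\<bar> * \<bar>?b x\<bar> + \<bar>?a x\<bar> * \<bar>g x\<bar>"
        using abs_triangle_ineq[of "?a x * ?b x + f x * ?b x" "?a x * g x"]
          abs_triangle_ineq[of "?a x * ?b x" "f x * ?b x"] unfolding abs_mult by linarith
      also have "\<dots> \<le> (1 + 1 / e n) * ((?a x)\<^sup>2 + (?b x)\<^sup>2) + e n * ((f x)\<^sup>2 + (g x)\<^sup>2)"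
        using am[of "\<bar>?a x\<bar>" "\<bar>?b x\<bar>"] ame[of "\<bar>f x\<bar>" "\<bar>?b x\<bar>"] ame[of "\<bar>g x\<bar>" "\<bar>?a x\<bar>", unfolded mult.commute[of "\<bar>g x\<bar>"]]
        by (simp add: distrib_left distrib_right add_divide_distrib)
      finally have *: "\<bar>X n x * Y n x - f x * g x\<bar> \<le> \<dots>" .
      have "\<bar>\<zeta> x * X n x * Y n x - \<zeta> x * f x * g x\<bar> = \<bar>\<zeta> x\<bar> * \<bar>X n x * Y n x - f x * g x\<bar>"
        by (simp add: abs_mult[symmetric] algebra_simps)
      also have "\<dots> \<le> (C * ?I x) * ((1 + 1 / e n) * ((?a x)\<^sup>2 + (?b x)\<^sup>2) + e n * ((f x)\<^sup>2 + (g x)\<^sup>2))"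
        by (intro mult_mono C * ) (auto simp: C)
      also have "\<dots> = ?B x" by (simp add: algebra_simps)
      finally show ?thesis .
    qed
    have iB: "integrable lborel ?B"
      by (intro Bochner_Integration.integrable_add integrable_mult_right ints)
    have "\<bar>(LINT x|lborel. \<zeta> x * X n x * Y n x) - (LINT x|lborel. \<zeta> x * f x * g x)\<bar>
      = \<bar>LINT x|lborel. \<zeta> x * X n x * Y n x - \<zeta> x * f x * g x\<bar>"
      by (simp add: int)
    also have "\<dots> \<le> (LINT x|lborel. ?B x)"
      using Bochner_Integration.integral_norm_bound_integral[OF Bochner_Integration.integrable_diff[OF int] iB] pt by simp
    also have "\<dots> = C * ((1 + 1 / e n) * S n + e n * K)"
      unfolding S_def K_def sqn_def
      by (rule has_bochner_integral_integral_eq)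
        (intro has_bochner_integral_add has_bochner_integral_mult_right has_bochner_integral_integrable ints)
    also have "S n / e n \<le> sqrt (S n)"
    proof -
      have "S n = sqrt (S n) * sqrt (S n)" using S0 by simp
      also have "\<dots> \<le> sqrt (S n) * e n" by (intro mult_left_mono) (auto simp: e_def S0)
      finally show ?thesis using e0[of n] by (simp add: divide_le_eq)
    qed
    then have "C * ((1 + 1 / e n) * S n + e n * K) \<le> C * (S n + e n * K + sqrt (S n))"
      by (intro mult_left_mono C) (simp add: distrib_right)
    finally show ?thesis .
  qed
  have "(\<lambda>n. C * (S n + e n * K + sqrt (S n))) \<longlonglongrightarrow> C * (0 + 0 * K + sqrt 0)"
    by (intro tendsto_intros S e)
  then have "(\<lambda>n. C * (S n + e n * K + sqrt (S n))) \<longlonglongrightarrow> 0" by simp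
  then show ?thesis
    by (rule LIM_zero_cancel[OF Lim_null_comparison[rotated]]) (simp add: bound)
qed

lemma L2conv_integral1:
  assumes "bsupp \<zeta>" "L2conv X f"
  shows "(\<lambda>n. LINT x|lborel. \<zeta> x * X n x) \<longlonglongrightarrow> (LINT x|lborel. \<zeta> x * f x)"
  using L2conv_integral[OF assms L2conv_const[OF L2loc_const[of 1]]] by simp

section \<open>Scaling of integrals and Taylor estimates\<close>

lemma lborel_integral_affine:
  fixes f :: "real^'n \<Rightarrow> real"
  assumes "f \<in> borel_measurable borel" "c \<noteq> 0"
  shows "(LINT x|lborel. f x) = \<bar>c\<bar> ^ CARD('n) * (LINT x|lborel. f (t + c *\<^sub>R x))"
proof -
  have "(LINT x|lborel. f x) = (LINT x|density (distr lborel borel (\<lambda>x. t + c *\<^sub>R x)) (\<lambda>_. ennreal (\<bar>c\<bar> ^ CARD('n))). f x)"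
    using lborel_affine[OF assms(2), of t] by simp
  also have "\<dots> = (LINT x|distr lborel borel (\<lambda>x. t + c *\<^sub>R x). \<bar>c\<bar> ^ CARD('n) *\<^sub>R f x)"
    using assms by (intro integral_density) auto
  also have "\<dots> = (LINT x|lborel. \<bar>c\<bar> ^ CARD('n) *\<^sub>R f (t + c *\<^sub>R x))"
    using assms by (intro integral_distr) auto
  finally show ?thesis by simp
qed

lemma sm_along_line:
  assumes "sm f"
  shows "((\<lambda>t. f (x + t *\<^sub>R v)) has_real_derivative (\<Sum>i\<in>UNIV. v $ i * pd i f (x + t *\<^sub>R v))) (at t)"
proof -
  have "((\<lambda>t. x + t *\<^sub>R v) has_derivative (\<lambda>h. h *\<^sub>R v)) (at t)"
    by (auto intro!: derivative_eq_intros)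
  from has_derivative_compose[OF this sm_has_derivative[OF assms]]
  show ?thesis by (simp add: has_field_derivative_def mult.assoc sum_distrib_left[symmetric] mult_commute_abs)
qed

lemma sm_mvt:
  assumes "sm f"
  shows "\<exists>t. 0 < t \<and> t < 1 \<and> f (x + v) - f x = (\<Sum>i\<in>UNIV. v $ i * pd i f (x + t *\<^sub>R v))"
  using MVT2[of 0 1 "\<lambda>t. f (x + t *\<^sub>R v)", OF _ sm_along_line[OF assms]] by auto

lemma tf_bounded: "tf f \<Longrightarrow> \<exists>C\<ge>0. \<forall>x. \<bar>f x\<bar> \<le> C"
  using tf_bsupp[of f] unfolding bsupp_def
  by (metis abs_ge_zero indicator_simps mult.right_neutral mult_zero_right order_trans)

lemma tf_lipschitz: assumes "tf f" shows "\<exists>L\<ge>0. \<forall>x v. \<bar>f (x + v) - f x\<bar> \<le> L * norm v"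
proof -
  have "\<forall>i. \<exists>C\<ge>0. \<forall>x. \<bar>pd i f x\<bar> \<le> C" using tf_bounded tf_pd assms by blast
  then obtain C where C: "\<And>i. C i \<ge> 0" "\<And>i x. \<bar>pd i f x\<bar> \<le> C i" by metis
  have "\<bar>f (x + v) - f x\<bar> \<le> (\<Sum>i\<in>UNIV. C i) * norm v" for x v
  proof -
    obtain t where "f (x + v) - f x = (\<Sum>i\<in>UNIV. v $ i * pd i f (x + t *\<^sub>R v))"
      using sm_mvt[OF tf_sm[OF assms]] by blast
    also have "\<bar>\<dots>\<bar> \<le> (\<Sum>i\<in>UNIV. norm v * C i)"
      by (rule order_trans[OF sum_abs sum_mono]) (auto simp: abs_mult intro!: mult_mono C component_le_norm_cart)
    finally show ?thesis by (simp add: sum_distrib_left mult.commute)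
  qed
  then show ?thesis using sum_nonneg[of UNIV C] C by blast
qed

text \<open>The Lipschitz bounds of the first derivatives, inserted after one application of the
  mean value theorem on the segment, already give the quadratic remainder. Uniformity in
  \<open>x\<close> comes from the bounded support.\<close>

lemma tf_taylor:
  assumes "tf f"
  shows "\<exists>L\<ge>0. \<forall>x v. \<bar>f (x + v) - f x - (\<Sum>i\<in>UNIV. v $ i * pd i f x)\<bar> \<le> L * (norm v)\<^sup>2"
proof -
  have "\<forall>i. \<exists>C\<ge>0. \<forall>x v. \<bar>pd i f (x + v) - pd i f x\<bar> \<le> C * norm v" using tf_lipschitz tf_pd assms by blast
  then obtain C where C: "\<And>i. C i \<ge> 0" "\<And>i x v. \<bar>pd i f (x + v) - pd i f x\<bar> \<le> C i * norm v" by metis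
  have "\<bar>f (x + v) - f x - (\<Sum>i\<in>UNIV. v $ i * pd i f x)\<bar> \<le> (\<Sum>i\<in>UNIV. C i) * (norm v)\<^sup>2" for x v
  proof -
    obtain t where t: "0 < t" "t < 1" "f (x + v) - f x = (\<Sum>i\<in>UNIV. v $ i * pd i f (x + t *\<^sub>R v))"
      using sm_mvt[OF tf_sm[OF assms]] by blast
    have "\<bar>pd i f (x + t *\<^sub>R v) - pd i f x\<bar> \<le> C i * norm v" for i
    proof -
      have "\<bar>pd i f (x + t *\<^sub>R v) - pd i f x\<bar> \<le> C i * norm (t *\<^sub>R v)" by (rule C)
      also have "\<dots> \<le> C i * norm v" using t C(1)[of i] by (intro mult_left_mono) (auto simp: mult_left_le_one_le)
      finally show ?thesis .
    qed
    then have "\<bar>\<Sum>i\<in>UNIV. v $ i * (pd i f (x + t *\<^sub>R v) - pd i f x)\<bar> \<le> (\<Sum>i\<in>UNIV. norm v * (C i * norm v))"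
      by (intro order_trans[OF sum_abs sum_mono]) (auto simp: abs_mult intro!: mult_mono component_le_norm_cart)
    then show ?thesis
      by (simp add: t(3) right_diff_distrib sum_subtractf sum_distrib_left sum_distrib_right power2_eq_square mult_ac)
  qed
  then show ?thesis using sum_nonneg[of UNIV C] C by blast
qed

section \<open>Convolution and mollification\<close>

definition conv :: "(real^'n \<Rightarrow> real) \<Rightarrow> (real^'n \<Rightarrow> real) \<Rightarrow> real^'n \<Rightarrow> real" where
  "conv h \<eta> x = (LINT y|lborel. h y * \<eta> (x - y))"

text \<open>The equation \<Delta>h = D in the sense of distributions.\<close>

definition weak_lap :: "(real^'n \<Rightarrow> real) \<Rightarrow> (real^'n \<Rightarrow> real) \<Rightarrow> bool" where
  "weak_lap h D \<longleftrightarrow> (\<forall>\<phi>. tf \<phi> \<longrightarrow> (LINT x|lborel. h x * lap \<phi> x) = (LINT x|lborel. D x * \<phi> x))"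

lemma L2loc_abs: "L2loc h \<Longrightarrow> L2loc (\<lambda>x. \<bar>h x\<bar>)"
  by (auto simp: L2loc_def)

lemma tf_reflect: "tf \<eta> \<Longrightarrow> tf (\<lambda>y. \<eta> (x - y))"
  using tf_affine[of \<eta> "-1" x] by simp

lemma conv_integrable: "L2loc h \<Longrightarrow> tf \<eta> \<Longrightarrow> integrable lborel (\<lambda>y. h y * \<eta> (x - y))"
  by (intro bsupp_L2_int' tf_bsupp tf_reflect)

text \<open>The quadratic Taylor remainder of the kernel is uniform in \<open>y\<close>, and for |v|
  \<le> 1 it vanishes outside one fixed ball, on which \<open>h\<close> is integrable. This gives
  the explicit error \<open>K * (norm v)\<^sup>2\<close>.\<close>

lemma conv_has_derivative:
  fixes h \<eta> :: "real^'n \<Rightarrow> real"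
  assumes h: "L2loc h" and \<eta>: "tf \<eta>"
  shows "(conv h \<eta> has_derivative (\<lambda>v. \<Sum>i\<in>UNIV. v $ i * conv h (pd i \<eta>) x)) (at x)"
proof -
  let ?D = "\<lambda>v. \<Sum>i\<in>UNIV. v $ i * conv h (pd i \<eta>) x"
  obtain L where L: "L \<ge> 0" "\<And>x v. \<bar>\<eta> (x + v) - \<eta> x - (\<Sum>i\<in>UNIV. v $ i * pd i \<eta> x)\<bar> \<le> L * (norm v)\<^sup>2"
    using tf_taylor[OF \<eta>] by blast
  obtain R where R: "supp_in R \<eta>" using \<eta> by (auto simp: tf_def)
  \<comment> \<open>Beyond this radius both |x - y| and |x - y + v| exceed \<open>R\<close>; the
    summand 1 accounts for |v| \<le> 1.\<close>
  define S where "S = norm x + \<bar>R\<bar> + 1"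
  define K where "K = L * (LINT y|lborel. indicator (cball 0 S) y * \<bar>h y\<bar>)"
  have int: "integrable lborel (\<lambda>y. indicator (cball 0 S) y * \<bar>h y\<bar>)"
    by (rule bsupp_L2_int[OF bsupp_indicator L2loc_abs[OF h]])
  have bound: "\<bar>conv h \<eta> (x + v) - conv h \<eta> x - ?D v\<bar> \<le> K * (norm v)\<^sup>2" if "norm v \<le> 1" for v
  proof -
    let ?r = "\<lambda>y. \<eta> (x - y + v) - \<eta> (x - y) - (\<Sum>i\<in>UNIV. v $ i * pd i \<eta> (x - y))"
    have i1: "integrable lborel (\<lambda>y. h y * \<eta> (x + v - y))" "integrable lborel (\<lambda>y. h y * \<eta> (x - y))"
      "\<And>i. integrable lborel (\<lambda>y. v $ i * (h y * pd i \<eta> (x - y)))"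
      by (intro integrable_mult_right conv_integrable h \<eta> tf_pd)+
    have "h y * ?r y = h y * \<eta> (x + v - y) - h y * \<eta> (x - y) - (\<Sum>i\<in>UNIV. v $ i * (h y * pd i \<eta> (x - y)))" for y
      by (simp add: algebra_simps sum_distrib_left)
    moreover have "has_bochner_integral lborel (\<lambda>y. h y * \<eta> (x + v - y) - h y * \<eta> (x - y) - (\<Sum>i\<in>UNIV. v $ i * (h y * pd i \<eta> (x - y))))
       (conv h \<eta> (x + v) - conv h \<eta> x - (\<Sum>i\<in>UNIV. LINT y|lborel. v $ i * (h y * pd i \<eta> (x - y))))"
      unfolding conv_def
      by (intro has_bochner_integral_diff has_bochner_integral_sum has_bochner_integral_integrable i1)
    ultimately have I: "has_bochner_integral lborel (\<lambda>y. h y * ?r y) (conv h \<eta> (x + v) - conv h \<eta> x - ?D v)"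
      by (simp add: conv_def)
    have pt: "\<bar>h y * ?r y\<bar> \<le> L * (norm v)\<^sup>2 * (indicator (cball 0 S) y * \<bar>h y\<bar>)" for y
    proof (cases "norm y \<le> S")
      case True
      have "\<bar>h y * ?r y\<bar> \<le> \<bar>h y\<bar> * (L * (norm v)\<^sup>2)"
        unfolding abs_mult by (intro mult_left_mono L) auto
      with True show ?thesis by (simp add: mult_ac)
    next
      case False
      have "norm y \<le> norm (x - y) + norm x" using norm_triangle_sub[of y x] by (simp add: norm_minus_commute)
      then have 1: "R < norm (x - y)" using False by (simp add: S_def)
      have "norm (x - y) \<le> norm (x - y + v) + norm v" using norm_triangle_ineq4[of "x - y + v" v] by simp
      then have 2: "R < norm (x - y + v)"
        using False that \<open>norm y \<le> norm (x - y) + norm x\<close> by (simp add: S_def)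
      have "?r y = 0" using R 1 2 supp_in_pd[OF R] by (simp add: supp_in_def)
      then show ?thesis using L(1) by simp
    qed
    have "\<bar>LINT y|lborel. h y * ?r y\<bar> \<le> (LINT y|lborel. L * (norm v)\<^sup>2 * (indicator (cball 0 S) y * \<bar>h y\<bar>))"
      using Bochner_Integration.integral_norm_bound_integral[of lborel "\<lambda>y. h y * ?r y" "\<lambda>y. L * (norm v)\<^sup>2 * (indicator (cball 0 S) y * \<bar>h y\<bar>)"]
        I int pt by (simp add: has_bochner_integral_iff)
    then have "\<bar>LINT y|lborel. h y * ?r y\<bar> \<le> L * (norm v)\<^sup>2 * (LINT y|lborel. indicator (cball 0 S) y * \<bar>h y\<bar>)"
      by simp
    moreover have "(LINT y|lborel. h y * ?r y) = conv h \<eta> (x + v) - conv h \<eta> x - ?D v"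
      using I by (rule has_bochner_integral_integral_eq)
    ultimately show ?thesis by (simp only: K_def mult_ac)
  qed
  have "((\<lambda>v. norm (conv h \<eta> (x + v) - conv h \<eta> x - ?D v) / norm v) \<longlongrightarrow> 0) (at 0)"
  proof (rule Lim_null_comparison)
    have "\<forall>\<^sub>F v in at (0::real^'n). v \<in> ball 0 1 - {0}" by (auto simp: eventually_at dist_norm intro!: exI[of _ 1])
    then show "\<forall>\<^sub>F v in at 0. norm (norm (conv h \<eta> (x + v) - conv h \<eta> x - ?D v) / norm v) \<le> K * norm v"
    proof eventually_elim
      case (elim v)
      then show ?case using bound[of v] by (simp add: divide_le_eq power2_eq_square mult.assoc)
    qed
    show "((\<lambda>v. K * norm v) \<longlongrightarrow> 0) (at 0)"
      by (rule tendsto_eq_intros tendsto_norm_zero | simp)+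
  qed
  moreover have "bounded_linear ?D"
    by (intro bounded_linear_sum bounded_linear_mult_const bounded_linear_vec_nth)
  ultimately show ?thesis by (simp add: has_derivative_at)
qed

lemma pd_conv: "L2loc h \<Longrightarrow> tf \<eta> \<Longrightarrow> pd i (conv h \<eta>) = conv h (pd i \<eta>)"
  by (rule ext) (simp add: pd_eq[OF conv_has_derivative] sum_axis_mult)

lemma sm_conv: assumes "L2loc h" "tf \<eta>" shows "sm (conv h \<eta>)"
proof -
  have d: "conv h \<eta> differentiable (at x)" if "tf \<eta>" for \<eta> x
    using conv_has_derivative[OF assms(1) that] unfolding differentiable_def by blast
  have "RC k (conv h \<eta>)" if "tf \<eta>" for k \<eta>
    using that
  proof (induction k arbitrary: \<eta>)
    case 0
    then show ?case using d by (simp add: differentiable_everywhere_imp_continuous)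
  next
    case (Suc k)
    then show ?case using d assms(1) by (simp add: pd_conv tf_pd)
  qed
  with assms show ?thesis by (simp add: sm_def)
qed

lemma lap_conv: assumes "L2loc h" "tf \<eta>" shows "lap (conv h \<eta>) = conv h (lap \<eta>)"
proof
  fix x
  have "lap (conv h \<eta>) x = (\<Sum>i\<in>UNIV. conv h (pd i (pd i \<eta>)) x)"
    using assms by (simp add: lap_def pd_conv tf_pd)
  also have "\<dots> = conv h (lap \<eta>) x"
    unfolding conv_def lap_def sum_distrib_left
    by (rule Bochner_Integration.integral_sum[symmetric]) (intro conv_integrable assms tf_pd)
  finally show "lap (conv h \<eta>) x = conv h (lap \<eta>) x" .
qed

text \<open>As a function of y, \<open>\<eta> (x - y)\<close> is itself a test function, and its
  Laplacian is the reflected one because two sign changes cancel. Testing the weak equation with it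
  makes the Laplacian of the mollification explicit.\<close>

lemma lap_conv_weak:
  assumes "L2loc h" "tf \<eta>" "weak_lap h D" shows "lap (conv h \<eta>) = conv D \<eta>"
proof
  fix x
  have "lap (\<lambda>y. \<eta> (x - y)) = (\<lambda>y. lap \<eta> (x - y))"
    using lap_affine_sm[OF tf_sm[OF assms(2)], of x "-1"] by simp
  then show "lap (conv h \<eta>) x = conv D \<eta> x"
    using assms tf_reflect[OF assms(2), of x] unfolding weak_lap_def lap_conv[OF assms(1,2)] conv_def by metis
qed

text \<open>Convolving the constant 1 with \<open>f\<close> gives a constant function, whose
  derivative is 0. By \<open>pd_conv\<close> the same derivative is the convolution of 1 with
  \<open>pd i f\<close>, that is, its integral.\<close>

lemma integral_pd_zero:
  fixes f :: "real^'n \<Rightarrow> real"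
  assumes "tf f" shows "(LINT x|lborel. pd i f x) = 0"
proof -
  have m: "g \<in> borel_measurable borel" if "tf g" for g :: "real^'n \<Rightarrow> real"
    using that by (intro sm_measurable tf_sm)
  have c: "conv (\<lambda>_. 1) g x = (LINT y|lborel. g y)" if "tf g" for g :: "real^'n \<Rightarrow> real" and x
    using lborel_integral_affine[of g "-1" x] m[OF that] by (simp add: conv_def)
  have "conv (\<lambda>_. 1) f = (\<lambda>x. LINT y|lborel. f y)" using c[OF assms] by auto
  then have "pd i (conv (\<lambda>_. 1) f) 0 = 0" by (simp add: pd_const)
  then show ?thesis using pd_conv[OF L2loc_const[of 1] assms, of i] c[OF tf_pd[OF assms]] by simp
qed

section \<open>The mollifier\<close>

definition bump :: "real^'n \<Rightarrow> real" where "bump x = flat 1 (1 - (norm x)\<^sup>2)"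

lemma bump_nonneg: "0 \<le> bump x" by (simp add: bump_def flat_1_nonneg)
lemma supp_bump: "supp_in 1 (bump :: real^'n \<Rightarrow> real)"
proof -
  have "bump x = 0" if "1 < norm x" for x :: "real^'n"
    using one_less_power[OF that, of 2] by (simp add: bump_def flat_def)
  then show ?thesis by (simp add: supp_in_def)
qed

lemma sm_bump: "sm bump"
  unfolding bump_def[abs_def] by (intro sm_flat sm_diff sm_const sm_norm_sq)

lemma tf_bump: "tf bump" using sm_bump supp_bump by (auto simp: tf_def)

lemma bump_ge: "norm x \<le> 1/2 \<Longrightarrow> exp (-2) \<le> bump x"
proof -
  assume "norm x \<le> 1/2"
  then have "(norm x)\<^sup>2 \<le> (1/2)\<^sup>2" by (intro power_mono) auto
  then have "1 - (norm x)\<^sup>2 \<ge> 1/2" by (simp add: power2_eq_square)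
  then show ?thesis by (simp add: bump_def flat_def field_simps)
qed

lemma integral_bump_pos: "0 < (LINT x|lborel. bump (x::real^'n))"
proof -
  have "0 < exp (-2) * measure lborel (cball (0::real^'n) (1/2))"
    by simp
  also have "\<dots> = (LINT x|lborel. indicator (cball (0::real^'n) (1/2)) x * exp (-2))"
    by (simp add: integral_ball)
  also have "\<dots> \<le> (LINT x|lborel. bump (x::real^'n))"
    by (intro integral_mono integrable_ball tf_integrable tf_bump)
      (auto simp: indicator_def bump_nonneg intro: bump_ge)
  finally show ?thesis .
qed

text \<open>Approximate identity at scale 1/(n+1). The support radius never exceeds 1, which is the
  origin of the enlargements of balls by 1 below.\<close>

definition rho :: "nat \<Rightarrow> real^'n \<Rightarrow> real" where
  "rho n x = real (Suc n) ^ CARD('n) / (LINT y|lborel. bump (y::real^'n)) * bump (real (Suc n) *\<^sub>R x)"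

lemma rho_nonneg: "0 \<le> rho n x"
  unfolding rho_def using integral_bump_pos by (intro mult_nonneg_nonneg divide_nonneg_pos bump_nonneg) auto

lemma tf_rho: "tf (rho n)"
proof -
  have "tf (\<lambda>x::real^'n. bump (0 + real (Suc n) *\<^sub>R x))" by (rule tf_affine[OF tf_bump]) simp
  then show ?thesis unfolding rho_def[abs_def] by (intro tf_cmult) simp
qed

lemma integral_rho: "(LINT x|lborel. rho n (x::real^'n)) = 1"
proof -
  have "(LINT x|lborel. bump (x::real^'n))
     = \<bar>real (Suc n)\<bar> ^ CARD('n) * (LINT x|lborel. bump (0 + real (Suc n) *\<^sub>R (x::real^'n)))"
    using lborel_integral_affine[of "bump :: real^'n \<Rightarrow> real" "real (Suc n)" 0]
    by (simp add: sm_measurable sm_bump)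
  then show ?thesis using integral_bump_pos[where 'n='n] unfolding rho_def
    by (auto simp del: of_nat_Suc simp: field_simps)
qed

lemma rho_measurable [measurable]: "rho n \<in> borel_measurable borel"
  by (intro sm_measurable tf_sm tf_rho)

lemma integral_rho_reflect: "(LINT y|lborel. rho n ((x::real^'n) - y)) = 1"
  using lborel_integral_affine[OF rho_measurable[of n], of "-1" x] integral_rho[of n, where 'n='n] by simp

lemma integral_rho_shift: "(LINT y|lborel. rho n ((y::real^'n) - x)) = 1"
  using lborel_integral_affine[OF rho_measurable[of n], of 1 "-x"] integral_rho[of n, where 'n='n] by simp

lemma supp_rho: "supp_in (1 / real (Suc n)) (rho n)"
proof -
  have "bump (real (Suc n) *\<^sub>R x) = 0" if "1 / real (Suc n) < norm x" for x :: "real^'n"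
  proof -
    have "1 < norm (real (Suc n) *\<^sub>R x)" using that by (simp add: field_simps del: of_nat_Suc)
    then show ?thesis using supp_bump unfolding supp_in_def by blast
  qed
  then show ?thesis unfolding supp_in_def rho_def by (metis mult_zero_right)
qed

lemma conv_add:
  assumes "L2loc f" "L2loc g" "tf \<eta>" shows "conv (\<lambda>x. f x + g x) \<eta> x = conv f \<eta> x + conv g \<eta> x"
  unfolding conv_def using conv_integrable[OF assms(1,3), of x] conv_integrable[OF assms(2,3), of x]
  by (simp add: distrib_right)

lemma conv_mono_AE:
  assumes "L2loc f" "L2loc g" "tf \<eta>" "\<And>x. 0 \<le> \<eta> x" "AE y in lborel. \<eta> (x - y) \<noteq> 0 \<longrightarrow> f y \<le> g y"
  shows "conv f \<eta> x \<le> conv g \<eta> x"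
  unfolding conv_def
proof (rule integral_mono_AE[OF conv_integrable[OF assms(1,3)] conv_integrable[OF assms(2,3)]])
  show "AE y in lborel. f y * \<eta> (x - y) \<le> g y * \<eta> (x - y)"
    using assms(5) by eventually_elim (metis assms(4) mult_right_mono mult_zero_right order_refl)
qed

lemma sqn_add:
  assumes "L2loc f" "L2loc g"
  shows "sqn R (\<lambda>x. f x + g x) \<le> 2 * sqn R f + 2 * sqn R g"
proof -
  have am: "(a + b)\<^sup>2 \<le> 2 * a\<^sup>2 + 2 * b\<^sup>2" for a b :: real
    using zero_le_power2[of "a - b"] by (simp add: power2_eq_square algebra_simps)
  have "sqn R (\<lambda>x. f x + g x) \<le> (LINT x|lborel. 2 * (indicator (cball 0 R) x * (f x)\<^sup>2) + 2 * (indicator (cball 0 R) x * (g x)\<^sup>2))"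
    unfolding sqn_def
    by (intro integral_mono Bochner_Integration.integrable_add integrable_mult_right L2loc_int L2loc_add assms)
      (auto simp: indicator_def am)
  also have "\<dots> = 2 * sqn R f + 2 * sqn R g"
    unfolding sqn_def
    by (rule has_bochner_integral_integral_eq)
      (intro has_bochner_integral_add has_bochner_integral_mult_right has_bochner_integral_integrable L2loc_int assms)
  finally show ?thesis .
qed

lemma sqn_minus: "sqn R (\<lambda>x. - f x) = sqn R f"
  by (simp add: sqn_def)

text \<open>Jensen's inequality for the probability density \<open>rho n (x - y)\<close> in y: the
  variance of \<open>k\<close> under it is nonnegative.\<close>

lemma conv_rho_sq:
  assumes "L2loc k" shows "(conv k (rho n) x)\<^sup>2 \<le> (LINT y|lborel. (k y)\<^sup>2 * rho n (x - y))"
    and "integrable lborel (\<lambda>y. (k y)\<^sup>2 * rho n (x - y))"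
proof -
  let ?p = "\<lambda>y. rho n (x - y)" and ?m = "conv k (rho n) x"
  have tp: "tf ?p" by (rule tf_reflect[OF tf_rho])
  have i2: "integrable lborel (\<lambda>y. (k y)\<^sup>2 * ?p y)"
    using bsupp_L2_product[OF tf_bsupp[OF tp] assms assms] by (simp add: power2_eq_square mult_ac)
  have i1: "integrable lborel (\<lambda>y. k y * ?p y)" by (rule conv_integrable[OF assms tf_rho])
  have i0: "integrable lborel ?p" by (rule tf_integrable[OF tp])
  have e: "(LINT y|lborel. ?p y) = 1"
    by (rule integral_rho_reflect)
  have "0 \<le> (LINT y|lborel. (k y - ?m)\<^sup>2 * ?p y)"
    by (intro integral_nonneg_AE AE_I2) (simp add: rho_nonneg)
  also have "(\<lambda>y. (k y - ?m)\<^sup>2 * ?p y) = (\<lambda>y. (k y)\<^sup>2 * ?p y + (?m\<^sup>2 * ?p y - 2 * ?m * (k y * ?p y)))"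
    by (auto simp: power2_eq_square algebra_simps)
  also have "(LINT y|lborel. (k y)\<^sup>2 * ?p y + (?m\<^sup>2 * ?p y - 2 * ?m * (k y * ?p y))) = (LINT y|lborel. (k y)\<^sup>2 * ?p y) + (?m\<^sup>2 * 1 - 2 * ?m * ?m)"
    unfolding e[symmetric]
    by (rule has_bochner_integral_integral_eq)
      (use i2 i1 i0 e in \<open>auto intro!: has_bochner_integral_add has_bochner_integral_diff has_bochner_integral_mult_right
         simp: conv_def has_bochner_integral_iff\<close>)
  finally show "?m\<^sup>2 \<le> (LINT y|lborel. (k y)\<^sup>2 * ?p y)" by (simp add: power2_eq_square)
  show "integrable lborel (\<lambda>y. (k y)\<^sup>2 * rho n (x - y))" by (rule i2)
qed

text \<open>Jensen's inequality pointwise, then Tonelli: integrating the kernel over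
  \<open>x\<close> gives 1. The kernel reaches at most distance 1, so only values of
  \<open>k\<close> in the ball of radius \<open>R + 1\<close> matter.\<close>

lemma sqn_conv_rho:
  fixes k :: "real^'n \<Rightarrow> real"
  assumes "L2loc k" shows "sqn R (conv k (rho n)) \<le> sqn (R + 1) k"
proof -
  have [measurable]: "k \<in> borel_measurable borel" "rho n \<in> borel_measurable borel"
    using assms sm_measurable[OF tf_sm[OF tf_rho[of n]]] by (auto simp: L2loc_def)
  have [measurable]: "cball (0::real^'n) (R + 1) \<in> sets borel" by simp
  let ?I = "\<lambda>y. indicator (cball 0 (R + 1)) y * (k y)\<^sup>2 :: real"
  have Lc: "L2loc (conv k (rho n))" by (intro L2loc_sm sm_conv assms tf_rho)
  have "ennreal (sqn R (conv k (rho n))) = (\<integral>\<^sup>+x. ennreal (indicator (cball 0 R) x * (conv k (rho n) x)\<^sup>2) \<partial>lborel)"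
    unfolding sqn_def by (rule nn_integral_eq_integral[symmetric, OF L2loc_int[OF Lc]]) (auto simp: indicator_def)
  also have "\<dots> \<le> (\<integral>\<^sup>+x. \<integral>\<^sup>+y. ennreal (?I y * rho n (x - y)) \<partial>lborel \<partial>lborel)"
  proof (rule nn_integral_mono)
    fix x :: "real^'n"
    show "ennreal (indicator (cball 0 R) x * (conv k (rho n) x)\<^sup>2) \<le> (\<integral>\<^sup>+y. ennreal (?I y * rho n (x - y)) \<partial>lborel)"
    proof (cases "norm x \<le> R")
      case True
      have "ennreal (indicator (cball 0 R) x * (conv k (rho n) x)\<^sup>2) \<le> ennreal (LINT y|lborel. (k y)\<^sup>2 * rho n (x - y))"
        using conv_rho_sq(1)[OF assms, of n x] True by (intro ennreal_leI) simp
      also have "\<dots> = (\<integral>\<^sup>+y. ennreal ((k y)\<^sup>2 * rho n (x - y)) \<partial>lborel)"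
        by (rule nn_integral_eq_integral[symmetric, OF conv_rho_sq(2)[OF assms]]) (simp add: rho_nonneg)
      also have "\<dots> = (\<integral>\<^sup>+y. ennreal (?I y * rho n (x - y)) \<partial>lborel)"
      proof (rule nn_integral_cong)
        fix y :: "real^'n"
        show "ennreal ((k y)\<^sup>2 * rho n (x - y)) = ennreal (?I y * rho n (x - y))"
        proof (cases "norm (x - y) \<le> 1")
          case True2: True
          have "norm y \<le> norm x + norm (x - y)" using norm_triangle_ineq4[of x "x - y"] by simp
          with True True2 show ?thesis by simp
        next
          case False
          have "1 / real (Suc n) \<le> 1" by simp
          with False have "1 / real (Suc n) < norm (x - y)" by linarith
          then have "rho n (x - y) = 0" using supp_rho unfolding supp_in_def by blast
          then show ?thesis by simp
        qed
      qed
      finally show ?thesis .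
    qed simp
  qed
  also have "\<dots> = (\<integral>\<^sup>+y. \<integral>\<^sup>+x. ennreal (?I y * rho n (x - y)) \<partial>lborel \<partial>lborel)"
    by (rule lborel_pair.Fubini'[symmetric]) measurable
  also have "\<dots> = (\<integral>\<^sup>+y. ennreal (?I y) \<partial>lborel)"
  proof (rule nn_integral_cong)
    fix y :: "real^'n"
    have "tf (\<lambda>x. rho n (x - y))" using tf_affine[OF tf_rho[of n], of 1 "-y"] by simp
    then have i: "integrable lborel (\<lambda>x. ?I y * rho n (x - y))" by (intro integrable_mult_right tf_integrable)
    have "(\<integral>\<^sup>+x. ennreal (?I y * rho n (x - y)) \<partial>lborel) = ennreal (LINT x|lborel. ?I y * rho n (x - y))"
      by (rule nn_integral_eq_integral[OF i]) (simp add: rho_nonneg)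
    also have "(LINT x|lborel. ?I y * rho n (x - y)) = ?I y"
      by (simp add: integral_rho_shift)
    finally show "(\<integral>\<^sup>+x. ennreal (?I y * rho n (x - y)) \<partial>lborel) = ennreal (?I y)" .
  qed
  also have "\<dots> = ennreal (sqn (R + 1) k)"
    unfolding sqn_def by (rule nn_integral_eq_integral[OF L2loc_int[OF assms]]) (auto simp: indicator_def)
  finally show ?thesis using sqn_nonneg ennreal_le_iff by blast
qed

lemma conv_rho_continuous:
  fixes g :: "real^'n \<Rightarrow> real"
  assumes g: "continuous_on UNIV g" and e: "e > 0"
  shows "\<forall>\<^sub>F n in sequentially. \<forall>x. norm x \<le> R \<longrightarrow> \<bar>conv g (rho n) x - g x\<bar> \<le> e"
proof -
  have L: "L2loc g" by (intro Lloc_imp_L2loc Lloc_continuous g)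
  have "uniformly_continuous_on (cball 0 (R + 1)) g"
    by (intro compact_uniformly_continuous continuous_on_subset[OF g]) auto
  then obtain d where d: "d > 0" "\<And>x y. norm x \<le> R + 1 \<Longrightarrow> norm y \<le> R + 1 \<Longrightarrow> dist y x < d \<Longrightarrow> dist (g y) (g x) < e"
    unfolding uniformly_continuous_on_def using e by (metis mem_cball_0)
  have "\<forall>\<^sub>F n in sequentially. inverse (real (Suc n)) < d"
    using order_tendstoD(2)[OF LIMSEQ_inverse_real_of_nat d(1)] .
  then show ?thesis
  proof eventually_elim
    case (elim n)
    show ?case
    proof (intro allI impI)
      fix x :: "real^'n" assume x: "norm x \<le> R"
      let ?p = "\<lambda>y. rho n (x - y)"
      have e1: "(LINT y|lborel. ?p y) = 1"
        by (rule integral_rho_reflect)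
      have i0: "integrable lborel ?p" by (intro tf_integrable tf_reflect tf_rho)
      have i1: "integrable lborel (\<lambda>y. g y * ?p y)" by (rule conv_integrable[OF L tf_rho])
      have "conv g (rho n) x - g x = (LINT y|lborel. g y * ?p y) - (LINT y|lborel. g x * ?p y)"
        by (simp add: conv_def e1)
      also have "\<dots> = (LINT y|lborel. g y * ?p y - g x * ?p y)"
        by (rule Bochner_Integration.integral_diff[symmetric]) (use i0 i1 in auto)
      also have "norm \<dots> \<le> (LINT y|lborel. e * ?p y)"
      proof (rule Bochner_Integration.integral_norm_bound_integral)
        show "integrable lborel (\<lambda>y. g y * ?p y - g x * ?p y)" "integrable lborel (\<lambda>y. e * ?p y)"
          using i0 i1 by auto
        fix y
        show "norm (g y * ?p y - g x * ?p y) \<le> e * ?p y"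
        proof (cases "norm (x - y) \<le> 1 / real (Suc n)")
          case True
          have "1 / real (Suc n) \<le> 1" by simp
          then have "norm y \<le> R + 1" using norm_triangle_ineq4[of x "x - y"] x True by (simp only: diff_diff_eq2 add_diff_cancel_left')
          moreover have "dist y x < d" using True elim by (simp add: dist_norm norm_minus_commute inverse_eq_divide)
          ultimately have "\<bar>g y - g x\<bar> \<le> e" using d(2)[of x y] x by (simp add: dist_real_def)
          then show ?thesis using rho_nonneg[of n "x - y"]
            by (simp add: left_diff_distrib[symmetric] abs_mult mult_right_mono)
        next
          case False
          then have "1 / real (Suc n) < norm (x - y)" by linarith
          then have "?p y = 0" using supp_rho unfolding supp_in_def by blast
          then show ?thesis by simp
        qed
      qed
      also have "\<dots> = e" by (simp add: e1)
      finally show "\<bar>conv g (rho n) x - g x\<bar> \<le> e" by simp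
    qed
  qed
qed

section \<open>Convergence of mollifications\<close>

lemma sqn_dct:
  fixes Y :: "nat \<Rightarrow> real^'n \<Rightarrow> real"
  assumes Y: "\<And>n. Y n \<in> borel_measurable borel" and w: "L2loc w"
    and b: "\<And>n x. \<bar>Y n x\<bar> \<le> \<bar>w x\<bar>" and lim: "AE x in lborel. (\<lambda>n. Y n x) \<longlonglongrightarrow> 0"
  shows "(\<lambda>n. sqn R (Y n)) \<longlonglongrightarrow> 0"
proof -
  have "(\<lambda>n. LINT x|lborel. indicator (cball 0 R) x * (Y n x)\<^sup>2) \<longlonglongrightarrow> (LINT x::real^'n|lborel. (0::real))"
  proof (rule integral_dominated_convergence[where w="\<lambda>x. indicator (cball 0 R) x * (w x)\<^sup>2"])
    show "(\<lambda>x. indicator (cball 0 R) x * (Y n x)\<^sup>2) \<in> borel_measurable lborel" for n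
      by (rule ball_sq_measurable[OF Y])
    show "integrable lborel (\<lambda>x. indicator (cball 0 R) x * (w x)\<^sup>2)" by (rule L2loc_int[OF w])
    show "AE x in lborel. (\<lambda>n. indicator (cball 0 R) x * (Y n x)\<^sup>2) \<longlonglongrightarrow> 0"
      using lim
    proof eventually_elim
      case (elim x)
      have "(\<lambda>n. indicator (cball 0 R) x * (Y n x)\<^sup>2) \<longlonglongrightarrow> indicator (cball 0 R) x * 0\<^sup>2"
        by (intro tendsto_intros elim)
      then show ?case by simp
    qed
    show "AE x in lborel. norm (indicator (cball 0 R) x * (Y n x)\<^sup>2) \<le> indicator (cball 0 R) x * (w x)\<^sup>2" for n
      using b[of n] by (intro AE_I2) (auto simp: indicator_def abs_le_square_iff)
  qed simp
  then show ?thesis by (simp add: sqn_def)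
qed

text \<open>A measurable function is an almost everywhere limit of continuous ones, but without
  control of their size. Clamping the values of \<open>h\<close> and of the approximants to [-m, m]
  supplies the dominating function.\<close>

lemma L2loc_approx_continuous:
  fixes h :: "real^'n \<Rightarrow> real"
  assumes h: "L2loc h" and e: "e > 0"
  shows "\<exists>g. continuous_on UNIV g \<and> sqn R (\<lambda>x. h x - g x) < e"
proof -
  define cl :: "nat \<Rightarrow> real \<Rightarrow> real" where "cl m t = max (- real m) (min (real m) t)" for m t
  have cl_b: "\<bar>cl m t\<bar> \<le> real m" and cl_d: "\<bar>t - cl m t\<bar> \<le> \<bar>t\<bar>" for m t
    by (auto simp: cl_def max_def min_def)
  have cl_c: "continuous_on UNIV (cl m)" for m
    unfolding cl_def[abs_def] by (intro continuous_intros)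
  have [measurable]: "h \<in> borel_measurable borel" "cl m \<in> borel_measurable borel" for m
    using h cl_c by (auto simp: L2loc_def intro: borel_measurable_continuous_onI)
  have "(\<lambda>m. sqn R (\<lambda>x. h x - cl m (h x))) \<longlonglongrightarrow> 0"
  proof (rule sqn_dct[where w=h, OF _ h cl_d])
    show "AE x in lborel. (\<lambda>m. h x - cl m (h x)) \<longlonglongrightarrow> 0"
    proof (rule AE_I2)
      fix x
      obtain m0 where "\<bar>h x\<bar> \<le> real m0" using real_arch_simple by blast
      then have "\<forall>m\<ge>m0. h x - cl m (h x) = 0" by (auto simp: cl_def)
      then show "(\<lambda>m. h x - cl m (h x)) \<longlonglongrightarrow> 0" 
        by (intro tendsto_eventually) (auto simp: eventually_sequentially)
    qed
  qed measurable
  from order_tendstoD(2)[OF this, of "e/4"] e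
  obtain m where m: "sqn R (\<lambda>x. h x - cl m (h x)) < e/4" by (auto simp: eventually_sequentially)
  define k where "k x = cl m (h x)" for x
  have k[measurable]: "k \<in> borel_measurable borel" unfolding k_def[abs_def] by measurable
  then have "k measurable_on UNIV"
    by (intro lebesgue_measurable_imp_measurable_on) (auto intro: measurable_completion)
  then obtain N g where N: "negligible N" and g: "\<And>n. continuous_on UNIV (g n)"
     and gl: "\<And>x. x \<notin> N \<Longrightarrow> (\<lambda>n. g n x) \<longlonglongrightarrow> k x"
    unfolding measurable_on_def by auto
  have "AE x in lebesgue. x \<notin> N" using N by (intro AE_not_in) (simp add: negligible_iff_null_sets)
  then have N': "AE x in lborel. x \<notin> N" by (simp add: AE_completion_iff)
  have clg: "continuous_on UNIV (\<lambda>x. cl m (g n x))" for n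
    by (rule continuous_on_compose2[OF cl_c g]) simp
  have Lk: "L2loc k"
    by (rule L2loc_bound[OF L2loc_const[of 1] k])
      (auto simp: k_def intro!: exI[of _ "real m"] AE_I2 order_trans[OF cl_b])
  have "(\<lambda>n. sqn R (\<lambda>x. k x - cl m (g n x))) \<longlonglongrightarrow> 0"
  proof (rule sqn_dct[where w="\<lambda>x. 2 * real m"])
    show "(\<lambda>x. k x - cl m (g n x)) \<in> borel_measurable borel" for n
      using borel_measurable_continuous_onI[OF clg[of n]] k by measurable
    show "\<bar>k x - cl m (g n x)\<bar> \<le> \<bar>2 * real m\<bar>" for n x
      using cl_b[of m "h x"] cl_b[of m "g n x"] by (simp add: k_def)
    show "AE x in lborel. (\<lambda>n. k x - cl m (g n x)) \<longlonglongrightarrow> 0"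
      using N'
    proof eventually_elim
      case (elim x)
      have "cl m (k x) = k x" by (simp add: k_def cl_def)
      moreover have "(\<lambda>n. cl m (g n x)) \<longlonglongrightarrow> cl m (k x)"
        by (rule continuous_on_tendsto_compose[OF cl_c gl[OF elim]]) auto
      ultimately have "(\<lambda>n. k x - cl m (g n x)) \<longlonglongrightarrow> k x - k x" by (intro tendsto_diff) auto
      then show ?case by simp
    qed
  qed (rule L2loc_const)
  from order_tendstoD(2)[OF this, of "e/4"] e
  obtain n where n: "sqn R (\<lambda>x. k x - cl m (g n x)) < e/4" by (auto simp: eventually_sequentially)
  have "sqn R (\<lambda>x. (h x - k x) + (k x - cl m (g n x))) \<le> 2 * sqn R (\<lambda>x. h x - k x) + 2 * sqn R (\<lambda>x. k x - cl m (g n x))"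
    by (intro sqn_add L2loc_diff h Lk Lloc_imp_L2loc Lloc_continuous clg)
  then have "sqn R (\<lambda>x. h x - cl m (g n x)) < e" using m n by (simp add: k_def)
  with clg show ?thesis by blast
qed

lemma conv_rho_L2conv:
  fixes h :: "real^'n \<Rightarrow> real"
  assumes h: "L2loc h" shows "L2conv (\<lambda>n. conv h (rho n)) h"
  unfolding L2conv_def
proof (intro conjI allI h)
  show "L2loc (conv h (rho n))" for n by (intro L2loc_sm sm_conv h tf_rho)
  fix R
  let ?v = "measure lborel (cball (0::real^'n) R)"
  have R1: "sqn R k \<le> sqn (R + 1) k" if "L2loc k" for k :: "real^'n \<Rightarrow> real"
    unfolding sqn_def by (intro integral_mono L2loc_int that) (auto simp: indicator_def)
  show "(\<lambda>n. sqn R (\<lambda>x. conv h (rho n) x - h x)) \<longlonglongrightarrow> 0"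
  proof (rule LIMSEQ_I)
    fix e :: real assume e: "0 < e"
    \<comment> \<open>With k = h - g, the mollification error of \<open>h\<close> is the sum of
      those of \<open>k\<close> and \<open>g\<close>. Each use of \<open>sqn_add\<close> doubles, so
      the total is at most 2 (2/16 + 2/16) + 2/8 = 3/4 of \<open>e\<close>.\<close>
    obtain g where g: "continuous_on UNIV g" "sqn (R + 1) (\<lambda>x. h x - g x) < e / 16"
      using L2loc_approx_continuous[OF h, of "e/16" "R+1"] e by auto
    have Lg: "L2loc g" by (intro Lloc_imp_L2loc Lloc_continuous g)
    define k where "k x = h x - g x" for x
    have Lk: "L2loc k" unfolding k_def[abs_def] by (intro L2loc_diff h Lg)
    \<comment> \<open>The \<open>+ 1\<close> guards against a ball of measure 0.\<close>
    define d where "d = sqrt (e / (16 * (?v + 1)))"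
    have d: "d > 0" "d\<^sup>2 * ?v \<le> e / 16"
    proof -
      have "?v + 1 > 0" by (simp add: add_nonneg_pos)
      then show "d > 0" unfolding d_def using e by simp
      have "d\<^sup>2 * ?v = e / 16 * (?v / (?v + 1))" unfolding d_def using e \<open>?v + 1 > 0\<close> by simp
      also have "\<dots> \<le> e / 16 * 1" using e \<open>?v + 1 > 0\<close> by (intro mult_left_mono) auto
      finally show "d\<^sup>2 * ?v \<le> e / 16" by simp
    qed
    have "\<forall>\<^sub>F n in sequentially. \<forall>x. norm x \<le> R \<longrightarrow> \<bar>conv g (rho n) x - g x\<bar> \<le> d"
      by (rule conv_rho_continuous[OF g(1) d(1)])
    then obtain n0 where n0: "\<And>n x. n \<ge> n0 \<Longrightarrow> norm x \<le> R \<Longrightarrow> \<bar>conv g (rho n) x - g x\<bar> \<le> d"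
      by (auto simp: eventually_sequentially)
    have "norm (sqn R (\<lambda>x. conv h (rho n) x - h x) - 0) < e" if n: "n \<ge> n0" for n
    proof -
      have L: "L2loc (conv k (rho n))" "L2loc (conv g (rho n))" by (intro L2loc_sm sm_conv Lk Lg tf_rho)+
      have eq: "conv h (rho n) x - h x = (conv k (rho n) x + (- k x)) + (conv g (rho n) x - g x)" for x
        using conv_add[OF Lk Lg tf_rho, of n x] by (simp add: k_def)
      have Lmk: "L2loc (\<lambda>x. - k x)" using L2loc_cmult[OF Lk, of "-1"] by simp
      have "sqn R (\<lambda>x. conv h (rho n) x - h x)
         \<le> 2 * sqn R (\<lambda>x. conv k (rho n) x + (- k x)) + 2 * sqn R (\<lambda>x. conv g (rho n) x - g x)"
        unfolding eq by (intro sqn_add L2loc_add L2loc_diff L Lg Lmk)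
      also have "sqn R (\<lambda>x. conv k (rho n) x + (- k x)) \<le> 2 * sqn R (conv k (rho n)) + 2 * sqn R k"
        using sqn_add[OF L(1) Lmk, of R] by (simp add: sqn_minus)
      also have "sqn R (conv k (rho n)) \<le> e / 16" using sqn_conv_rho[OF Lk, of R n] g(2) by (simp add: k_def[abs_def])
      also have "sqn R k \<le> e / 16" using R1[OF Lk] g(2) by (simp add: k_def[abs_def])
      also have "sqn R (\<lambda>x. conv g (rho n) x - g x) \<le> 2 * 0\<^sup>2 * sqn R g + 2 * d\<^sup>2 * ?v"
        by (rule sqn_mono_AE[OF L2loc_diff[OF L(2) Lg] Lg]) (use n0[OF n] in auto)
      also have "2 * 0\<^sup>2 * sqn R g + 2 * d\<^sup>2 * ?v \<le> e / 8" using d(2) by simp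
      finally have "sqn R (\<lambda>x. conv h (rho n) x - h x) < e" using e by simp
      then show ?thesis using sqn_nonneg[of R "\<lambda>x. conv h (rho n) x - h x"] by simp
    qed
    then show "\<exists>no. \<forall>n\<ge>no. norm (sqn R (\<lambda>x. conv h (rho n) x - h x) - 0) < e" by blast
  qed
qed

section \<open>The energy form\<close>

definition schr :: "(real^'n \<Rightarrow> real) \<Rightarrow> (real^'n \<Rightarrow> real) \<Rightarrow> real^'n \<Rightarrow> real" where
  "schr V f x = - lap f x + V x * f x"

definition grad2 :: "(real^'n \<Rightarrow> real) \<Rightarrow> real^'n \<Rightarrow> real" where
  "grad2 f x = (\<Sum>i\<in>UNIV. (pd i f x)\<^sup>2)"

lemma integral_div_zero:
  assumes "\<And>i. tf (w i)"
  shows "(LINT x|lborel. (\<Sum>i\<in>UNIV. pd i (w i) x)) = 0"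
    and "integrable lborel (\<lambda>x. \<Sum>i\<in>UNIV. pd i (w i) x)"
  using assms by (simp_all add: tf_integrable tf_pd integral_pd_zero)

lemma tf_grad2: assumes "tf f" shows "tf (grad2 f)"
  unfolding grad2_def[abs_def] power2_eq_square
  by (intro tf_sum tf_mult tf_pd sm_pd tf_sm assms)

lemma tf_L2_int: "tf f \<Longrightarrow> L2loc g \<Longrightarrow> integrable lborel (\<lambda>x. f x * g x)"
  by (intro bsupp_L2_int tf_bsupp)

lemma schr_L2_int:
  assumes "tf f" "L2loc g" "Lloc V"
  shows "integrable lborel (\<lambda>x. g x * schr V f x)"
proof -
  have "integrable lborel (\<lambda>x. f x * (V x * g x) - lap f x * g x)"
    by (intro Bochner_Integration.integrable_diff tf_L2_int tf_lap L2loc_mult assms)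
  then show ?thesis by (simp add: schr_def algebra_simps)
qed

text \<open>The two integrands differ by the divergence of f grad g - g grad f, which has bounded
  support as soon as \<open>g\<close> has. So \<open>f\<close> may be any smooth function, in
  particular \<open>subsol\<close>.\<close>

lemma schr_symmetric:
  assumes f: "sm f" and g: "tf g" and V: "Lloc V"
  shows "(LINT x|lborel. f x * schr V g x) = (LINT x|lborel. g x * schr V f x)"
proof -
  have s: "sm f" "sm g" using f g by (auto simp: tf_sm)
  have g': "tf (pd i g)" for i by (rule tf_pd[OF g])
  let ?w = "\<lambda>i x. f x * pd i g x - g x * pd i f x"
  have w: "tf (?w i)" for i
    using tf_add[OF tf_mult(2)[OF g' s(1)] tf_cmult[OF tf_mult(1)[OF g sm_pd[OF s(1)]], of "-1"]] by simp
  have pw: "pd i (?w i) x = f x * pd i (pd i g) x - g x * pd i (pd i f) x" for i x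
  proof -
    have "pd i (\<lambda>x. f x * pd i g x + (-1) * (g x * pd i f x)) x
       = f x * pd i (pd i g) x - g x * pd i (pd i f) x"
      by (simp only: pd_add_sm pd_mult_sm pd_cmult_sm s sm_pd sm_mult sm_cmult) (simp add: algebra_simps)
    then show ?thesis by simp
  qed
  have eq: "g x * schr V f x = f x * schr V g x + (\<Sum>i\<in>UNIV. pd i (?w i) x)" for x
    unfolding pw by (simp add: schr_def lap_def sum_subtractf sum_distrib_left algebra_simps)
  have "integrable lborel (\<lambda>x. f x * schr V g x)" by (rule schr_L2_int[OF g L2loc_sm[OF s(1)] V])
  then show ?thesis unfolding eq
    using integral_div_zero[of ?w, OF w] by (simp only: Bochner_Integration.integral_add)
qed

text \<open>One integration by parts suffices, since the mixed terms combine to the divergence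
  of \<open>F\<^sup>2 \<zeta> \<nabla>\<zeta>\<close>.\<close>

lemma energy_identity:
  assumes \<zeta>: "tf \<zeta>" and F: "sm F" and V: "Lloc V"
  shows "(LINT x|lborel. (\<zeta> x * F x) * schr V (\<lambda>x. \<zeta> x * F x) x)
     = (LINT x|lborel. grad2 \<zeta> x * (F x)\<^sup>2 - (\<zeta> x)\<^sup>2 * (F x * lap F x) + (\<zeta> x)\<^sup>2 * (V x * (F x)\<^sup>2))"
proof -
  have s: "sm \<zeta>" using \<zeta> by (rule tf_sm)
  let ?w = "\<lambda>i x. (F x * F x) * (\<zeta> x * pd i \<zeta> x)"
  have w: "tf (?w i)" for i by (intro tf_mult sm_mult F \<zeta> sm_pd s)
  have z2: "tf (\<lambda>x. (\<zeta> x)\<^sup>2)" unfolding power2_eq_square by (intro tf_mult \<zeta> s)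
  have pw: "pd i (?w i) x = 2 * (\<zeta> x * F x) * (pd i \<zeta> x * pd i F x) + (F x)\<^sup>2 * (\<zeta> x * pd i (pd i \<zeta>) x) + (pd i \<zeta> x)\<^sup>2 * (F x)\<^sup>2" for i x
    by (simp only: pd_mult_sm F s sm_pd sm_mult) (simp add: algebra_simps power2_eq_square)
  have eq: "grad2 \<zeta> x * (F x)\<^sup>2 - (\<zeta> x)\<^sup>2 * (F x * lap F x) + (\<zeta> x)\<^sup>2 * (V x * (F x)\<^sup>2)
     = (\<zeta> x * F x) * schr V (\<lambda>x. \<zeta> x * F x) x + (\<Sum>i\<in>UNIV. pd i (?w i) x)" for x
  proof -
    have "(\<Sum>i\<in>UNIV. pd i (?w i) x) = 2 * (\<zeta> x * F x) * (\<Sum>i\<in>UNIV. pd i \<zeta> x * pd i F x)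
        + (F x)\<^sup>2 * (\<zeta> x * lap \<zeta> x) + grad2 \<zeta> x * (F x)\<^sup>2"
      unfolding pw sum.distrib grad2_def lap_def
      by (simp only: sum_distrib_left sum_distrib_right)
    then show ?thesis
      by (simp add: schr_def lap_mult_sm s F) (simp add: algebra_simps power2_eq_square)
  qed
  have "integrable lborel (\<lambda>x. (\<zeta> x * F x) * schr V (\<lambda>x. \<zeta> x * F x) x)"
    by (intro schr_L2_int tf_mult \<zeta> F s sm_mult L2loc_sm V)
  then show ?thesis unfolding eq
    using integral_div_zero[of ?w, OF w] by (simp only: Bochner_Integration.integral_add)
qed

section \<open>The smooth positive part\<close>

definition spos :: "real \<Rightarrow> real \<Rightarrow> real" where "spos d t = (t + sqrt (t\<^sup>2 + d\<^sup>2)) / 2"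

lemma sqrt_bounds:
  assumes "0 < (d::real)"
  shows "0 < sqrt (t\<^sup>2 + d\<^sup>2)" "\<bar>t\<bar> \<le> sqrt (t\<^sup>2 + d\<^sup>2)" "sqrt (t\<^sup>2 + d\<^sup>2) \<le> \<bar>t\<bar> + d"
proof -
  show "0 < sqrt (t\<^sup>2 + d\<^sup>2)" using assms by (simp add: add_nonneg_pos)
  show "\<bar>t\<bar> \<le> sqrt (t\<^sup>2 + d\<^sup>2)" by (rule real_le_rsqrt) simp
  show "sqrt (t\<^sup>2 + d\<^sup>2) \<le> \<bar>t\<bar> + d"
    by (rule real_le_lsqrt) (use assms in \<open>auto simp: power2_eq_square algebra_simps\<close>)
qed

text \<open>The quotient in the third bound is \<open>spos d t\<close> times its derivative, the
  coefficient of the Laplacian after the chain rule. With s the root, it lies below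
  \<open>spos d t\<close> because \<open>spos d t\<close> is at most s, and above
  \<open>max t 0\<close> because (t + s)^2 / 4 \<ge> t s.\<close>

lemma spos_bounds:
  assumes d: "0 < d"
  shows "0 \<le> spos d t" "\<bar>spos d t - max t 0\<bar> \<le> d"
    "\<bar>(spos d t)\<^sup>2 / sqrt (t\<^sup>2 + d\<^sup>2) - max t 0\<bar> \<le> d"
proof -
  define s where "s = sqrt (t\<^sup>2 + d\<^sup>2)"
  have s: "0 < s" "\<bar>t\<bar> \<le> s" "s \<le> \<bar>t\<bar> + d" "s\<^sup>2 = t\<^sup>2 + d\<^sup>2"
    using sqrt_bounds[OF d, of t] by (auto simp: s_def)
  show 0: "0 \<le> spos d t" using s by (simp add: spos_def s_def[symmetric])
  show 1: "\<bar>spos d t - max t 0\<bar> \<le> d" using s d by (auto simp: spos_def s_def[symmetric] max_def)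
  have le: "spos d t \<le> s" using s by (simp add: spos_def s_def[symmetric])
  have up: "(spos d t)\<^sup>2 / s \<le> spos d t"
    using mult_left_mono[OF le 0] s(1) by (simp add: divide_le_eq power2_eq_square)
  have lo: "max t 0 \<le> (spos d t)\<^sup>2 / s"
  proof (cases "t \<le> 0")
    case False
    have e: "spos d t = (t + s) / 2" by (simp add: spos_def s_def)
    have "(spos d t)\<^sup>2 - t * s = (s - t)\<^sup>2 / 4"
      unfolding e by (simp add: power2_eq_square field_simps)
    then have "t * s \<le> (spos d t)\<^sup>2" using zero_le_power2[of "s - t"] by linarith
    with s(1) False show ?thesis by (simp add: le_divide_eq)
  qed (use s(1) in auto)
  show "\<bar>(spos d t)\<^sup>2 / sqrt (t\<^sup>2 + d\<^sup>2) - max t 0\<bar> \<le> d"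
    using lo up 1 unfolding s_def by linarith
qed

lemma spos_deriv:
  assumes d: "0 < d"
  shows "(spos d has_real_derivative spos d t / sqrt (t\<^sup>2 + d\<^sup>2)) (at t)"
    and "((\<lambda>t. spos d t / sqrt (t\<^sup>2 + d\<^sup>2)) has_real_derivative d\<^sup>2 / (2 * sqrt (t\<^sup>2 + d\<^sup>2) ^ 3)) (at t)"
proof -
  define S where "S t = sqrt (t\<^sup>2 + d\<^sup>2)" for t
  have S: "0 < S t" "S t * S t = t\<^sup>2 + d\<^sup>2" "S t \<noteq> 0" for t
    using sqrt_bounds(1)[OF d, of t] by (auto simp: S_def)
  have p: "0 < t\<^sup>2 + d\<^sup>2" for t using sqrt_bounds(1)[OF d, of t] by simp
  have sp: "spos d t = (t + S t) / 2" for t by (simp add: spos_def S_def)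
  have "((\<lambda>t. t\<^sup>2 + d\<^sup>2) has_real_derivative 2 * t) (at t)" by (auto intro!: derivative_eq_intros)
  from DERIV_chain2[OF DERIV_real_sqrt[OF p] this]
  have dS: "(S has_real_derivative t / S t) (at t)" by (simp add: S_def[abs_def] field_simps)
  have e1: "(1 + t / S t) / 2 = spos d t / S t" for t using S(3)[of t] by (simp add: sp field_simps)
  have "((\<lambda>t. (t + S t) / 2) has_real_derivative (1 + t / S t) / 2) (at t)"
    by (intro DERIV_cdivide DERIV_add DERIV_ident dS)
  then show "(spos d has_real_derivative spos d t / sqrt (t\<^sup>2 + d\<^sup>2)) (at t)"
    unfolding e1 sp[symmetric] by (simp add: S_def)
  have "((\<lambda>t. (1 + t / S t) / 2) has_real_derivative (0 + (1 * S t - t * (t / S t)) / (S t * S t)) / 2) (at t)"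
    by (intro DERIV_cdivide DERIV_add DERIV_const DERIV_divide DERIV_ident dS S)
  moreover have "(0 + (1 * S t - t * (t / S t)) / (S t * S t)) / 2 = d\<^sup>2 / (2 * S t ^ 3)"
  proof -
    have "1 * S t - t * (t / S t) = (S t * S t - t\<^sup>2) / S t"
      using S(3)[of t] by (simp add: diff_divide_distrib power2_eq_square)
    also have "\<dots> = d\<^sup>2 / S t" unfolding S(2) by simp
    finally show ?thesis by (simp add: power3_eq_cube)
  qed
  ultimately show "((\<lambda>t. spos d t / sqrt (t\<^sup>2 + d\<^sup>2)) has_real_derivative d\<^sup>2 / (2 * sqrt (t\<^sup>2 + d\<^sup>2) ^ 3)) (at t)"
    unfolding e1 by (simp add: S_def)
qed

lemma lap_compose:
  assumes h: "sm h" and p1: "\<And>t. (p has_real_derivative p1 t) (at t)"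
    and p2: "\<And>t. (p1 has_real_derivative p2 t) (at t)"
  shows "lap (\<lambda>x. p (h x)) x = p1 (h x) * lap h x + p2 (h x) * grad2 h x"
proof -
  have 1: "pd i (\<lambda>x. p (h x)) = (\<lambda>x. p1 (h x) * pd i h x)" for i
    by (rule ext) (rule pd_compose(1)[OF sm_differentiable[OF h] p1])
  have "pd i (pd i (\<lambda>x. p (h x))) x = p1 (h x) * pd i (pd i h) x + p2 (h x) * (pd i h x)\<^sup>2" for i
    unfolding 1
    by (subst pd_mult[OF pd_compose(2)[OF sm_differentiable[OF h] p2] sm_differentiable[OF sm_pd[OF h]]])
      (simp add: pd_compose(1)[OF sm_differentiable[OF h] p2] power2_eq_square)
  then show ?thesis by (simp add: lap_def grad2_def sum.distrib sum_distrib_left)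
qed

lemma grad2_nonneg: "0 \<le> grad2 f x" unfolding grad2_def by (intro sum_nonneg) simp

lemma sm_spos: assumes "sm h" "0 < d" shows "sm (\<lambda>x. spos d (h x))"
proof -
  have "sm (\<lambda>x. (1/2) * (h x + sqrt ((h x)\<^sup>2 + d\<^sup>2)))"
    by (intro sm_cmult sm_add assms sm_sqrt sm_power sm_const) (use assms in \<open>simp add: add_nonneg_pos\<close>)
  then show ?thesis by (simp add: spos_def)
qed

text \<open>By the chain rule the two sides differ by \<open>spos\<close> times its second
  derivative times the squared gradient, which convexity makes nonnegative. The left side contains
  only \<open>h\<close> and its Laplacian, and both converge under mollification.\<close>

lemma spos_lap_ge:
  assumes h: "sm h" and d: "0 < d"
  shows "(spos d (h x))\<^sup>2 / sqrt ((h x)\<^sup>2 + d\<^sup>2) * lap h x \<le> spos d (h x) * lap (\<lambda>x. spos d (h x)) x"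
proof -
  have "lap (\<lambda>x. spos d (h x)) x = spos d (h x) / sqrt ((h x)\<^sup>2 + d\<^sup>2) * lap h x
      + d\<^sup>2 / (2 * sqrt ((h x)\<^sup>2 + d\<^sup>2) ^ 3) * grad2 h x"
    by (rule lap_compose[OF h spos_deriv[OF d]])
  moreover have "0 \<le> spos d (h x) * (d\<^sup>2 / (2 * sqrt ((h x)\<^sup>2 + d\<^sup>2) ^ 3) * grad2 h x)"
    by (intro mult_nonneg_nonneg divide_nonneg_nonneg spos_bounds d grad2_nonneg) auto
  ultimately show ?thesis by (simp add: distrib_left power2_eq_square)
qed

section \<open>Positive parts of zero-energy subsolutions\<close>

lemma energy_split:
  assumes f: "tf f" and \<phi>: "tf \<phi>" and V: "Lloc V"
  shows "(LINT x|lborel. (f x + \<phi> x) * schr V (\<lambda>x. f x + \<phi> x) x)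
     = (LINT x|lborel. f x * schr V f x) + 2 * (LINT x|lborel. f x * schr V \<phi> x) + (LINT x|lborel. \<phi> x * schr V \<phi> x)"
proof -
  have s: "sm f" "sm \<phi>" using f \<phi> by (auto simp: tf_sm)
  have i: "integrable lborel (\<lambda>x. f x * schr V f x)" "integrable lborel (\<lambda>x. f x * schr V \<phi> x)"
    "integrable lborel (\<lambda>x. \<phi> x * schr V f x)" "integrable lborel (\<lambda>x. \<phi> x * schr V \<phi> x)"
    by (intro schr_L2_int f \<phi> L2loc_sm s V)+
  have "(f x + \<phi> x) * schr V (\<lambda>x. f x + \<phi> x) x
     = (f x * schr V f x + f x * schr V \<phi> x) + (\<phi> x * schr V f x + \<phi> x * schr V \<phi> x)" for x
    by (simp add: schr_def lap_add_sm s algebra_simps)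
  then have "(LINT x|lborel. (f x + \<phi> x) * schr V (\<lambda>x. f x + \<phi> x) x)
     = ((LINT x|lborel. f x * schr V f x) + (LINT x|lborel. f x * schr V \<phi> x))
       + ((LINT x|lborel. \<phi> x * schr V f x) + (LINT x|lborel. \<phi> x * schr V \<phi> x))"
    by (simp add: i)
  then show ?thesis using schr_symmetric[OF s(1) \<phi> V] by simp
qed

text \<open>Nonnegativity of the form at \<open>\<zeta> F + \<phi>\<close>, with \<open>F\<close>
  the smoothed positive part of a mollification of \<open>h\<close>, passed to the limit. Since
  \<open>\<phi>\<close> is a test function, the cross term can put all derivatives on
  \<open>\<phi>\<close>. The inequality \<open>sub\<close> concerns \<open>D\<close> and
  \<open>V h\<close> themselves, not their mollifications, and so enters only at the end.\<close>

lemma localised_energy_nonneg: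
  fixes V h D :: "real^'n \<Rightarrow> real"
  assumes V: "Lloc V" and pos: "\<And>f. tf f \<Longrightarrow> 0 \<le> (LINT x|lborel. f x * schr V f x)"
    and h: "L2loc h" and D: "L2loc D" and w: "weak_lap h D"
    and sub: "AE x in lborel. 0 < h x \<longrightarrow> V x * h x \<le> D x"
    and \<zeta>: "tf \<zeta>" and \<phi>: "tf \<phi>"
  shows "0 \<le> (LINT x|lborel. grad2 \<zeta> x * (max (h x) 0)\<^sup>2)
     + 2 * (LINT x|lborel. \<zeta> x * max (h x) 0 * schr V \<phi> x) + (LINT x|lborel. \<phi> x * schr V \<phi> x)"
proof -
  define d where "d n = inverse (real (Suc n))" for n
  have d: "0 < d n" for n by (simp add: d_def)
  have pd: "0 < t\<^sup>2 + (d n)\<^sup>2" for t n using sqrt_bounds(1)[OF d, of t n] by simp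
  have d0: "d \<longlonglongrightarrow> 0" unfolding d_def[abs_def] by (rule LIMSEQ_inverse_real_of_nat)
  define H where "H n = conv h (rho n)" for n
  have H: "sm (H n)" "lap (H n) = conv D (rho n)" for n
    unfolding H_def by (intro sm_conv h tf_rho) (intro lap_conv_weak h tf_rho w)
  have Hc: "L2conv H h" unfolding H_def[abs_def] by (rule conv_rho_L2conv[OF h])
  have Dc: "L2conv (\<lambda>n. lap (H n)) D" unfolding H(2) by (rule conv_rho_L2conv[OF D])
  define p where "p x = max (h x) 0" for x
  have p: "L2loc p"
    by (rule L2loc_bound[OF h]) (use h in \<open>auto simp: p_def[abs_def] L2loc_def intro!: exI[of _ 1]\<close>)
  define F where "F n x = spos (d n) (H n x)" for n x
  \<comment> \<open>The product of \<open>F n\<close> with the derivative of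
    \<open>spos (d n)\<close> at \<open>H n\<close>. By \<open>spos_lap_ge\<close>,
    \<open>G n\<close> times the Laplacian of \<open>H n\<close> is at most \<open>F n\<close> times
    its own Laplacian.\<close>
  define G where "G n x = (spos (d n) (H n x))\<^sup>2 / sqrt ((H n x)\<^sup>2 + (d n)\<^sup>2)" for n x
  have F: "sm (F n)" for n unfolding F_def[abs_def] by (intro sm_spos H d)
  have G: "sm (G n)" for n unfolding G_def[abs_def]
    by (intro sm_divide sm_power sm_spos sm_sqrt sm_add sm_const H d) (simp_all add: pd)
  have Fc: "L2conv F p"
  proof (rule L2conv_dominated[OF L2loc_sm[OF F] p Hc d0])
    have "\<bar>F n x - p x\<bar> \<le> 1 * \<bar>H n x - h x\<bar> + d n" for n x
      using spos_bounds(2)[OF d[of n], of "H n x"] unfolding F_def p_def by (simp add: max_def abs_if split: if_splits)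
    then show "\<exists>C. \<forall>n. AE x in lborel. norm x \<le> R \<longrightarrow> \<bar>F n x - p x\<bar> \<le> C * \<bar>H n x - h x\<bar> + d n" for R
      by blast
  qed
  have Gc: "L2conv G p"
  proof (rule L2conv_dominated[OF L2loc_sm[OF G] p Hc d0])
    have "\<bar>G n x - p x\<bar> \<le> 1 * \<bar>H n x - h x\<bar> + d n" for n x
      using spos_bounds(3)[OF d[of n], of "H n x"] unfolding G_def p_def by (simp add: max_def abs_if split: if_splits)
    then show "\<exists>C. \<forall>n. AE x in lborel. norm x \<le> R \<longrightarrow> \<bar>G n x - p x\<bar> \<le> C * \<bar>H n x - h x\<bar> + d n" for R
      by blast
  qed
  let ?g = "grad2 \<zeta>" and ?z = "\<lambda>x. \<zeta> x * \<zeta> x" and ?q = "LINT x|lborel. \<phi> x * schr V \<phi> x"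
  have g: "tf ?g" and z: "tf ?z" by (intro tf_grad2 tf_mult \<zeta> tf_sm)+
  \<comment> \<open>Each integral is a fixed weight of bounded support times one or two locally L2
    convergent factors, the form that \<open>L2conv_integral\<close> and
    \<open>L2conv_integral1\<close> handle. \<open>F\<close> and \<open>G\<close> get separate slots
    since they agree only in the limit.\<close>
  define E where "E F G D = (LINT x|lborel. ?g x * F x * F x) - (LINT x|lborel. ?z x * G x * D x) + (LINT x|lborel. ?z x * F x * (V x * F x))
     + 2 * ((LINT x|lborel. \<phi> x * (\<zeta> x * F x) * V x) - (LINT x|lborel. lap \<phi> x * (\<zeta> x * F x))) + ?q" for F G D
  have cross: "(LINT x|lborel. \<phi> x * (\<zeta> x * f x) * V x) - (LINT x|lborel. lap \<phi> x * (\<zeta> x * f x))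
     = (LINT x|lborel. \<zeta> x * f x * schr V \<phi> x)" if "L2loc f" for f
  proof -
    have L: "L2loc (\<lambda>x. \<zeta> x * f x)" by (intro L2loc_mult Lloc_continuous sm_continuous tf_sm \<zeta> that)
    have "integrable lborel (\<lambda>x. \<phi> x * (\<zeta> x * f x) * V x)" "integrable lborel (\<lambda>x. lap \<phi> x * (\<zeta> x * f x))"
      by (intro bsupp_L2_product bsupp_L2_int tf_bsupp \<phi> tf_lap L Lloc_imp_L2loc V)+
    then show ?thesis
      by (simp add: Bochner_Integration.integral_diff[symmetric] schr_def algebra_simps del: Bochner_Integration.integral_diff)
  qed
  have EF: "0 \<le> E (F n) (G n) (lap (H n))" for n
  proof -
    have zF: "tf (\<lambda>x. \<zeta> x * F n x)" by (intro tf_mult \<zeta> F)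
    have "0 \<le> (LINT x|lborel. (\<zeta> x * F n x) * schr V (\<lambda>x. \<zeta> x * F n x) x)
       + 2 * (LINT x|lborel. \<zeta> x * F n x * schr V \<phi> x) + ?q"
      using pos[OF tf_add[OF zF \<phi>]] unfolding energy_split[OF zF \<phi> V] .
    also have "(LINT x|lborel. (\<zeta> x * F n x) * schr V (\<lambda>x. \<zeta> x * F n x) x)
       = (LINT x|lborel. grad2 \<zeta> x * (F n x)\<^sup>2 - (\<zeta> x)\<^sup>2 * (F n x * lap (F n) x) + (\<zeta> x)\<^sup>2 * (V x * (F n x)\<^sup>2))"
      by (rule energy_identity[OF \<zeta> F V])
    also have "\<dots> = (LINT x|lborel. ?g x * F n x * F n x - ?z x * F n x * lap (F n) x + ?z x * F n x * (V x * F n x))"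
      by (rule Bochner_Integration.integral_cong) (auto simp: power2_eq_square)
    also have "\<dots> \<le> (LINT x|lborel. ?g x * F n x * F n x - ?z x * G n x * lap (H n) x + ?z x * F n x * (V x * F n x))"
    proof (rule integral_mono)
      fix x
      have "?z x * (G n x * lap (H n) x) \<le> ?z x * (F n x * lap (F n) x)"
        using spos_lap_ge[OF H(1) d] unfolding F_def[abs_def] G_def by (intro mult_left_mono) auto
      then show "?g x * F n x * F n x - ?z x * F n x * lap (F n) x + ?z x * F n x * (V x * F n x)
         \<le> ?g x * F n x * F n x - ?z x * G n x * lap (H n) x + ?z x * F n x * (V x * F n x)"
        by (simp only: mult.assoc)
    qed (intro Bochner_Integration.integrable_add Bochner_Integration.integrable_diff bsupp_L2_product tf_bsupp g z
        L2loc_sm F G H sm_lap L2loc_mult V)+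
    also have "\<dots> = (LINT x|lborel. ?g x * F n x * F n x) - (LINT x|lborel. ?z x * G n x * lap (H n) x) + (LINT x|lborel. ?z x * F n x * (V x * F n x))"
      by (rule has_bochner_integral_integral_eq)
       (intro has_bochner_integral_add has_bochner_integral_diff has_bochner_integral_integrable bsupp_L2_product tf_bsupp g z
        L2loc_sm F G H sm_lap L2loc_mult V)
    finally show ?thesis unfolding E_def cross[OF L2loc_sm[OF F]] by simp
  qed
  have "(\<lambda>n. E (F n) (G n) (lap (H n))) \<longlonglongrightarrow> E p p D"
    unfolding E_def
    by (intro tendsto_add tendsto_diff tendsto_mult tendsto_const L2conv_integral L2conv_integral1 tf_bsupp g z
        Fc Gc Dc L2conv_mult V L2conv_const Lloc_imp_L2loc Lloc_continuous sm_continuous tf_sm \<zeta> \<phi> tf_lap)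
  then have "0 \<le> E p p D" by (rule LIMSEQ_le_const) (use EF in auto)
  moreover have "(LINT x|lborel. ?z x * p x * (V x * p x)) \<le> (LINT x|lborel. ?z x * p x * D x)"
  proof (rule integral_mono_AE)
    show "AE x in lborel. ?z x * p x * (V x * p x) \<le> ?z x * p x * D x"
      using sub
    proof eventually_elim
      case (elim x)
      show ?case
      proof (cases "0 < h x")
        case True
        with elim show ?thesis by (intro mult_left_mono) (auto simp: p_def max_def)
      qed (simp add: p_def max_def)
    qed
  qed (intro bsupp_L2_product tf_bsupp z p D L2loc_mult V)+
  ultimately show ?thesis unfolding E_def cross[OF p] by (simp add: p_def power2_eq_square mult.assoc)
qed

lemma pd_scaled_bump:
  "pd i (\<lambda>x::real^'n. c * bump (r *\<^sub>R x)) = (\<lambda>x. c * r * pd i bump (r *\<^sub>R x))"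
  using pd_affine_sm[OF sm_bump, of i 0 r] sm_affine[OF sm_bump, of "0::real^'n" r]
  by (simp add: pd_cmult_sm mult.assoc)

lemma bump_0_pos: "0 < bump (0::real^'n)" by (simp add: bump_def flat_1_pos)

lemma bump_le_0: "bump x \<le> bump (0::real^'n)"
  by (auto simp: bump_def flat_def field_simps)

text \<open>The cutoff term of \<open>localised_energy_nonneg\<close> is at most a constant times
  the quotient in \<open>growth\<close>, so it disappears along \<open>R\<close> and leaves 0 \<le>
  2 b + q, with b linear and q quadratic in the test function. Replacing \<open>\<phi>\<close> by
  its multiples forces b = 0, which is the weak equation.\<close>

lemma positive_part_weak_solution:
  fixes V h D :: "real^'n \<Rightarrow> real"
  assumes V: "Lloc V" and pos: "\<And>f. tf f \<Longrightarrow> 0 \<le> (LINT x|lborel. f x * schr V f x)"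
    and h: "L2loc h" and D: "L2loc D" and w: "weak_lap h D"
    and sub: "AE x in lborel. 0 < h x \<longrightarrow> V x * h x \<le> D x"
    and R: "filterlim R at_top sequentially"
    and growth: "(\<lambda>j. sqn (R j) (\<lambda>x. max (h x) 0) / (R j)\<^sup>2) \<longlonglongrightarrow> 0"
  shows "weak_lap (\<lambda>x. max (h x) 0) (\<lambda>x. V x * max (h x) 0)"
proof -
  define p where "p x = max (h x) 0" for x
  have p: "L2loc p"
    by (rule L2loc_bound[OF h]) (use h in \<open>auto simp: p_def[abs_def] L2loc_def intro!: exI[of _ 1]\<close>)
  obtain C where C: "C \<ge> 0" "\<And>x::real^'n. \<bar>grad2 bump x\<bar> \<le> C" using tf_bounded[OF tf_grad2[OF tf_bump]] by blast
  \<comment> \<open>Dividing by \<open>bump 0\<close>, the maximum of \<open>bump\<close>, gives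
    cutoffs with values in [0, 1] that tend to 1 pointwise as \<open>R j\<close> grows.\<close>
  define \<zeta> where "\<zeta> j x = inverse (bump (0::real^'n)) * bump (inverse (R j) *\<^sub>R (x::real^'n))" for j x
  have tz: "tf (\<zeta> j)" if "R j > 0" for j
    unfolding \<zeta>_def[abs_def]
    using tf_cmult[OF tf_affine[OF tf_bump, of "inverse (R j)" "0::real^'n"], of "inverse (bump (0::real^'n))"] that by simp
  define B where "B = C / (bump (0::real^'n))\<^sup>2"
  have gz: "grad2 (\<zeta> j) x \<le> B / (R j)\<^sup>2 * indicator (cball 0 (R j)) x" if "R j > 0" for j x
  proof (cases "norm x \<le> R j")
    case True
    have "grad2 (\<zeta> j) x = grad2 bump (inverse (R j) *\<^sub>R x) / ((bump (0::real^'n))\<^sup>2 * (R j)\<^sup>2)"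
      unfolding \<zeta>_def[abs_def] grad2_def pd_scaled_bump
      by (simp add: power_mult_distrib power_inverse sum_distrib_left[symmetric] divide_inverse)
    also have "\<dots> \<le> C / ((bump (0::real^'n))\<^sup>2 * (R j)\<^sup>2)"
      using C(2)[of "inverse (R j) *\<^sub>R x"] by (intro divide_right_mono) auto
    finally show ?thesis using True by (simp add: B_def)
  next
    case False
    have "supp_in (R j) (\<zeta> j)"
    proof -
      have "bump (inverse (R j) *\<^sub>R x) = 0" if "R j < norm x" for x :: "real^'n"
      proof -
        have "1 < norm (inverse (R j) *\<^sub>R x)" using that \<open>R j > 0\<close> by (simp add: field_simps)
        then show ?thesis using supp_bump unfolding supp_in_def by blast
      qed
      then show ?thesis by (simp add: supp_in_def \<zeta>_def)
    qed
    then have "supp_in (R j) (pd i (\<zeta> j))" for i by (rule supp_in_pd)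
    then have "pd i (\<zeta> j) x = 0" for i using False by (simp add: supp_in_def)
    then show ?thesis using False by (simp add: grad2_def)
  qed
  have ineq: "0 \<le> 2 * (LINT x|lborel. p x * schr V \<phi> x) + (LINT x|lborel. \<phi> x * schr V \<phi> x)" if \<phi>: "tf \<phi>" for \<phi>
  proof -
    let ?q = "LINT x|lborel. \<phi> x * schr V \<phi> x"
    have Rp: "\<forall>\<^sub>F j in sequentially. R j > 0" using R by (simp add: filterlim_at_top_dense)
    have i: "integrable lborel (\<lambda>x. p x * schr V \<phi> x)" by (rule schr_L2_int[OF \<phi> p V])
    have "\<forall>\<^sub>F j in sequentially. 0 \<le> B * (sqn (R j) p / (R j)\<^sup>2) + 2 * (LINT x|lborel. \<zeta> j x * (p x * schr V \<phi> x)) + ?q"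
      using Rp
    proof eventually_elim
      case (elim j)
      have "0 \<le> (LINT x|lborel. grad2 (\<zeta> j) x * (p x)\<^sup>2) + 2 * (LINT x|lborel. \<zeta> j x * p x * schr V \<phi> x) + ?q"
        unfolding p_def by (rule localised_energy_nonneg[OF V pos h D w sub tz[OF elim] \<phi>])
      moreover have "(LINT x|lborel. grad2 (\<zeta> j) x * (p x)\<^sup>2) \<le> (LINT x|lborel. B / (R j)\<^sup>2 * (indicator (cball 0 (R j)) x * (p x)\<^sup>2))"
      proof (rule integral_mono)
        show "integrable lborel (\<lambda>x. grad2 (\<zeta> j) x * (p x)\<^sup>2)"
          using bsupp_L2_product[OF tf_bsupp[OF tf_grad2[OF tz[OF elim]]] p p] by (simp add: power2_eq_square mult.assoc)
        show "integrable lborel (\<lambda>x. B / (R j)\<^sup>2 * (indicator (cball 0 (R j)) x * (p x)\<^sup>2))"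
          by (intro integrable_mult_right L2loc_int p)
        show "grad2 (\<zeta> j) x * (p x)\<^sup>2 \<le> B / (R j)\<^sup>2 * (indicator (cball 0 (R j)) x * (p x)\<^sup>2)" for x
          using mult_right_mono[OF gz[OF elim, of x], of "(p x)\<^sup>2"] by (simp add: mult.assoc)
      qed
      moreover have "\<dots> = B * (sqn (R j) p / (R j)\<^sup>2)" by (simp add: sqn_def)
      ultimately show ?case unfolding mult.assoc by linarith
    qed
    moreover have "(\<lambda>j. B * (sqn (R j) p / (R j)\<^sup>2) + 2 * (LINT x|lborel. \<zeta> j x * (p x * schr V \<phi> x)) + ?q)
        \<longlonglongrightarrow> B * 0 + 2 * (LINT x|lborel. p x * schr V \<phi> x) + ?q"
    proof (intro tendsto_intros)
      show "(\<lambda>j. sqn (R j) p / (R j)\<^sup>2) \<longlonglongrightarrow> 0" using growth by (simp add: p_def[abs_def])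
      show "(\<lambda>j. LINT x|lborel. \<zeta> j x * (p x * schr V \<phi> x)) \<longlonglongrightarrow> (LINT x|lborel. p x * schr V \<phi> x)"
      proof (rule integral_dominated_convergence[where w="\<lambda>x. \<bar>p x * schr V \<phi> x\<bar>"])
        show "AE x in lborel. (\<lambda>j. \<zeta> j x * (p x * schr V \<phi> x)) \<longlonglongrightarrow> p x * schr V \<phi> x"
        proof (rule AE_I2)
          fix x :: "real^'n"
          have "continuous_on UNIV (bump :: real^'n \<Rightarrow> real)" by (rule sm_continuous[OF sm_bump])
          then have "isCont bump (0::real^'n)" by (simp add: continuous_on_eq_continuous_at)
          moreover have "(\<lambda>j. inverse (R j) *\<^sub>R x) \<longlonglongrightarrow> 0 *\<^sub>R x"
            by (intro tendsto_scaleR tendsto_const filterlim_compose[OF tendsto_inverse_0_at_top[OF filterlim_ident] R])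
          ultimately have "(\<lambda>j. bump (inverse (R j) *\<^sub>R x)) \<longlonglongrightarrow> bump (0::real^'n)"
            using isCont_tendsto_compose by fastforce
          then have "(\<lambda>j. inverse (bump (0::real^'n)) * bump (inverse (R j) *\<^sub>R x) * (p x * schr V \<phi> x))
              \<longlonglongrightarrow> inverse (bump (0::real^'n)) * bump (0::real^'n) * (p x * schr V \<phi> x)"
            by (intro tendsto_intros)
          then show "(\<lambda>j. \<zeta> j x * (p x * schr V \<phi> x)) \<longlonglongrightarrow> p x * schr V \<phi> x"
            using bump_0_pos[where 'n='n] by (simp add: \<zeta>_def)
        qed
        show "AE x in lborel. norm (\<zeta> j x * (p x * schr V \<phi> x)) \<le> \<bar>p x * schr V \<phi> x\<bar>" for j
        proof (rule AE_I2)
          fix x :: "real^'n"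
          have "\<bar>\<zeta> j x\<bar> \<le> 1" using bump_le_0[of "inverse (R j) *\<^sub>R x"] bump_nonneg[of "inverse (R j) *\<^sub>R x"] bump_0_pos[where 'n='n]
            by (simp add: \<zeta>_def field_simps)
          then show "norm (\<zeta> j x * (p x * schr V \<phi> x)) \<le> \<bar>p x * schr V \<phi> x\<bar>"
            using mult_right_mono[of "\<bar>\<zeta> j x\<bar>" 1 "\<bar>p x * schr V \<phi> x\<bar>"] by (simp add: abs_mult)
        qed
        show "(\<lambda>x. \<zeta> j x * (p x * schr V \<phi> x)) \<in> borel_measurable lborel" for j
        proof -
          have "sm (\<zeta> j)" unfolding \<zeta>_def[abs_def] using sm_cmult[OF sm_affine[OF sm_bump, of "0::real^'n" "inverse (R j)"]] by simp
          then show ?thesis using borel_measurable_integrable[OF i] sm_measurable by auto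
        qed
      qed (use i in auto)
    qed
    ultimately have "0 \<le> B * 0 + 2 * (LINT x|lborel. p x * schr V \<phi> x) + ?q"
      by (intro tendsto_lowerbound) auto
    then show ?thesis by simp
  qed
  have zero: "(LINT x|lborel. p x * schr V \<phi> x) = 0" if \<phi>: "tf \<phi>" for \<phi>
  proof (rule ccontr)
    let ?b = "LINT x|lborel. p x * schr V \<phi> x" and ?q = "LINT x|lborel. \<phi> x * schr V \<phi> x"
    assume b: "?b \<noteq> 0"
    have s: "schr V (\<lambda>x. t * \<phi> x) = (\<lambda>x. t * schr V \<phi> x)" for t
      by (auto simp: schr_def lap_cmult_sm tf_sm \<phi> algebra_simps)
    have *: "0 \<le> 2 * (t * ?b) + t\<^sup>2 * ?q" for t
    proof -
      have "(\<lambda>x. p x * (t * schr V \<phi> x)) = (\<lambda>x. t * (p x * schr V \<phi> x))"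
        "(\<lambda>x. t * \<phi> x * (t * schr V \<phi> x)) = (\<lambda>x. t\<^sup>2 * (\<phi> x * schr V \<phi> x))"
        by (auto simp: power2_eq_square)
      then show ?thesis using ineq[OF tf_cmult[OF \<phi>, of t]] unfolding s by simp
    qed
    \<comment> \<open>With t = - r b the quadratic becomes r b^2 (r q - 2), which is negative as
      soon as r > 0 and r q \<le> 1; this \<open>r\<close> works for either sign of q.\<close>
    define r where "r = inverse (\<bar>?q\<bar> + 1)"
    have r: "r > 0" "r * ?q \<le> 1" by (auto simp: r_def field_simps)
    have "0 \<le> 2 * (- (r * ?b) * ?b) + (r * ?b)\<^sup>2 * ?q" using *[of "- (r * ?b)"] by simp
    also have "\<dots> = r * ?b\<^sup>2 * (r * ?q - 2)" by (simp add: power2_eq_square algebra_simps)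
    also have "\<dots> < 0" using r b by (intro mult_pos_neg) auto
    finally show False by simp
  qed
  show ?thesis unfolding weak_lap_def
  proof (intro allI impI)
    fix \<phi> :: "real^'n \<Rightarrow> real" assume \<phi>: "tf \<phi>"
    have "integrable lborel (\<lambda>x. lap \<phi> x * p x)" "integrable lborel (\<lambda>x. \<phi> x * (V x * p x))"
      by (intro tf_L2_int tf_lap \<phi> p L2loc_mult V)+
    then have "(LINT x|lborel. \<phi> x * (V x * p x)) - (LINT x|lborel. lap \<phi> x * p x) = (LINT x|lborel. p x * schr V \<phi> x)"
      by (simp add: Bochner_Integration.integral_diff[symmetric] schr_def algebra_simps del: Bochner_Integration.integral_diff)
    then show "(LINT x|lborel. max (h x) 0 * lap \<phi> x) = (LINT x|lborel. V x * max (h x) 0 * \<phi> x)"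
      using zero[OF \<phi>] by (simp add: p_def mult_ac)
  qed
qed

section \<open>A lower bound for nonnegative solutions\<close>

text \<open>\<open>flat [:0, 0, 1:]\<close> is the derivative of \<open>flat 1\<close>; the factor 2
  comes from differentiating the squared norm, see \<open>pd_bump\<close>.\<close>

definition dbump :: "real^'n \<Rightarrow> real" where "dbump z = 2 * flat [:0, 0, 1:] (1 - (norm z)\<^sup>2)"

lemma sm_dbump: "sm dbump"
  unfolding dbump_def[abs_def] by (intro sm_cmult sm_flat sm_diff sm_const sm_norm_sq)

lemma supp_dbump: "supp_in 1 (dbump :: real^'n \<Rightarrow> real)"
proof -
  have "dbump x = 0" if "1 < norm x" for x :: "real^'n"
    using one_less_power[OF that, of 2] by (simp add: dbump_def flat_def)
  then show ?thesis by (simp add: supp_in_def)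
qed

lemma tf_dbump: "tf dbump" using sm_dbump supp_dbump by (auto simp: tf_def)

lemma pd_bump: "pd i bump = (\<lambda>z::real^'n. - (z $ i * dbump z))"
proof
  fix z :: "real^'n"
  have d: "(flat 1 has_real_derivative flat [:0,0,1:] t) (at t)" for t
    using flat_deriv[of 1 t] by simp
  have s: "sm (\<lambda>z::real^'n. 1 + (-1) * (norm z)\<^sup>2)" by (intro sm_add sm_cmult sm_const sm_norm_sq)
  have "pd i (\<lambda>z::real^'n. 1 + (-1) * (norm z)\<^sup>2) = (\<lambda>z. - (2 * z $ i))"
    by (simp only: pd_add_sm pd_const pd_cmult_sm pd_norm_sq sm_norm_sq sm_const sm_cmult) simp
  with pd_compose(1)[OF sm_differentiable[OF s] d, of i z]
  show "pd i bump z = - (z $ i * dbump z)" by (simp add: bump_def[abs_def] dbump_def)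
qed

text \<open>For t = 1 - |z|^2 in (0, 1] the weights are exp(-1/t) and 2 exp(-1/t) / t^2, and 1/t^2
  \<ge> 1. This is what bounds a term weighted by \<open>bump\<close> by the mean weighted by
  \<open>dbump\<close>.\<close>

lemma bump_le_dbump: "2 * bump z \<le> dbump z"
proof (cases "0 < 1 - (norm z)\<^sup>2")
  case True
  let ?t = "1 - (norm z)\<^sup>2"
  have "?t * ?t \<le> 1 * 1" using True by (intro mult_mono) auto
  then have "1 \<le> 1 / ?t * (1 / ?t)" using True by (simp add: le_divide_eq)
  from mult_right_mono[OF this, of "exp (- (1 / ?t))"] True show ?thesis
    by (simp add: bump_def dbump_def flat_def)
qed (simp add: bump_def dbump_def flat_def)

lemma dbump_nonneg: "0 \<le> dbump z"
  using bump_le_dbump[of z] bump_nonneg[of z] by linarith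

text \<open>Transfers the means to a fixed box, where the Leibniz rule for parameter integrals
  applies; the box contains the unit ball.\<close>

lemma integral_lborel_cbox:
  fixes g :: "real^'n \<Rightarrow> real"
  assumes g: "integrable lborel g" and s: "supp_in 1 g"
  shows "(LINT z|lborel. g z) = integral (cbox (- 1) 1) g"
proof -
  have "g = (\<lambda>z. if z \<in> cbox (- 1) 1 then g z else 0)"
  proof
    fix z :: "real^'n"
    have "z \<in> cbox (- 1) 1" if "norm z \<le> 1"
    proof -
      have "\<bar>z $ i\<bar> \<le> 1" for i using component_le_norm_cart[of z i] that by linarith
      then show ?thesis by (auto simp: mem_box_cart abs_le_iff minus_le_iff)
    qed
    with s show "g z = (if z \<in> cbox (- 1) 1 then g z else 0)"
      unfolding supp_in_def by (metis not_le)
  qed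
  then have "integral UNIV g = integral (cbox (- 1) 1) g"
    by (metis integral_restrict_UNIV)
  with integral_lborel[OF g] show ?thesis by simp
qed

definition bmean :: "(real^'n \<Rightarrow> real) \<Rightarrow> real^'n \<Rightarrow> real \<Rightarrow> real" where
  "bmean f x t = (LINT z|lborel. f (x + t *\<^sub>R z) * dbump z)"

text \<open>Differentiating in the radius produces the inner product of z and grad f with weight
  \<open>dbump\<close>. As - z \<open>dbump\<close> is the gradient of \<open>bump\<close>, one
  integration by parts turns this into the Laplacian with weight \<open>bump\<close>, and the inner
  derivative supplies the factor \<open>t\<close>.\<close>

lemma bmean_deriv:
  fixes f :: "real^'n \<Rightarrow> real"
  assumes f: "sm f"
  shows "(bmean f x has_real_derivative t * (LINT z|lborel. lap f (x + t *\<^sub>R z) * bump z)) (at t)"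
proof -
  let ?B = "cbox (- 1) (1::real^'n)"
  let ?d = "\<lambda>s z. (\<Sum>i\<in>UNIV. z $ i * pd i f (x + s *\<^sub>R z)) * dbump z"
  have c: "continuous_on UNIV f" "continuous_on UNIV (pd i f)" "continuous_on UNIV (dbump::real^'n \<Rightarrow> real)" for i
    by (intro sm_continuous sm_pd sm_dbump f)+
  have i1: "tf (\<lambda>z. f (x + s *\<^sub>R z) * dbump z)" for s by (intro tf_mult tf_dbump sm_affine f)
  have i2: "tf (\<lambda>z. ?d s z)" for s by (intro tf_mult tf_dbump sm_sum sm_mult sm_coord sm_affine sm_pd f)
  have sp: "supp_in 1 (\<lambda>z. g z * dbump z)" for g :: "real^'n \<Rightarrow> real" using supp_dbump[where 'n='n] by (simp add: supp_in_def)
  have eq: "bmean f x s = integral ?B (\<lambda>z. f (x + s *\<^sub>R z) * dbump z)" for s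
    unfolding bmean_def by (rule integral_lborel_cbox[OF tf_integrable[OF i1] sp])
  have "((\<lambda>s. integral ?B (\<lambda>z. f (x + s *\<^sub>R z) * dbump z)) has_real_derivative integral ?B (?d t)) (at t within UNIV)"
  proof (rule leibniz_rule_field_derivative[where U=UNIV])
    show "((\<lambda>s. f (x + s *\<^sub>R z) * dbump z) has_real_derivative ?d s z) (at s within UNIV)" for s z
      by (rule DERIV_cmult_right[OF sm_along_line[OF f]])
    show "(\<lambda>z. f (x + s *\<^sub>R z) * dbump z) integrable_on ?B" for s
      by (intro integrable_continuous continuous_on_subset[OF sm_continuous[OF tf_sm[OF i1]]]) auto
    show "continuous_on (UNIV \<times> ?B) (\<lambda>(s, z). ?d s z)"
      unfolding split_def
      by (intro continuous_intros continuous_on_compose2[OF c(2)] continuous_on_compose2[OF c(3)]) auto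
  qed auto
  moreover have "integral ?B (?d t) = (LINT z|lborel. ?d t z)"
    by (rule integral_lborel_cbox[symmetric, OF tf_integrable[OF i2] sp])
  ultimately have D: "(bmean f x has_real_derivative (LINT z|lborel. ?d t z)) (at t)"
    unfolding eq[abs_def] by simp
  let ?w = "\<lambda>i z. pd i f (x + t *\<^sub>R z) * bump z"
  have w: "tf (?w i)" for i by (intro tf_mult tf_bump sm_affine sm_pd f)
  have pw: "pd i (?w i) z = t * (pd i (pd i f) (x + t *\<^sub>R z) * bump z) - z $ i * pd i f (x + t *\<^sub>R z) * dbump z" for i z
    by (simp add: pd_mult_sm sm_affine sm_pd f sm_bump pd_affine_sm pd_bump algebra_simps)
  have "?d t z = t * (lap f (x + t *\<^sub>R z) * bump z) - (\<Sum>i\<in>UNIV. pd i (?w i) z)" for z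
    unfolding pw by (simp add: lap_def sum_subtractf sum_distrib_left sum_distrib_right)
  moreover have "integrable lborel (\<lambda>z. t * (lap f (x + t *\<^sub>R z) * bump z))"
    by (intro integrable_mult_right tf_integrable tf_mult tf_bump sm_affine sm_lap f)
  ultimately have "(LINT z|lborel. ?d t z) = t * (LINT z|lborel. lap f (x + t *\<^sub>R z) * bump z)"
    using integral_div_zero[of ?w, OF w] by simp
  with D show ?thesis by simp
qed

text \<open>Since \<open>\<nabla>bump = - z dbump\<close>, the weighted mean \<open>m t = bmean f x t\<close> satisfies
  \<open>m' \<le> (C t / 2) m\<close>.\<close>

lemma smooth_supersolution_lower_bound:
  fixes f :: "real^'n \<Rightarrow> real"
  assumes f: "sm f" and nn: "\<And>y. 0 \<le> f y" and C: "0 \<le> C" and R: "0 < R"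
    and sup: "\<And>y. norm y \<le> 5 * R \<Longrightarrow> lap f y \<le> C * f y" and x: "norm x \<le> R"
  shows "2 * exp (-2) * (LINT y|lborel. indicator (cball 0 R) y * f y)
    \<le> (4 * R) ^ CARD('n) * exp (C * (4 * R)\<^sup>2 / 4) * (LINT z|lborel. dbump (z::real^'n)) * f x"
proof -
  define m where "m = bmean f x"
  \<comment> \<open>If |x| \<le> R and \<open>x + r *\<^sub>R z\<close> lies in the ball of radius
    R, then |z| \<le> 2 R / r = 1/2, where \<open>bump\<close> is at least exp(-2). On the other
    hand, |z| \<le> 1 keeps all points within radius 5 R, where \<open>sup\<close> is
    available.\<close>
  define r where "r = 4 * R"
  have r: "0 < r" using R by (simp add: r_def)
  have i1: "tf (\<lambda>z. f (x + s *\<^sub>R z) * dbump z)" for s by (intro tf_mult tf_dbump sm_affine f)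
  have dm: "t * (LINT z|lborel. lap f (x + t *\<^sub>R z) * bump z) \<le> C * t / 2 * m t" if t: "0 \<le> t" "t \<le> r" for t
  proof -
    have "(LINT z|lborel. lap f (x + t *\<^sub>R z) * bump z) \<le> (LINT z|lborel. C / 2 * (f (x + t *\<^sub>R z) * dbump z))"
    proof (rule integral_mono)
      fix z :: "real^'n"
      show "lap f (x + t *\<^sub>R z) * bump z \<le> C / 2 * (f (x + t *\<^sub>R z) * dbump z)"
      proof (cases "norm z \<le> 1")
        case True
        have "norm (x + t *\<^sub>R z) \<le> norm x + t * norm z" using norm_triangle_ineq[of x "t *\<^sub>R z"] t by simp
        also have "\<dots> \<le> R + 4 * R * 1" using x True t R by (intro add_mono mult_mono) (auto simp: r_def)
        finally have "lap f (x + t *\<^sub>R z) \<le> C * f (x + t *\<^sub>R z)" by (intro sup) simp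
        then have "lap f (x + t *\<^sub>R z) * bump z \<le> C * f (x + t *\<^sub>R z) * bump z"
          by (rule mult_right_mono[OF _ bump_nonneg])
        also have "\<dots> \<le> C * f (x + t *\<^sub>R z) * (dbump z / 2)"
          using bump_le_dbump[of z] by (intro mult_left_mono mult_nonneg_nonneg C nn) simp
        finally show ?thesis by simp
      next
        case False
        then have "bump z = 0" using supp_bump unfolding supp_in_def by (metis not_le)
        then show ?thesis using mult_nonneg_nonneg[OF C mult_nonneg_nonneg[OF nn dbump_nonneg]] by simp
      qed
    qed (intro integrable_mult_right tf_integrable i1 tf_mult tf_bump sm_affine sm_lap f)+
    also have "\<dots> = C / 2 * m t" by (simp add: m_def bmean_def)
    finally have "(LINT z|lborel. lap f (x + t *\<^sub>R z) * bump z) \<le> C / 2 * m t" .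
    from mult_left_mono[OF this t(1)] show ?thesis by (simp add: mult_ac)
  qed
  \<comment> \<open>Gronwall's argument: the exponential is the integrating factor for m' \<le> (C t
    / 2) m.\<close>
  define N where "N t = m t * exp (- (C * t\<^sup>2 / 4))" for t
  have "N r \<le> N 0"
  proof (rule DERIV_nonpos_imp_nonincreasing[of 0 r])
    fix t assume t: "0 \<le> t" "t \<le> r"
    let ?l = "t * (LINT z|lborel. lap f (x + t *\<^sub>R z) * bump z)"
    have e: "((\<lambda>t. exp (- (C * t\<^sup>2 / 4))) has_real_derivative exp (- (C * t\<^sup>2 / 4)) * - (C * t / 2)) (at t)"
      by (auto intro!: derivative_eq_intros)
    have "(N has_real_derivative ?l * exp (- (C * t\<^sup>2 / 4)) + exp (- (C * t\<^sup>2 / 4)) * - (C * t / 2) * m t) (at t)"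
      unfolding N_def[abs_def] by (rule DERIV_mult[OF _ e]) (simp add: m_def bmean_deriv[OF f])
    moreover have "?l * exp (- (C * t\<^sup>2 / 4)) + exp (- (C * t\<^sup>2 / 4)) * - (C * t / 2) * m t \<le> 0"
      using mult_right_mono[OF dm[OF t], of "exp (- (C * t\<^sup>2 / 4))"] by (simp add: mult_ac)
    ultimately show "\<exists>y. (N has_real_derivative y) (at t) \<and> y \<le> 0" by blast
  qed (use r in simp)
  then have "m r * exp (- (C * r\<^sup>2 / 4)) \<le> m 0" by (simp add: N_def)
  then have mr: "m r \<le> exp (C * r\<^sup>2 / 4) * m 0" by (simp add: exp_minus field_simps)
  have m0: "m 0 = (LINT z|lborel. dbump (z::real^'n)) * f x" by (simp add: m_def bmean_def)
  let ?I = "\<lambda>y. indicator (cball 0 R) y * f y"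
  have Ii: "integrable lborel ?I" by (intro bsupp_L2_int bsupp_indicator L2loc_sm f)
  have Im: "?I \<in> borel_measurable borel" using borel_measurable_integrable[OF Ii] by simp
  have sub: "(LINT y|lborel. ?I y) = r ^ CARD('n) * (LINT z|lborel. ?I (x + r *\<^sub>R z))"
    using lborel_integral_affine[OF Im, of r x] r by simp
  have pt: "2 * exp (-2) * ?I (x + r *\<^sub>R z) \<le> f (x + r *\<^sub>R z) * dbump z" for z :: "real^'n"
  proof (cases "norm (x + r *\<^sub>R z) \<le> R")
    case True
    have "norm (r *\<^sub>R z) \<le> norm (x + r *\<^sub>R z) + norm x" using norm_triangle_ineq4[of "x + r *\<^sub>R z" x] by simp
    then have "r * norm z \<le> norm (x + r *\<^sub>R z) + norm x" using r by simp
    then have "4 * R * norm z \<le> 2 * R" using True x unfolding r_def by linarith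
    then have "norm z \<le> 1/2" using R by (simp add: field_simps)
    then have "2 * exp (-2) \<le> dbump z" using bump_ge[of z] bump_le_dbump[of z] by linarith
    from mult_left_mono[OF this nn[of "x + r *\<^sub>R z"]] True show ?thesis by (simp add: mult.commute)
  qed (simp add: nn dbump_nonneg)
  have "2 * exp (-2) * (LINT z|lborel. ?I (x + r *\<^sub>R z)) = (LINT z|lborel. 2 * exp (-2) * ?I (x + r *\<^sub>R z))"
    by simp
  also have "\<dots> \<le> m r" unfolding m_def bmean_def
  proof (rule integral_mono[OF _ tf_integrable[OF i1] pt])
    show "integrable lborel (\<lambda>z. 2 * exp (-2) * ?I (x + r *\<^sub>R z))"
    proof (rule Bochner_Integration.integrable_bound[OF tf_integrable[OF i1[of r]]])
      have "(\<lambda>z. ?I (x + r *\<^sub>R z)) \<in> borel_measurable borel"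
        by (rule measurable_compose[OF _ Im]) simp
      then show "(\<lambda>z. 2 * exp (-2) * ?I (x + r *\<^sub>R z)) \<in> borel_measurable lborel" by simp
      have abs_I: "\<bar>2 * exp (-2) * ?I y\<bar> = 2 * exp (-2) * ?I y" for y using nn[of y] by simp
      then show "AE z in lborel. norm (2 * exp (-2) * ?I (x + r *\<^sub>R z)) \<le> norm (f (x + r *\<^sub>R z) * dbump z)"
        unfolding real_norm_def abs_I by (intro AE_I2 order_trans[OF pt abs_ge_self])
    qed
  qed
  finally have "2 * exp (-2) * (LINT z|lborel. ?I (x + r *\<^sub>R z)) \<le> exp (C * r\<^sup>2 / 4) * ((LINT z|lborel. dbump (z::real^'n)) * f x)"
    using mr m0 by simp
  from mult_left_mono[OF this, of "r ^ CARD('n)"] show ?thesis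
    unfolding sub using r by (simp add: r_def mult_ac)
qed

text \<open>Where \<open>X n\<close> is nonnegative, the negative part of \<open>f\<close> is at
  most the modulus of \<open>X n\<close> - f. Hence its squared L2 norm on the ball is below every
  term of a sequence tending to 0.\<close>

lemma L2conv_nonneg_limit:
  fixes f :: "real^'n \<Rightarrow> real"
  assumes X: "L2conv X f" and nn: "\<And>n x. norm x \<le> R \<Longrightarrow> 0 \<le> X n x"
  shows "AE x in lborel. norm x \<le> R \<longrightarrow> 0 \<le> f x"
proof -
  have L: "L2loc f" "L2loc (X n)" for n using X by (auto simp: L2conv_def)
  define g where "g x = min (f x) 0" for x
  have g: "L2loc g"
    by (rule L2loc_bound[OF L(1)]) (use L in \<open>auto simp: g_def[abs_def] L2loc_def intro!: exI[of _ 1]\<close>)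
  have "sqn R g \<le> sqn R (\<lambda>x. X n x - f x)" for n
    unfolding sqn_def
  proof (intro integral_mono L2loc_int g L2loc_diff L)
    fix x
    show "indicator (cball 0 R) x * (g x)\<^sup>2 \<le> indicator (cball 0 R) x * (X n x - f x)\<^sup>2"
    proof (cases "norm x \<le> R")
      case True
      then have "\<bar>g x\<bar> \<le> \<bar>X n x - f x\<bar>" using nn[of x n] by (auto simp: g_def min_def)
      then show ?thesis by (simp add: abs_le_square_iff mult_left_mono)
    qed simp
  qed
  moreover have "(\<lambda>n. sqn R (\<lambda>x. X n x - f x)) \<longlonglongrightarrow> 0" using X by (simp add: L2conv_def)
  ultimately have "sqn R g \<le> 0" by (intro LIMSEQ_le_const) auto
  then have "sqn R g = 0" using sqn_nonneg[of R g] by simp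
  then have "AE x in lborel. indicator (cball 0 R) x * (g x)\<^sup>2 = 0"
    unfolding sqn_def by (subst (asm) integral_nonneg_eq_0_iff_AE[OF L2loc_int[OF g]]) (auto simp: indicator_def)
  then show ?thesis
    by eventually_elim (auto simp: g_def indicator_def min_def split: if_splits)
qed

text \<open>Serves two ends: a nonzero solution is bounded below on balls, and a solution vanishing
  on a ball vanishes on larger ones. The bound is first shown for mollifications: the kernel is
  nonnegative, so V p \<le> C p survives it, and \<open>c\<close> is the same for all of
  them.\<close>

lemma weak_supersolution_lower_bound:
  fixes p V :: "real^'n \<Rightarrow> real"
  assumes V: "Lloc V" and p: "L2loc p" and nn: "\<And>x. 0 \<le> p x"
    and w: "weak_lap p (\<lambda>x. V x * p x)" and R: "0 < R"
  shows "\<exists>c>0. AE x in lborel. norm x \<le> R \<longrightarrow> c * (LINT y|lborel. indicator (cball 0 R) y * p y) \<le> p x"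
proof -
  \<comment> \<open>5 R is the radius up to which the smooth estimate uses the differential
    inequality, and 1 is the reach of the kernel.\<close>
  obtain C where C: "C \<ge> 0" "AE x in lborel. norm x \<le> 5 * R + 1 \<longrightarrow> \<bar>V x\<bar> \<le> C"
    using V unfolding Lloc_def by blast
  let ?K = "(4 * R) ^ CARD('n) * exp (C * (4 * R)\<^sup>2 / 4) * (LINT z|lborel. dbump (z::real^'n))"
  have K: "0 < ?K"
  proof -
    have "(LINT z|lborel. 2 * bump (z::real^'n)) \<le> (LINT z|lborel. dbump (z::real^'n))"
      by (intro integral_mono integrable_mult_right tf_integrable tf_bump tf_dbump bump_le_dbump)
    then have "0 < (LINT z|lborel. dbump (z::real^'n))" using integral_bump_pos[where 'n='n] by simp
    then show ?thesis using R by simp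
  qed
  define c where "c = 2 * exp (-2) / ?K"
  have c: "c > 0" using K by (simp add: c_def)
  define P where "P n = conv p (rho n)" for n
  have sP: "sm (P n)" for n unfolding P_def by (intro sm_conv p tf_rho)
  have Pnn: "0 \<le> P n x" for n x
    unfolding P_def conv_def by (intro integral_nonneg_AE AE_I2 mult_nonneg_nonneg nn rho_nonneg)
  have lapP: "lap (P n) y \<le> C * P n y" if y: "norm y \<le> 5 * R" for n y
  proof -
    have "lap (P n) y = conv (\<lambda>x. V x * p x) (rho n) y"
      unfolding P_def lap_conv_weak[OF p tf_rho w] ..
    also have "\<dots> \<le> conv (\<lambda>x. C * p x) (rho n) y"
    proof (rule conv_mono_AE)
      show "AE x in lborel. rho n (y - x) \<noteq> 0 \<longrightarrow> V x * p x \<le> C * p x"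
        using C(2)
      proof eventually_elim
        case (elim x)
        show ?case
        proof
          assume "rho n (y - x) \<noteq> 0"
          then have "norm (y - x) \<le> 1 / real (Suc n)" using supp_rho unfolding supp_in_def by (metis not_le)
          moreover have "1 / real (Suc n) \<le> 1" by simp
          moreover have "norm x \<le> norm y + norm (y - x)" using norm_triangle_ineq4[of y "y - x"] by simp
          ultimately have "norm x \<le> 5 * R + 1" using y by linarith
          with elim have "V x \<le> C" by auto
          then show "V x * p x \<le> C * p x" by (rule mult_right_mono[OF _ nn])
        qed
      qed
    qed (intro L2loc_mult V p L2loc_cmult tf_rho rho_nonneg)+
    also have "\<dots> = C * P n y" by (simp add: P_def conv_def mult.assoc)
    finally show ?thesis .
  qed
  let ?I = "\<lambda>f. LINT y|lborel. indicator (cball 0 R) y * f y"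
  have low: "c * ?I (P n) \<le> P n x" if "norm x \<le> R" for n x
    using smooth_supersolution_lower_bound[OF sP[of n] Pnn C(1) R lapP that] K
    by (simp add: c_def divide_le_eq mult.commute)
  have Pc: "L2conv P p" unfolding P_def[abs_def] by (rule conv_rho_L2conv[OF p])
  have Ic: "(\<lambda>n. ?I (P n)) \<longlonglongrightarrow> ?I p" by (rule L2conv_integral1[OF bsupp_indicator Pc])
  \<comment> \<open>The integrals of the mollifications converge as well, so the lower bound becomes
    nonnegativity of one convergent sequence.\<close>
  have "L2conv (\<lambda>n x. P n x - c * ?I (P n)) (\<lambda>x. p x - c * ?I p)"
  proof (rule L2conv_dominated[OF _ _ Pc])
    show "L2loc (\<lambda>x. P n x - c * ?I (P n))" "L2loc (\<lambda>x. p x - c * ?I p)" for n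
      by (intro L2loc_diff L2loc_const p L2loc_sm sP)+
    have "(\<lambda>n. c * \<bar>?I (P n) - ?I p\<bar>) \<longlonglongrightarrow> c * \<bar>?I p - ?I p\<bar>" by (intro tendsto_intros Ic)
    then show "(\<lambda>n. c * \<bar>?I (P n) - ?I p\<bar>) \<longlonglongrightarrow> 0" by simp
    have "\<bar>P n x - c * ?I (P n) - (p x - c * ?I p)\<bar> \<le> 1 * \<bar>P n x - p x\<bar> + c * \<bar>?I (P n) - ?I p\<bar>" for n x
    proof -
      have "P n x - c * ?I (P n) - (p x - c * ?I p) = (P n x - p x) - c * (?I (P n) - ?I p)"
        by (simp add: algebra_simps)
      also have "\<bar>\<dots>\<bar> \<le> \<bar>P n x - p x\<bar> + \<bar>c * (?I (P n) - ?I p)\<bar>" by (rule abs_triangle_ineq4)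
      finally show ?thesis using c by (simp add: abs_mult)
    qed
    then show "\<exists>C. \<forall>n. AE x in lborel. norm x \<le> S \<longrightarrow> \<bar>P n x - c * ?I (P n) - (p x - c * ?I p)\<bar>
        \<le> C * \<bar>P n x - p x\<bar> + c * \<bar>?I (P n) - ?I p\<bar>" for S by blast
  qed
  from L2conv_nonneg_limit[OF this, of R] low
  have "AE x in lborel. norm x \<le> R \<longrightarrow> 0 \<le> p x - c * ?I p" by simp
  with c show ?thesis by (intro exI[of _ c]) auto
qed

section \<open>The critical radial function\<close>

text \<open>\<open>qcut\<close> is smooth, at least 3, and the identity on \<open>[4, \<infinity>)\<close>; so \<open>subsol\<close> is smooth and equals
  \<open>|x| powr (-d/2) * (2 ln |x|) powr (-1/2)\<close> for \<open>|x| \<ge> 2\<close>.\<close>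

definition qcut :: "real \<Rightarrow> real" where
  "qcut s = 3 + flat 1 (s - 3) / (flat 1 (s - 3) + flat 1 (4 - s)) * (s - 3)"

definition subsol :: "real^'n \<Rightarrow> real" where
  "subsol x = qcut ((norm x)\<^sup>2) powr (- (real CARD('n) / 4)) * ln (qcut ((norm x)\<^sup>2)) powr (- (1/2))"

lemma flat_denom_pos: "0 < flat 1 (s - 3) + flat 1 (4 - s)"
proof (cases "3 < s")
  case True
  then show ?thesis using flat_1_pos[of "s - 3"] flat_1_nonneg[of "4 - s"] by linarith
next
  case False
  then show ?thesis using flat_1_pos[of "4 - s"] flat_1_nonneg[of "s - 3"] by linarith
qed

lemma qcut_ge: "3 \<le> qcut s"
proof (cases "s \<le> 3")
  case True
  then show ?thesis by (simp add: qcut_def flat_def)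
next
  case False
  then show ?thesis unfolding qcut_def
    using flat_1_nonneg[of "s - 3"] flat_denom_pos[of s] by (auto intro!: mult_nonneg_nonneg divide_nonneg_pos)
qed

lemma qcut_eq: "4 \<le> s \<Longrightarrow> qcut s = s"
  using flat_denom_pos[of s] by (simp add: qcut_def flat_def)

text \<open>The floor 3 of \<open>qcut\<close> lies above e; this keeps the logarithm away from 0,
  where its negative power is singular.\<close>

lemma ln_qcut_ge: "1 \<le> ln (qcut s)"
  using qcut_ge[of s] exp_le by (subst ln_ge_iff) auto

lemma sm_subsol: "sm (subsol :: real^'n \<Rightarrow> real)"
proof -
  have N: "sm (\<lambda>x::real^'n. (norm x)\<^sup>2)" by (rule sm_norm_sq)
  have q: "sm (\<lambda>x::real^'n. qcut ((norm x)\<^sup>2))"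
    unfolding qcut_def by (intro sm_add sm_const sm_mult sm_divide sm_flat sm_diff N flat_denom_pos)
  have q0: "0 < qcut s" for s using qcut_ge[of s] by simp
  have l0: "0 < ln (qcut s)" for s using ln_qcut_ge[of s] by linarith
  show ?thesis unfolding subsol_def[abs_def]
    by (intro sm_mult sm_powr sm_ln q q0 l0)
qed

lemma subsol_pos: "0 < subsol x"
proof -
  have "0 < qcut s" "0 < ln (qcut s)" for s using qcut_ge[of s] ln_qcut_ge[of s] by linarith+
  then show ?thesis unfolding subsol_def by (metis mult_pos_pos order_less_irrefl powr_gt_zero)
qed

section \<open>The Laplacian of the radial function\<close>

lemma pd_cong_open:
  assumes "g differentiable (at x)" "open S" "x \<in> S" "\<And>y. y \<in> S \<Longrightarrow> f y = g y"
  shows "pd i f x = pd i g x"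
proof -
  have "(f has_derivative (\<lambda>v. \<Sum>i\<in>UNIV. v $ i * pd i g x)) (at x)"
    by (rule has_derivative_transform_within_open[OF has_derivative_pd[OF assms(1)] assms(2,3)]) (simp add: assms(4))
  from pd_eq[OF this] show ?thesis by (simp add: sum_axis_mult)
qed

text \<open>Profile of the radial function in the variable s = |x|^2, with a = d/4. In this variable
  the chain rule meets only a polynomial of x, with gradient 2 x.\<close>

definition U0 :: "real \<Rightarrow> real \<Rightarrow> real" where "U0 a s = s powr (- a) * ln s powr (- (1/2))"
definition U1 :: "real \<Rightarrow> real \<Rightarrow> real" where "U1 a s = - (a / s + 1 / (2 * s * ln s)) * U0 a s"

lemma U0_deriv:
  assumes s: "1 < s" shows "(U0 a has_real_derivative U1 a s) (at s)"
proof -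
  have L: "0 < ln s" using s by simp
  have d1: "((\<lambda>s. s powr (- a)) has_real_derivative (- a) * s powr (- a - 1)) (at s)"
    by (rule has_real_derivative_powr) (use s in simp)
  have d2: "((\<lambda>s. ln s powr (- (1/2))) has_real_derivative (- (1/2)) * ln s powr (- (1/2) - 1) * inverse s) (at s)"
    by (rule DERIV_chain2[OF has_real_derivative_powr[OF L] DERIV_ln]) (use s in simp)
  have e1: "s powr (- a - 1) = s powr (- a) / s" using s by (simp add: powr_diff)
  have e2: "ln s powr (- (1/2) - 1) = ln s powr (- (1/2)) / ln s" using L by (simp only: powr_diff powr_one)
  have "(U0 a has_real_derivative (- a) * s powr (- a - 1) * ln s powr (- (1/2))
      + (- (1/2)) * ln s powr (- (1/2) - 1) * inverse s * s powr (- a)) (at s)"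
    unfolding U0_def[abs_def] by (rule DERIV_mult[OF d1 d2])
  moreover have "(- a) * s powr (- a - 1) * ln s powr (- (1/2))
      + (- (1/2)) * ln s powr (- (1/2) - 1) * inverse s * s powr (- a) = U1 a s"
  proof -
    have *: "(- a) * (P / s) * Q + (- (1/2)) * (Q / l) * inverse s * P = - (a / s + 1 / (2 * s * l)) * (P * Q)"
      if "l \<noteq> 0" for P Q l :: real
      using s that by (simp add: field_simps)
    show ?thesis unfolding e1 e2 U1_def U0_def by (rule *) (use L in simp)
  qed
  ultimately show ?thesis by simp
qed

lemma U1_deriv:
  assumes s: "1 < s"
  shows "(U1 a has_real_derivative ((a / s + 1 / (2 * s * ln s))\<^sup>2 + a / s\<^sup>2 + 1 / (2 * s\<^sup>2 * ln s) + 1 / (2 * s\<^sup>2 * (ln s)\<^sup>2)) * U0 a s) (at s)"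
proof -
  have L: "0 < ln s" using s by simp
  let ?w = "a / s + 1 / (2 * s * ln s)"
  have "((\<lambda>s. - (a / s + 1 / (2 * s * ln s))) has_real_derivative
     a / s\<^sup>2 + 1 / (2 * s\<^sup>2 * ln s) + 1 / (2 * s\<^sup>2 * (ln s)\<^sup>2)) (at s)"
    using s L by (auto intro!: derivative_eq_intros simp: field_simps power2_eq_square)
  from DERIV_mult[OF this U0_deriv[OF s, of a]]
  have "(U1 a has_real_derivative (a / s\<^sup>2 + 1 / (2 * s\<^sup>2 * ln s) + 1 / (2 * s\<^sup>2 * (ln s)\<^sup>2)) * U0 a s + U1 a s * - ?w) (at s)"
    unfolding U1_def[abs_def] .
  moreover have "U1 a s * - ?w = ?w\<^sup>2 * U0 a s"
  proof -
    have "- W * u * - W = W\<^sup>2 * u" for W u :: real by (simp add: power2_eq_square)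
    then show ?thesis unfolding U1_def .
  qed
  ultimately show ?thesis by (simp add: distrib_right add_ac)
qed

text \<open>For a function U of s = |x|^2 the Laplacian is 4 s U'' + 2 d U'. The choice a = d/4
  turns the coefficient 4 a + 2 - d of 1/(s ln s) into 2 and yields d (4 - d) / 4 at 1/s; the terms
  with (ln s)^2 add up to 1 + 2 = 3. Inserting ln s = 2 ln |x| produces the constants 1 and
  3/4.\<close>

lemma lap_subsol:
  fixes x :: "real^'n"
  assumes x: "2 < norm x"
  shows "lap subsol x = (real CARD('n) * (4 - real CARD('n)) / (4 * (norm x)\<^sup>2)
                 + 1 / ((norm x)\<^sup>2 * ln (norm x)) + 3 / (4 * (norm x)\<^sup>2 * (ln (norm x))\<^sup>2)) * subsol x"
proof -
  define d where "d = real CARD('n)"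
  define a where "a = d / 4"
  let ?S = "{y::real^'n. 2 < norm y}"
  have oS: "open ?S" by (intro open_Collect_less continuous_intros)
  have sq: "4 < (norm y)\<^sup>2" if "y \<in> ?S" for y :: "real^'n"
    using that power_strict_mono[of 2 "norm y" 2] by simp
  have eq: "subsol y = U0 a ((norm y)\<^sup>2)" if "y \<in> ?S" for y :: "real^'n"
    using sq[OF that] by (simp add: subsol_def U0_def qcut_eq a_def d_def)
  have dN: "(\<lambda>y::real^'n. (norm y)\<^sup>2) differentiable (at y)" for y by (intro sm_differentiable sm_norm_sq)
  have p1: "pd i subsol y = U1 a ((norm y)\<^sup>2) * (2 * y $ i)" if "y \<in> ?S" for y :: "real^'n" and i
  proof -
    have D: "(U0 a has_real_derivative U1 a ((norm y)\<^sup>2)) (at ((norm y)\<^sup>2))"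
      by (rule U0_deriv) (use sq[OF that] in simp)
    have "pd i subsol y = pd i (\<lambda>y. U0 a ((norm y)\<^sup>2)) y"
      by (rule pd_cong_open[OF pd_compose(2)[OF dN D] oS that eq])
    also have "\<dots> = U1 a ((norm y)\<^sup>2) * (2 * y $ i)"
      unfolding pd_compose(1)[OF dN D] by (simp add: pd_norm_sq)
    finally show ?thesis .
  qed
  let ?s = "(norm x)\<^sup>2"
  define s where "s = ?s"
  define L where "L = ln s"
  have xS: "x \<in> ?S" using x by simp
  have s4: "4 < s" using sq[OF xS] by (simp add: s_def)
  have L0: "0 < L" using s4 by (simp add: L_def)
  define w where "w = (a / s + 1 / (2 * s * L))\<^sup>2 + a / s\<^sup>2 + 1 / (2 * s\<^sup>2 * L) + 1 / (2 * s\<^sup>2 * L\<^sup>2)"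
  have D1: "(U1 a has_real_derivative w * U0 a s) (at ?s)"
    using U1_deriv[of s a] s4 by (simp add: w_def L_def s_def)
  have p2: "pd i (pd i subsol) x = w * U0 a s * 4 * (x $ i)\<^sup>2 + 2 * U1 a s" for i
  proof -
    have dc: "(\<lambda>y. 2 * y $ i) differentiable (at x)" by (intro sm_differentiable sm_cmult sm_coord)
    have pdc: "pd i (\<lambda>y::real^'n. 2 * y $ i) x = 2" by (simp add: pd_cmult_sm sm_coord pd_coord)
    have dU: "(\<lambda>y. U1 a ((norm y)\<^sup>2)) differentiable (at x)" by (rule pd_compose(2)[OF dN D1])
    have "pd i (pd i subsol) x = pd i (\<lambda>y. U1 a ((norm y)\<^sup>2) * (2 * y $ i)) x"
      by (rule pd_cong_open[OF differentiable_mult[OF dU dc] oS xS p1])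
    also have "\<dots> = U1 a s * 2 + w * U0 a s * (2 * x $ i) * (2 * x $ i)"
      unfolding pd_mult[OF dU dc] pdc pd_compose(1)[OF dN D1] by (simp add: pd_norm_sq s_def)
    finally show ?thesis by (simp add: power2_eq_square)
  qed
  have "lap subsol x = w * U0 a s * 4 * s + d * (2 * U1 a s)"
    unfolding lap_def p2 sum.distrib by (simp add: sum_distrib_left[symmetric] norm_sq_eq[symmetric] s_def d_def)
  also have "\<dots> = (4 * s * w - 2 * d * (a / s + 1 / (2 * s * L))) * U0 a s"
    by (simp add: U1_def L_def algebra_simps)
  also have "4 * s * w - 2 * d * (a / s + 1 / (2 * s * L)) = d * (4 - d) / (4 * s) + 2 / (s * L) + 3 / (s * L\<^sup>2)"
    unfolding w_def a_def using s4 L0 by (simp add: field_simps power2_eq_square)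
  also have "U0 a s = subsol x" using eq[OF xS] by (simp add: s_def)
  also have "L = 2 * ln (norm x)" unfolding L_def s_def using x by (simp add: ln_realpow)
  finally show ?thesis using x by (simp add: s_def d_def power_mult_distrib)
qed

text \<open>In polar coordinates the square times r^(d-1) is 1/(2 r ln r), with antiderivative (ln
  ln r)/2. Both estimates on dyadic shells rest on this formula.\<close>

lemma subsol_sq:
  fixes x :: "real^'n"
  assumes x: "2 \<le> norm x"
  shows "(subsol x)\<^sup>2 = 1 / (norm x ^ CARD('n) * (2 * ln (norm x)))"
proof -
  let ?s = "(norm x)\<^sup>2"
  have s: "4 \<le> ?s" using power_mono[OF x, of 2] by simp
  have "(?s powr (- (real CARD('n) / 4)))\<^sup>2 = ?s powr (- (real CARD('n) / 2))"
    by (simp add: power2_eq_square powr_add[symmetric])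
  also have "\<dots> = norm x powr (- real CARD('n))"
  proof -
    have e: "?s = norm x powr 2" using x by (subst powr_numeral) auto
    show ?thesis unfolding e by (simp only: powr_powr) simp
  qed
  also have "\<dots> = 1 / norm x ^ CARD('n)"
  proof -
    have "0 < norm x" using x by linarith
    from powr_realpow[OF this, of "CARD('n)"] show ?thesis by (simp add: powr_minus divide_inverse)
  qed
  finally have 1: "(?s powr (- (real CARD('n) / 4)))\<^sup>2 = 1 / norm x ^ CARD('n)" .
  have "(ln ?s powr (- (1/2)))\<^sup>2 = ln ?s powr (- 1)"
    by (simp add: power2_eq_square powr_add[symmetric])
  also have "\<dots> = 1 / (2 * ln (norm x))"
  proof -
    have "0 < ln (norm x)" by (rule ln_gt_zero) (use x in linarith)
    moreover have "ln ?s = 2 * ln (norm x)" using x by (simp add: ln_realpow)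
    ultimately show ?thesis by (simp add: powr_minus_divide)
  qed
  finally have 2: "(ln ?s powr (- (1/2)))\<^sup>2 = 1 / (2 * ln (norm x))" .
  show ?thesis unfolding subsol_def qcut_eq[OF s] power_mult_distrib 1 2 by simp
qed

section \<open>Mass of the radial function on dyadic shells\<close>

lemma measure_ball_pow2:
  "measure lborel (cball (0::real^'n) (2 ^ j)) = unit_ball_vol (real CARD('n)) * (2 ^ j) ^ CARD('n)"
  by (simp add: content_cball)

text \<open>On the shell between N and 2 N the square is at most N^(-d), since 2 ln 2 \<ge> 1, and
  the ball of radius 2 N has volume proportional to N^d. Each doubling thus adds a bounded amount.
  Starting at radius 2 keeps the shells where \<open>subsol_sq\<close> holds.\<close>

lemma sqn_subsol_upper:
  "sqn (2 ^ Suc j) (subsol :: real^'n \<Rightarrow> real)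
    \<le> sqn 2 (subsol :: real^'n \<Rightarrow> real) + real j * (unit_ball_vol (real CARD('n)) * 2 ^ CARD('n))"
proof (induction j)
  case (Suc j)
  let ?N = "2 ^ Suc j :: real"
  have Lc: "L2loc (subsol :: real^'n \<Rightarrow> real)" by (intro L2loc_sm sm_subsol)
  have N: "2 \<le> ?N" using one_le_power[of "2::real" j] by simp
  have "sqn (2 ^ Suc (Suc j)) (subsol :: real^'n \<Rightarrow> real)
     \<le> (LINT x|lborel. indicator (cball 0 ?N) x * (subsol (x::real^'n))\<^sup>2 + indicator (cball 0 (2 ^ Suc (Suc j))) x * (1 / ?N ^ CARD('n)))"
    unfolding sqn_def
  proof (intro integral_mono Bochner_Integration.integrable_add L2loc_int Lc integrable_ball)
    fix x :: "real^'n"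
    show "indicator (cball 0 (2 ^ Suc (Suc j))) x * (subsol x)\<^sup>2
       \<le> indicator (cball 0 ?N) x * (subsol x)\<^sup>2 + indicator (cball 0 (2 ^ Suc (Suc j))) x * (1 / ?N ^ CARD('n))"
    proof (cases "norm x \<le> ?N")
      case False
      then have x: "?N \<le> norm x" "2 \<le> norm x" using N by linarith+
      have "ln 2 \<le> ln (norm x)" using x by (subst ln_le_cancel_iff) auto
      then have l: "1 \<le> 2 * ln (norm x)" using ln2_ge_two_thirds by linarith
      have "?N ^ CARD('n) * 1 \<le> norm x ^ CARD('n) * (2 * ln (norm x))"
        using x l by (intro mult_mono power_mono) auto
      then have "(subsol x)\<^sup>2 \<le> 1 / ?N ^ CARD('n)"
        unfolding subsol_sq[OF x(2)] by (intro frac_le) auto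
      then show ?thesis by (auto simp: indicator_def simp del: power_Suc)
    qed (auto simp: indicator_def simp del: power_Suc)
  qed
  also have "\<dots> = sqn ?N (subsol :: real^'n \<Rightarrow> real) + 1 / ?N ^ CARD('n) * measure lborel (cball (0::real^'n) (2 ^ Suc (Suc j)))"
    by (subst Bochner_Integration.integral_add[OF L2loc_int[OF Lc] integrable_ball]) (simp add: sqn_def)
  also have "1 / ?N ^ CARD('n) * measure lborel (cball (0::real^'n) (2 ^ Suc (Suc j))) = unit_ball_vol (real CARD('n)) * 2 ^ CARD('n)"
  proof -
    have "(2 ^ Suc (Suc j)) ^ CARD('n) = 2 ^ CARD('n) * ?N ^ CARD('n)" by (simp only: power_Suc power_mult_distrib)
    moreover have "?N ^ CARD('n) \<noteq> 0" by simp
    ultimately show ?thesis unfolding measure_ball_pow2 by (simp del: power_Suc)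
  qed
  finally show ?case using Suc.IH by (simp add: distrib_right)
qed simp

text \<open>The shell between 2^(j+1) and 2^(j+2) fills a fixed fraction of the outer ball, and on
  it the square is at least its value at the outer radius, where the logarithm is (j + 2) ln 2. So
  each shell contributes at least a multiple of 1/(j + 1).\<close>

lemma sqn_subsol_lower:
  "\<exists>c>0. \<forall>j. sqn (2 ^ Suc j) (subsol :: real^'n \<Rightarrow> real) \<ge> c * (\<Sum>i<j. inverse (real (Suc i)))"
proof -
  let ?d = "CARD('n)"
  have ln2: "ln 2 \<le> (1::real)" using ln_le_minus_one[of 2] by simp
  \<comment> \<open>1 - 2^(-d) is the fraction of the outer ball that the shell fills; the 4 comes
    from the factor 2 before the logarithm and from j + 2 \<le> 2 (j + 1), with ln 2 \<le>
    1.\<close>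
  define c where "c = unit_ball_vol (real ?d) * (1 - 1 / 2 ^ ?d) / 4"
  have "(1::real) < 2 ^ ?d" by (intro one_less_power) auto
  then have c: "c > 0" unfolding c_def by (intro divide_pos_pos mult_pos_pos) auto
  have Lc: "L2loc (subsol :: real^'n \<Rightarrow> real)" by (intro L2loc_sm sm_subsol)
  have "sqn (2 ^ Suc j) (subsol :: real^'n \<Rightarrow> real) \<ge> c * (\<Sum>i<j. inverse (real (Suc i)))" for j
  proof (induction j)
    case 0
    then show ?case by (simp add: sqn_nonneg)
  next
    case (Suc j)
    let ?N = "2 ^ Suc j :: real" and ?M = "2 ^ Suc (Suc j) :: real"
    have N: "2 \<le> ?N" using one_le_power[of "2::real" j] by simp
    let ?b = "1 / (?M ^ ?d * (2 * (real (Suc (Suc j)) * ln 2)))"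
    have "sqn ?N (subsol :: real^'n \<Rightarrow> real) + (?b * measure lborel (cball (0::real^'n) ?M) - ?b * measure lborel (cball (0::real^'n) ?N))
      = (LINT x|lborel. indicator (cball 0 ?N) x * (subsol (x::real^'n))\<^sup>2 + (indicator (cball 0 ?M) x * ?b - indicator (cball 0 ?N) x * ?b))"
      unfolding sqn_def integral_ball[symmetric]
      by (rule has_bochner_integral_integral_eq[symmetric])
        (intro has_bochner_integral_add has_bochner_integral_diff has_bochner_integral_integrable L2loc_int Lc integrable_ball)
    also have "\<dots> \<le> sqn ?M (subsol :: real^'n \<Rightarrow> real)"
      unfolding sqn_def
    proof (intro integral_mono Bochner_Integration.integrable_add Bochner_Integration.integrable_diff L2loc_int Lc integrable_ball)
      fix x :: "real^'n"
      show "indicator (cball 0 ?N) x * (subsol (x::real^'n))\<^sup>2 + (indicator (cball 0 ?M) x * ?b - indicator (cball 0 ?N) x * ?b)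
        \<le> indicator (cball 0 ?M) x * (subsol x)\<^sup>2"
      proof (cases "norm x \<le> ?N")
        case True
        moreover have "?N \<le> ?M" by simp
        ultimately have "norm x \<le> ?M" by linarith
        with True show ?thesis by (simp del: power_Suc)
      next
        case False
        then have x: "2 \<le> norm x" using N by linarith
        show ?thesis
        proof (cases "norm x \<le> ?M")
          case True
          have "ln (norm x) \<le> ln ?M" using True x by (subst ln_le_cancel_iff) auto
          also have "\<dots> = real (Suc (Suc j)) * ln 2" by (rule ln_realpow)
          finally have l: "ln (norm x) \<le> real (Suc (Suc j)) * ln 2" .
          have "ln 2 \<le> ln (norm x)" using x by (subst ln_le_cancel_iff) auto
          then have l0: "0 < ln (norm x)" using ln2_ge_two_thirds by linarith
          have "norm x ^ ?d * (2 * ln (norm x)) \<le> ?M ^ ?d * (2 * (real (Suc (Suc j)) * ln 2))"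
            using True l l0 by (intro mult_mono power_mono) auto
          then have "?b \<le> (subsol x)\<^sup>2"
            unfolding subsol_sq[OF x] 
            by (intro frac_le) (use l0 x in \<open>auto intro!: mult_pos_pos zero_less_power simp del: power_Suc of_nat_Suc\<close>)
          with False True show ?thesis by (simp del: power_Suc)
        qed (use False in \<open>simp del: power_Suc\<close>)
      qed
    qed
    finally have 1: "sqn ?N (subsol :: real^'n \<Rightarrow> real) + (?b * measure lborel (cball (0::real^'n) ?M) - ?b * measure lborel (cball (0::real^'n) ?N))
      \<le> sqn ?M (subsol :: real^'n \<Rightarrow> real)" .
    have MN: "?M ^ ?d = 2 ^ ?d * ?N ^ ?d" by (simp only: power_Suc power_mult_distrib)
    have "?b * measure lborel (cball (0::real^'n) ?M) - ?b * measure lborel (cball (0::real^'n) ?N)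
      = ?b * (unit_ball_vol (real ?d) * (?M ^ ?d - ?N ^ ?d))"
      unfolding measure_ball_pow2 by (simp add: right_diff_distrib)
    also have "\<dots> = unit_ball_vol (real ?d) * ((?M ^ ?d - ?N ^ ?d) / ?M ^ ?d) / (2 * (real (Suc (Suc j)) * ln 2))"
      by simp
    also have "(?M ^ ?d - ?N ^ ?d) / ?M ^ ?d = 1 - 1 / 2 ^ ?d"
      unfolding MN by (simp add: diff_divide_distrib del: power_Suc)
    also have "unit_ball_vol (real ?d) * (1 - 1 / 2 ^ ?d) / (2 * (real (Suc (Suc j)) * ln 2)) = 4 * c / (2 * (real (Suc (Suc j)) * ln 2))"
      by (simp add: c_def)
    finally have 2: "?b * measure lborel (cball (0::real^'n) ?M) - ?b * measure lborel (cball (0::real^'n) ?N)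
      = 4 * c / (2 * (real (Suc (Suc j)) * ln 2))" .
    have 3: "c * inverse (real (Suc j)) \<le> 4 * c / (2 * (real (Suc (Suc j)) * ln 2))"
    proof -
      have "2 * (real (Suc (Suc j)) * ln 2) \<le> 2 * ((2 * real (Suc j)) * 1)"
        using ln2 by (intro mult_left_mono mult_mono) auto
      then have *: "2 * (real (Suc (Suc j)) * ln 2) \<le> 4 * real (Suc j)" by simp
      have "c * inverse (real (Suc j)) = 4 * c / (4 * real (Suc j))"
        by (simp only: divide_inverse inverse_mult_distrib) simp
      also have "\<dots> \<le> 4 * c / (2 * (real (Suc (Suc j)) * ln 2))"
        by (rule divide_left_mono[OF *]) (use c in \<open>auto intro!: mult_pos_pos simp del: of_nat_Suc\<close>)
      finally show ?thesis .
    qed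
    have "c * (\<Sum>i<Suc j. inverse (real (Suc i))) = c * (\<Sum>i<j. inverse (real (Suc i))) + c * inverse (real (Suc j))"
      by (simp add: distrib_left)
    with 1 3 Suc.IH show ?case unfolding 2 by linarith
  qed
  with c show ?thesis by blast
qed

section \<open>Comparison\<close>

text \<open>Covers both growth rates that occur: bounded for a square integrable solution
  (\<open>B\<close> = 0), and linear in j for \<open>subsol\<close>.\<close>

lemma growth_pow2:
  assumes "\<And>j. 0 \<le> s j" "\<And>j. s j \<le> A + real j * B"
  shows "(\<lambda>j. s j / (2 ^ Suc j)\<^sup>2) \<longlonglongrightarrow> (0::real)"
proof (rule tendsto_sandwich[OF _ _ tendsto_const])
  have "(\<lambda>j. (\<bar>A\<bar> + real j * \<bar>B\<bar>) / 2 ^ j) \<longlonglongrightarrow> 0"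
  proof -
    have "(\<lambda>j. \<bar>A\<bar> * (1/2) ^ j + \<bar>B\<bar> * (real j * (1/2) ^ j)) \<longlonglongrightarrow> \<bar>A\<bar> * 0 + \<bar>B\<bar> * 0"
      by (intro tendsto_intros LIMSEQ_power_zero powser_times_n_limit_0) auto
    then show ?thesis by (simp add: power_one_over add_divide_distrib mult.commute[of _ "\<bar>B\<bar>"])
  qed
  then show "(\<lambda>j. (\<bar>A\<bar> + real j * \<bar>B\<bar>) / 2 ^ j) \<longlonglongrightarrow> 0" .
  show "\<forall>\<^sub>F j in sequentially. s j / (2 ^ Suc j)\<^sup>2 \<le> (\<bar>A\<bar> + real j * \<bar>B\<bar>) / 2 ^ j"
  proof (intro always_eventually allI)
    fix j
    have "s j \<le> \<bar>A\<bar> + real j * \<bar>B\<bar>"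
      using assms(2)[of j] mult_left_mono[of B "\<bar>B\<bar>" "real j"] by linarith
    moreover have "(2::real) ^ j \<le> (2 ^ Suc j)\<^sup>2"
      using power_increasing[of j "Suc j * 2" "2::real"] by (simp only: power_mult[symmetric]) simp
    ultimately show "s j / (2 ^ Suc j)\<^sup>2 \<le> (\<bar>A\<bar> + real j * \<bar>B\<bar>) / 2 ^ j"
      using assms(1)[of j] by (intro frac_le) auto
  qed
qed (use assms in simp)

lemma pow2_at_top: "filterlim (\<lambda>j. 2 ^ Suc j :: real) at_top sequentially"
proof (rule filterlim_at_top_mono[OF filterlim_real_sequentially], intro always_eventually allI)
  fix j :: nat
  have "real j < 2 ^ j" by (rule of_nat_less_two_power)
  also have "(2::real) ^ j \<le> 2 ^ Suc j" by simp
  finally show "real j \<le> 2 ^ Suc j" by simp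
qed

lemma square_integrable_L2loc:
  assumes [measurable]: "h \<in> borel_measurable borel" and i: "integrable lborel (\<lambda>x. (h x)\<^sup>2)"
  shows "L2loc h" "sqn R h \<le> (LINT x|lborel. (h x)\<^sup>2)"
proof -
  have int: "integrable lborel (\<lambda>x. indicator (cball 0 R) x * (h x)\<^sup>2)" for R
    by (rule Bochner_Integration.integrable_bound[OF i]) (auto simp: indicator_def)
  then show "L2loc h" by (simp add: L2loc_def)
  show "sqn R h \<le> (LINT x|lborel. (h x)\<^sup>2)"
    unfolding sqn_def by (rule integral_mono[OF int i]) (auto simp: indicator_def)
qed

lemma nonneg_weak_solution_zero:
  fixes p V :: "real^'n \<Rightarrow> real"
  assumes V: "Lloc V" and pos: "\<And>f. tf f \<Longrightarrow> 0 \<le> (LINT x|lborel. f x * schr V f x)"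
    and R0: "2 \<le> R0"
    and Vle: "\<And>x. R0 \<le> norm x \<Longrightarrow> V x \<le> real CARD('n) * (4 - real CARD('n)) / (4 * (norm x)\<^sup>2)
                 + 1 / ((norm x)\<^sup>2 * ln (norm x)) + 3 / (4 * (norm x)\<^sup>2 * (ln (norm x))\<^sup>2)"
    and pm: "p \<in> borel_measurable borel" and pi: "integrable lborel (\<lambda>x. (p x)\<^sup>2)"
    and nn: "\<And>x. 0 \<le> p x" and w: "weak_lap p (\<lambda>x. V x * p x)"
  shows "AE x in lborel. p x = 0"
proof (rule ccontr)
  assume nz: "\<not> (AE x in lborel. p x = 0)"
  have p: "L2loc p" by (rule square_integrable_L2loc[OF pm pi])
  have Lc: "L2loc (subsol :: real^'n \<Rightarrow> real)" by (intro L2loc_sm sm_subsol)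
  let ?I = "\<lambda>R f. LINT y|lborel. indicator (cball (0::real^'n) R) y * f y"
  have mono: "?I R p \<le> ?I S p" if "R \<le> S" for R S
    by (intro integral_mono bsupp_L2_int bsupp_indicator p) (use that nn in \<open>auto simp: indicator_def\<close>)
  have "\<exists>R>0. 0 < ?I R p"
  proof (rule ccontr)
    assume "\<not> (\<exists>R>0. 0 < ?I R p)"
    then have "?I (real (Suc n)) p \<le> 0" for n by (metis not_le of_nat_0_less_iff zero_less_Suc)
    moreover have "0 \<le> ?I R p" for R by (intro integral_nonneg_AE AE_I2) (simp add: nn)
    ultimately have "?I (real (Suc n)) p = 0" for n by (metis order_antisym)
    then have "AE x in lborel. indicator (cball (0::real^'n) (real (Suc n))) x * p x = 0" for n
      by (subst (asm) integral_nonneg_eq_0_iff_AE[OF bsupp_L2_int[OF bsupp_indicator p]]) (auto simp: nn)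
    then have "AE x in lborel. \<forall>n. indicator (cball (0::real^'n) (real (Suc n))) x * p x = 0"
      unfolding AE_all_countable by blast
    then have "AE x in lborel. p x = 0"
    proof eventually_elim
      case (elim x)
      obtain n where "norm x \<le> real n" using real_arch_simple by blast
      then have "norm x \<le> real (Suc n)" by simp
      with elim[rule_format, of n] show ?case by (simp del: of_nat_Suc)
    qed
    with nz show False ..
  qed
  then obtain R1 where R1: "0 < R1" "0 < ?I R1 p" by blast
  \<comment> \<open>Large enough that \<open>p\<close> has mass in the ball, and beyond
    \<open>R0\<close>: then \<open>h\<close> can be positive, up to a null set, only where the bound
    on \<open>V\<close> is available.\<close>
  define R where "R = max R1 (R0 + 1)"
  have R: "0 < R" "R0 < R" "0 < ?I R p" using R1 R0 mono[of R1 R] by (auto simp: R_def)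
  obtain c0 where c0: "c0 > 0" "AE x in lborel. norm x \<le> R \<longrightarrow> c0 * ?I R p \<le> p x"
    using weak_supersolution_lower_bound[OF V p nn w R(1)] by blast
  obtain M where M: "\<And>x::real^'n. norm x \<le> R \<Longrightarrow> \<bar>subsol x\<bar> \<le> M"
    using continuous_bounded_cball[OF sm_continuous[OF sm_subsol], of R] by blast
  have "0 < M" using M[of 0] subsol_pos[of "0::real^'n"] R by simp
  \<comment> \<open>\<open>M\<close> bounds \<open>subsol\<close> on the ball, so
    \<open>e * subsol\<close> stays below the lower bound of \<open>p\<close> there.\<close>
  define e where "e = c0 * ?I R p / M"
  have e: "0 < e" using c0 R \<open>0 < M\<close> by (simp add: e_def)
  have inner: "AE x in lborel. norm x \<le> R \<longrightarrow> e * subsol x \<le> p x"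
    using c0(2)
  proof eventually_elim
    case (elim x)
    show ?case
    proof
      assume x: "norm x \<le> R"
      have "e * subsol x \<le> e * M" using e M[OF x] by (intro mult_left_mono) auto
      also have "\<dots> = c0 * ?I R p" using \<open>0 < M\<close> by (simp add: e_def)
      finally show "e * subsol x \<le> p x" using elim x by simp
    qed
  qed
  define h where "h x = e * subsol x - p x" for x
  define D where "D x = e * lap subsol x - V x * p x" for x
  have h: "L2loc h" unfolding h_def[abs_def] by (intro L2loc_diff L2loc_cmult Lc p)
  have D: "L2loc D" unfolding D_def[abs_def]
    by (intro L2loc_diff L2loc_cmult L2loc_sm sm_lap sm_subsol L2loc_mult V p)
  have wh: "weak_lap h D" unfolding weak_lap_def
  proof (intro allI impI)
    fix \<phi> :: "real^'n \<Rightarrow> real" assume \<phi>: "tf \<phi>"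
    have z: "Lloc (\<lambda>x::real^'n. 0::real)" by (intro Lloc_continuous continuous_intros)
    have symc: "(LINT x|lborel. subsol x * lap \<phi> x) = (LINT x|lborel. lap subsol x * \<phi> x)"
      using schr_symmetric[OF sm_subsol \<phi> z] by (simp add: schr_def mult.commute)
    have i: "integrable lborel (\<lambda>x. subsol x * lap \<phi> x)" "integrable lborel (\<lambda>x. p x * lap \<phi> x)"
      "integrable lborel (\<lambda>x. lap subsol x * \<phi> x)" "integrable lborel (\<lambda>x. V x * p x * \<phi> x)"
      by (intro bsupp_L2_int' tf_bsupp tf_lap \<phi> Lc p L2loc_sm sm_lap sm_subsol L2loc_mult V)+
    have "(LINT x|lborel. h x * lap \<phi> x) = (LINT x|lborel. e * (subsol x * lap \<phi> x) - p x * lap \<phi> x)"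
      by (simp add: h_def algebra_simps)
    also have "\<dots> = e * (LINT x|lborel. subsol x * lap \<phi> x) - (LINT x|lborel. p x * lap \<phi> x)"
      using i by simp
    also have "\<dots> = e * (LINT x|lborel. lap subsol x * \<phi> x) - (LINT x|lborel. V x * p x * \<phi> x)"
      using w \<phi> by (simp add: symc weak_lap_def)
    also have "\<dots> = (LINT x|lborel. e * (lap subsol x * \<phi> x) - V x * p x * \<phi> x)"
      using i by simp
    also have "\<dots> = (LINT x|lborel. D x * \<phi> x)" by (simp add: D_def algebra_simps)
    finally show "(LINT x|lborel. h x * lap \<phi> x) = (LINT x|lborel. D x * \<phi> x)" .
  qed
  have sub: "AE x in lborel. 0 < h x \<longrightarrow> V x * h x \<le> D x"
    using inner
  proof eventually_elim
    case (elim x)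
    show ?case
    proof
      assume "0 < h x"
      then have x: "R0 < norm x" using elim R(2) by (fastforce simp: h_def)
      \<comment> \<open>In D - V h the contributions of \<open>p\<close> cancel, leaving
        \<open>e\<close> times the difference of the two sides here.\<close>
      have "V x * subsol x \<le> lap subsol x"
        unfolding lap_subsol[OF order_le_less_trans[OF R0 x]]
        by (intro mult_right_mono Vle less_imp_le[OF subsol_pos] less_imp_le[OF x])
      then have "e * (V x * subsol x) \<le> e * lap subsol x" using e by simp
      then show "V x * h x \<le> D x" by (simp add: h_def D_def algebra_simps)
    qed
  qed
  define u where "u x = max (h x) 0" for x
  have u: "L2loc u"
    by (rule L2loc_bound[OF h]) (use h in \<open>auto simp: u_def[abs_def] L2loc_def intro!: exI[of _ 1]\<close>)
  have "(\<lambda>j. sqn (2 ^ Suc j) u / (2 ^ Suc j)\<^sup>2) \<longlonglongrightarrow> 0"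
  proof (rule growth_pow2[OF sqn_nonneg])
    fix j
    let ?N = "2 ^ Suc j :: real" and ?B = "unit_ball_vol (real CARD('n)) * 2 ^ CARD('n)"
    have "sqn ?N u \<le> 2 * e\<^sup>2 * sqn ?N (subsol :: real^'n \<Rightarrow> real) + 2 * 0\<^sup>2 * measure lborel (cball (0::real^'n) ?N)"
    proof (rule sqn_mono_AE[OF u Lc], rule AE_I2)
      fix x :: "real^'n"
      have "\<bar>u x\<bar> \<le> e * \<bar>subsol x\<bar>" using nn[of x] e subsol_pos[of x] by (auto simp: u_def h_def max_def)
      then show "norm x \<le> ?N \<longrightarrow> \<bar>u x\<bar> \<le> e * \<bar>subsol x\<bar> + 0" by simp
    qed
    also have "\<dots> = 2 * e\<^sup>2 * sqn ?N (subsol :: real^'n \<Rightarrow> real)" by simp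
    also have "\<dots> \<le> 2 * e\<^sup>2 * (sqn 2 (subsol :: real^'n \<Rightarrow> real) + real j * ?B)"
      by (intro mult_left_mono sqn_subsol_upper) auto
    also have "\<dots> = 2 * e\<^sup>2 * sqn 2 (subsol :: real^'n \<Rightarrow> real) + real j * (2 * e\<^sup>2 * ?B)"
      by (simp add: algebra_simps)
    finally show "sqn ?N u \<le> 2 * e\<^sup>2 * sqn 2 (subsol :: real^'n \<Rightarrow> real) + real j * (2 * e\<^sup>2 * ?B)" .
  qed
  then have wu: "weak_lap u (\<lambda>x. V x * u x)"
    unfolding u_def by (intro positive_part_weak_solution[OF V pos h D wh sub pow2_at_top])
  have u0: "AE x in lborel. norm x \<le> R \<longrightarrow> u x = 0"
    using inner by eventually_elim (simp add: u_def h_def)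
  \<comment> \<open>Otherwise \<open>u\<close> would exceed a positive constant almost everywhere on
    the larger ball, although it vanishes on the inner ball, which has positive measure.\<close>
  have Iu: "?I S u = 0" if S: "R \<le> S" for S
  proof -
    have S0: "0 < S" using S R by simp
    obtain c where c: "c > 0" "AE x in lborel. norm x \<le> S \<longrightarrow> c * ?I S u \<le> u x"
      using weak_supersolution_lower_bound[OF V u _ wu S0] by (auto simp: u_def)
    have "0 \<le> ?I S u" by (intro integral_nonneg_AE AE_I2) (simp add: u_def)
    moreover have "c * ?I S u \<le> 0"
    proof (rule ccontr)
      assume *: "\<not> c * ?I S u \<le> 0"
      have "AE x in lborel. x \<notin> cball (0::real^'n) R"
        using c(2) u0 by eventually_elim (use * S in auto)
      then have "cball (0::real^'n) R \<in> null_sets lborel" by (simp add: AE_iff_null_sets)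
      then have "measure lborel (cball (0::real^'n) R) = 0" by (simp add: measure_def null_setsD1)
      moreover have "0 < measure lborel (cball (0::real^'n) R)" using R by (simp add: content_cball)
      ultimately show False by simp
    qed
    ultimately show ?thesis using c(1) by (simp add: mult_le_0_iff)
  qed
  have le: "AE x in lborel. norm x \<le> S \<longrightarrow> e * subsol x \<le> p x" if "R \<le> S" for S
  proof -
    have "AE x in lborel. indicator (cball (0::real^'n) S) x * u x = 0"
      using Iu[OF that]
      by (subst (asm) integral_nonneg_eq_0_iff_AE[OF bsupp_L2_int[OF bsupp_indicator u]]) (auto simp: u_def)
    then show ?thesis by eventually_elim (auto simp: u_def h_def indicator_def max_def split: if_splits)
  qed
  obtain c where c: "c > 0" "\<And>j. c * (\<Sum>i<j. inverse (real (Suc i))) \<le> sqn (2 ^ Suc j) (subsol :: real^'n \<Rightarrow> real)"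
    using sqn_subsol_lower[where 'n='n] by blast
  let ?P = "LINT x|lborel. (p x)\<^sup>2"
  have bnd: "sqn S (subsol :: real^'n \<Rightarrow> real) \<le> 2 * (1 / e)\<^sup>2 * ?P" if "R \<le> S" for S
  proof -
    have "sqn S (subsol :: real^'n \<Rightarrow> real) \<le> 2 * (1 / e)\<^sup>2 * sqn S p + 2 * 0\<^sup>2 * measure lborel (cball (0::real^'n) S)"
    proof (rule sqn_mono_AE[OF Lc p])
      show "AE x in lborel. norm x \<le> S \<longrightarrow> \<bar>subsol x\<bar> \<le> 1 / e * \<bar>p x\<bar> + 0"
        using le[OF that]
      proof eventually_elim
        case (elim x)
        then show ?case using e nn[of x] subsol_pos[of x] by (auto simp: field_simps)
      qed
    qed
    also have "\<dots> \<le> 2 * (1 / e)\<^sup>2 * ?P"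
      using square_integrable_L2loc(2)[OF pm pi, of S] by (simp add: mult_left_mono divide_right_mono)
    finally show ?thesis .
  qed
  \<comment> \<open>Shifting the index by \<open>j0\<close> moves all radii beyond \<open>R\<close>,
    where \<open>bnd\<close> holds. The shift only enlarges the harmonic sum, so the bound covers
    every j.\<close>
  obtain j0 :: nat where j0: "R < 2 ^ j0" using real_arch_pow[of 2 R] by auto
  have "(\<Sum>i<j. inverse (real (Suc i))) \<le> 2 * (1 / e)\<^sup>2 * ?P / c" for j
  proof -
    have "c * (\<Sum>i<j. inverse (real (Suc i))) \<le> c * (\<Sum>i<j + j0. inverse (real (Suc i)))"
      using c by (intro mult_left_mono sum_mono2) auto
    also have "\<dots> \<le> sqn (2 ^ Suc (j + j0)) (subsol :: real^'n \<Rightarrow> real)" by (rule c)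
    also have "\<dots> \<le> 2 * (1 / e)\<^sup>2 * ?P"
    proof (rule bnd)
      have "(2::real) ^ j0 \<le> 2 ^ Suc (j + j0)" by (rule power_increasing) auto
      with j0 show "R \<le> 2 ^ Suc (j + j0)" by linarith
    qed
    finally show ?thesis using c by (simp add: le_divide_eq mult.commute)
  qed
  then have "summable (\<lambda>i. inverse (real (Suc i)))" by (intro summableI_nonneg_bounded) auto
  then show False using not_summable_harmonic[where 'a=real] summable_Suc_iff[of "\<lambda>i. inverse (real i)"] by blast
qed

lemma weak_lapI_schr:
  fixes h V :: "real^'n \<Rightarrow> real"
  assumes "L2loc h" "Lloc V" "\<And>\<phi>. tf \<phi> \<Longrightarrow> (LINT x|lborel. h x * schr V \<phi> x) = 0"
  shows "weak_lap h (\<lambda>x. V x * h x)"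
  unfolding weak_lap_def
proof (intro allI impI)
  fix \<phi> :: "real^'n \<Rightarrow> real" assume \<phi>: "tf \<phi>"
  have "integrable lborel (\<lambda>x. \<phi> x * (V x * h x))" "integrable lborel (\<lambda>x. lap \<phi> x * h x)"
    by (intro tf_L2_int tf_lap \<phi> L2loc_mult assms)+
  then have "(LINT x|lborel. h x * schr V \<phi> x) = (LINT x|lborel. \<phi> x * (V x * h x)) - (LINT x|lborel. lap \<phi> x * h x)"
    by (simp add: Bochner_Integration.integral_diff[symmetric] schr_def algebra_simps del: Bochner_Integration.integral_diff)
  then show "(LINT x|lborel. h x * lap \<phi> x) = (LINT x|lborel. V x * h x * \<phi> x)"
    using assms(3)[OF \<phi>] by (simp add: mult_ac)
qed

text \<open>A zero mode satisfies the subsolution inequality with equality, and its positive part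
  has bounded mass, so \<open>positive_part_weak_solution\<close> applies along the radii 2^(j+1).
  The resulting nonnegative solution falls under \<open>nonneg_weak_solution_zero\<close>.\<close>

lemma weak_zero_mode_positive_part:
  fixes h V :: "real^'n \<Rightarrow> real"
  assumes V: "Lloc V" and pos: "\<And>f. tf f \<Longrightarrow> 0 \<le> (LINT x|lborel. f x * schr V f x)"
    and R0: "2 \<le> R0"
    and Vle: "\<And>x. R0 \<le> norm x \<Longrightarrow> V x \<le> real CARD('n) * (4 - real CARD('n)) / (4 * (norm x)\<^sup>2)
                 + 1 / ((norm x)\<^sup>2 * ln (norm x)) + 3 / (4 * (norm x)\<^sup>2 * (ln (norm x))\<^sup>2)"
    and hm[measurable]: "h \<in> borel_measurable borel" and hi: "integrable lborel (\<lambda>x. (h x)\<^sup>2)"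
    and zero: "\<And>\<phi>. tf \<phi> \<Longrightarrow> (LINT x|lborel. h x * schr V \<phi> x) = 0"
  shows "AE x in lborel. h x \<le> 0"
proof -
  have h: "L2loc h" by (rule square_integrable_L2loc[OF hm hi])
  let ?p = "\<lambda>x. max (h x) 0"
  have pm: "?p \<in> borel_measurable borel" by measurable
  have pi: "integrable lborel (\<lambda>x. (?p x)\<^sup>2)"
    by (rule Bochner_Integration.integrable_bound[OF hi]) (auto simp: max_def)
  have "(\<lambda>j. sqn (2 ^ Suc j) ?p / (2 ^ Suc j)\<^sup>2) \<longlonglongrightarrow> 0"
  proof (rule growth_pow2[OF sqn_nonneg])
    show "sqn (2 ^ Suc j) ?p \<le> (LINT x|lborel. (?p x)\<^sup>2) + real j * 0" for j
      using square_integrable_L2loc(2)[OF pm pi] by simp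
  qed
  then have "weak_lap ?p (\<lambda>x. V x * ?p x)"
    by (intro positive_part_weak_solution[OF V pos h L2loc_mult[OF V h] weak_lapI_schr[OF h V zero] _ pow2_at_top]) auto
  then have "AE x in lborel. ?p x = 0"
    by (intro nonneg_weak_solution_zero[OF V pos R0 Vle pm pi]) auto
  then show ?thesis by eventually_elim (simp add: max_def split: if_splits)
qed

lemma weak_zero_mode_trivial:
  fixes h V :: "real^'n \<Rightarrow> real"
  assumes V: "Lloc V" and pos: "\<And>f. tf f \<Longrightarrow> 0 \<le> (LINT x|lborel. f x * schr V f x)"
    and R0: "2 \<le> R0"
    and Vle: "\<And>x. R0 \<le> norm x \<Longrightarrow> V x \<le> real CARD('n) * (4 - real CARD('n)) / (4 * (norm x)\<^sup>2)
                 + 1 / ((norm x)\<^sup>2 * ln (norm x)) + 3 / (4 * (norm x)\<^sup>2 * (ln (norm x))\<^sup>2)"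
    and hm: "h \<in> borel_measurable borel" and hi: "integrable lborel (\<lambda>x. (h x)\<^sup>2)"
    and zero: "\<And>\<phi>. tf \<phi> \<Longrightarrow> (LINT x|lborel. h x * schr V \<phi> x) = 0"
  shows "AE x in lborel. h x = 0"
proof -
  have "AE x in lborel. h x \<le> 0"
    by (rule weak_zero_mode_positive_part[OF V pos R0 Vle hm hi zero])
  moreover have "AE x in lborel. - h x \<le> 0"
    by (rule weak_zero_mode_positive_part[OF V pos R0 Vle]) (use hm hi zero in auto)
  ultimately show ?thesis by eventually_elim simp
qed

section \<open>From the operator to the weak formulation\<close>

lemma Linfty_loc_imp_Lloc: assumes "Linfty_loc V" shows "Lloc V"
  unfolding Lloc_def
proof (intro conjI allI)
  show "V \<in> borel_measurable borel" using assms by (simp add: Linfty_loc_def)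
  fix R
  obtain C where C: "AE x in lborel. x \<in> cball 0 R \<longrightarrow> \<bar>V x\<bar> \<le> C"
    using assms unfolding Linfty_loc_def by (meson compact_cball)
  then have "AE x in lborel. norm x \<le> R \<longrightarrow> \<bar>V x\<bar> \<le> max C 0"
    by eventually_elim auto
  then show "\<exists>C\<ge>0. AE x in lborel. norm x \<le> R \<longrightarrow> \<bar>V x\<bar> \<le> C"
    by (intro exI[of _ "max C 0"]) simp
qed

lemma realisation_test_fun:
  assumes "schroedinger_realisation V H" "tf \<phi>"
  shows "((\<lambda>x. complex_of_real (\<phi> x)), (\<lambda>x. complex_of_real (schr V \<phi> x))) \<in> H"
proof -
  have "(\<lambda>x. - laplacian (\<lambda>x. complex_of_real (\<phi> x)) x + complex_of_real (V x) * complex_of_real (\<phi> x))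
    = (\<lambda>x. complex_of_real (schr V \<phi> x))"
    by (simp add: tf_imp_test_fun(2)[OF assms(2)] schr_def)
  with assms(1) tf_imp_test_fun(1)[OF assms(2)] show ?thesis
    unfolding schroedinger_realisation_def by metis
qed

lemma realisation_form_nonneg:
  assumes "schroedinger_realisation V H" "nonneg_op H" "tf f"
  shows "0 \<le> (LINT x|lborel. f x * schr V f x)"
proof -
  have "0 \<le> Re (ip (\<lambda>x. complex_of_real (f x)) (\<lambda>x. complex_of_real (schr V f x)))"
    using assms(2) realisation_test_fun[OF assms(1,3)] unfolding nonneg_op_def by blast
  also have "ip (\<lambda>x. complex_of_real (f x)) (\<lambda>x. complex_of_real (schr V f x))
     = complex_of_real (LINT x|lborel. f x * schr V f x)"
    by (simp add: ip_def flip: of_real_mult)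
  finally show ?thesis by simp
qed

text \<open>Self-adjointness places \<open>(\<psi>, g)\<close> in the adjoint graph of
  \<open>H\<close>; testing there with the pair of \<open>\<phi>\<close> and
  \<open>schr V \<phi>\<close> moves the operator onto \<open>\<phi>\<close>. As
  \<open>\<phi>\<close> and \<open>V\<close> are real, the resulting complex identity splits into
  real and imaginary parts.\<close>

lemma realisation_zero_mode:
  assumes H: "schroedinger_realisation V H" and V: "Lloc V" and \<psi>: "(\<psi>, g) \<in> H" and g: "AE x in lborel. g x = 0"
  shows "(\<lambda>x. Re (\<psi> x)) \<in> borel_measurable borel" "(\<lambda>x. Im (\<psi> x)) \<in> borel_measurable borel"
    and "integrable lborel (\<lambda>x. (Re (\<psi> x))\<^sup>2)" "integrable lborel (\<lambda>x. (Im (\<psi> x))\<^sup>2)"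
    and "tf \<phi> \<Longrightarrow> (LINT x|lborel. Re (\<psi> x) * schr V \<phi> x) = 0"
    and "tf \<phi> \<Longrightarrow> (LINT x|lborel. Im (\<psi> x) * schr V \<phi> x) = 0"
proof -
  have adj: "H = adjoint_graph H" and L: "L2 \<psi>" "L2 g"
    using H \<psi> unfolding schroedinger_realisation_def self_adjoint_op_def by auto
  have [measurable]: "\<psi> \<in> borel_measurable borel" "g \<in> borel_measurable borel"
    using L by (auto simp: L2_def)
  have i: "integrable lborel (\<lambda>x. (cmod (\<psi> x))\<^sup>2)" using L by (simp add: L2_def)
  show m: "(\<lambda>x. Re (\<psi> x)) \<in> borel_measurable borel" "(\<lambda>x. Im (\<psi> x)) \<in> borel_measurable borel"
    by measurable
  show si: "integrable lborel (\<lambda>x. (Re (\<psi> x))\<^sup>2)" "integrable lborel (\<lambda>x. (Im (\<psi> x))\<^sup>2)"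
    by (rule Bochner_Integration.integrable_bound[OF i]; simp add: cmod_power2)+
  assume \<phi>: "tf \<phi>"
  have ints: "integrable lborel (\<lambda>x. Re (\<psi> x) * schr V \<phi> x)" "integrable lborel (\<lambda>x. Im (\<psi> x) * schr V \<phi> x)"
    by (intro schr_L2_int \<phi> V square_integrable_L2loc(1) m si)+
  have "(\<psi>, g) \<in> adjoint_graph H" using \<psi> adj by simp
  then have "ip (\<lambda>x. complex_of_real (schr V \<phi> x)) \<psi> = ip (\<lambda>x. complex_of_real (\<phi> x)) g"
    using realisation_test_fun[OF H \<phi>] unfolding adjoint_graph_def by blast
  also have "\<dots> = 0"
  proof -
    have "AE x in lborel. cnj (complex_of_real (\<phi> x)) * g x = 0" using g by eventually_elim simp
    then show ?thesis unfolding ip_def by (rule integral_eq_zero_AE)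
  qed
  finally have 0: "ip (\<lambda>x. complex_of_real (schr V \<phi> x)) \<psi> = 0" .
  have "ip (\<lambda>x. complex_of_real (schr V \<phi> x)) \<psi>
    = (LINT x|lborel. complex_of_real (Re (\<psi> x) * schr V \<phi> x) + \<i> * complex_of_real (Im (\<psi> x) * schr V \<phi> x))"
    unfolding ip_def by (intro Bochner_Integration.integral_cong refl) (simp add: complex_eq_iff)
  also have "\<dots> = complex_of_real (LINT x|lborel. Re (\<psi> x) * schr V \<phi> x) + \<i> * complex_of_real (LINT x|lborel. Im (\<psi> x) * schr V \<phi> x)"
    by (rule has_bochner_integral_integral_eq)
      (intro has_bochner_integral_add has_bochner_integral_mult_right has_bochner_integral_of_real has_bochner_integral_integrable ints)
  finally show "(LINT x|lborel. Re (\<psi> x) * schr V \<phi> x) = 0" "(LINT x|lborel. Im (\<psi> x) * schr V \<phi> x) = 0"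
    using 0 by (simp_all add: complex_eq_iff)
qed

theorem theorem2:
  fixes V :: "real^'n \<Rightarrow> real"
    and H :: "((real^'n \<Rightarrow> complex) \<times> (real^'n \<Rightarrow> complex)) set"
    and R0 :: real
  assumes "Linfty_loc V"
    and "schroedinger_realisation V H"
    and "nonneg_op H"
    and "R0 > 1"
    and "\<forall>x. norm x \<ge> R0 \<longrightarrow>
           V x \<le> real CARD('n) * (4 - real CARD('n)) / (4 * (norm x)\<^sup>2)
                 + 1 / ((norm x)\<^sup>2 * ln (norm x))
                 + 3 / (4 * (norm x)\<^sup>2 * (ln (norm x))\<^sup>2)"
  shows "\<not> (\<exists>\<psi> g. (\<psi>, g) \<in> H \<and> \<not> (AE x in lborel. \<psi> x = 0) \<and> (AE x in lborel. g x = 0))"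
proof
  assume "\<exists>\<psi> g. (\<psi>, g) \<in> H \<and> \<not> (AE x in lborel. \<psi> x = 0) \<and> (AE x in lborel. g x = 0)"
  then obtain \<psi> g where \<psi>: "(\<psi>, g) \<in> H" and nz: "\<not> (AE x in lborel. \<psi> x = 0)"
    and g: "AE x in lborel. g x = 0" by blast
  have V: "Lloc V" by (rule Linfty_loc_imp_Lloc[OF assms(1)])
  note zm = realisation_zero_mode[OF assms(2) V \<psi> g]
  \<comment> \<open>The explicit formulas for \<open>subsol\<close> start at |x| = 2, hence the
    radius \<open>max R0 2\<close>; the bound on \<open>V\<close> persists on the smaller
    region.\<close>
  note trivial = weak_zero_mode_trivial[of V "max R0 2", OF V realisation_form_nonneg[OF assms(2,3)]]
  have "AE x in lborel. Re (\<psi> x) = 0"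
    by (rule trivial) (use zm assms(5) in auto)
  moreover have "AE x in lborel. Im (\<psi> x) = 0"
    by (rule trivial) (use zm assms(5) in auto)
  ultimately have "AE x in lborel. \<psi> x = 0"
    by eventually_elim (simp add: complex_eq_iff)
  with nz show False ..
qed

end
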